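(* Assume that $(A_1)$–$(A_3)$ hold. There exists $\delta>0$ such that for every $\varepsilon\in(0,\delta)$ the following holds. For every $\omega\in\Omega$ and $x_0\in\mathbb R^{n_1}$, the system of integral equations, for $t\le0$, $$\tilde x^\varepsilon(t)=e^{S\varepsilon t}x_0+\varepsilon\int_0^te^{S\varepsilon(t-s)}g_1(\tilde x^\varepsilon(s),\tilde y^\varepsilon(s)+\sigma\xi(\theta_s\omega))ds,\qquad \tilde y^\varepsilon(t)=\int_{-\infty}^te^{F(t-s)}g_2(\tilde x^\varepsilon(s),\tilde y^\varepsilon(s)+\sigma\xi(\theta_s\omega))ds,$$ with $(\tilde x^\varepsilon(0),\tilde y^\varepsilon(0))=(x_0,y_0)$ (where $y_0$ is the value determined by the second equation), has a unique solution $\tilde\phi^\varepsilon(t,\omega,(x_0,y_0))=(\tilde x^\varepsilon(t),\tilde y^\varepsilon(t))$ in $C_{-\gamma}^-$. Further, the random dynamical system generated by $$d\tilde x^\varepsilon=\varepsilon S\tilde x^\varepsilon dt+\varepsilon g_1(\tilde x^\varepsilon,\tilde y^\varepsilon+\sigma\xi(\theta_t\omega))dt,\qquad d\tilde y^\varepsilon=F\tilde y^\varepsilon dt+g_2(\tilde x^\varepsilon,\tilde y^\varepsilon+\sigma\xi(\theta_t\omega))dt$$ has a slow manifold $$\tilde{\mathcal M}^\varepsilon(\omega)=\{(x_0,y_0)\in\mathbb R^n:\tilde\phi^\varepsilon(\cdot,\omega,(x_0,y_0))\in C_{-\gamma}^-\}=\{(x_0,\tilde h^\varepsilon(\omega,x_0)):x_0\in\mathbb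 R^{n_1}\},$$ where $$\tilde h^\varepsilon(\omega,x_0)=\int_{-\infty}^0e^{-Fs}g_2(\tilde x^\varepsilon(s),\tilde y^\varepsilon(s)+\sigma\xi(\theta_s\omega))ds$$ (with $(\tilde x^\varepsilon,\tilde y^\varepsilon)$ the unique solution in $C_{-\gamma}^-$ of the system of integral equations $\tilde x^\varepsilon(t)=e^{S\varepsilon t}x_0+\varepsilon\int_0^te^{S\varepsilon(t-s)}g_1(\tilde x^\varepsilon(s),\tilde y^\varepsilon(s)+\sigma\xi(\theta_s\omega))ds$, $\tilde y^\varepsilon(t)=\int_{-\infty}^te^{F(t-s)}g_2(\tilde x^\varepsilon(s),\tilde y^\varepsilon(s)+\sigma\xi(\theta_s\omega))ds$, $t\le0$) is Lipschitz continuous in $x_0$ with $$\mathrm{Lip}\,\tilde h^\varepsilon(\omega,\cdot)\le-\frac{K}{(\gamma+\gamma_f)(1-\rho(\varepsilon))},\qquad\omega\in\Omega.$$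
   Context: Setting. $|\cdot|$ is the Euclidean norm, $n=n_1+n_2$, $\sigma>0$, $1<\alpha<2$. $S$ is an $n_1\times n_1$ matrix all of whose eigenvalues have non-negative real part, $F$ is an $n_2\times n_2$ matrix all of whose eigenvalues have negative real part, and $g_i:\mathbb R^{n_1}\times\mathbb R^{n_2}\to\mathbb R^{n_i}$ ($i=1,2$) are Lipschitz continuous with $g_i(0,0)=0$. Hypotheses. $(A_1)$: there are constants $\gamma_s>0$ and $\gamma_f<0$ such that $|e^{St}x|\le e^{\gamma_st}|x|$ for $t\le0$, $x\in\mathbb R^{n_1}$, and $|e^{Ft}y|\le e^{\gamma_ft}|y|$ for $t\ge0$, $y\in\mathbb R^{n_2}$. $(A_2)$: there is $K>0$ with $|g_i(x_1,y_1)-g_i(x_2,y_2)|\le K(|x_1-x_2|+|y_1-y_2|)$ for all $(x_j,y_j)\in\mathbb R^n$, $i=1,2$. $(A_3)$: $K<-\gamma_f$. A number $\gamma>0$ with $K<-(\gamma+\gamma_f)$ is fixed. Put $\rho(\varepsilon):=\frac{\varepsilon K}{\gamma+\varepsilon\gamma_s}-\frac{K}{\gamma+\gamma_f}$. Noise. $\Omega=\mathcal D_0(\mathbb R,\mathbb R^{n_2})$ is the space of càdlàg functions $\omega:\mathbb R\to\mathbb R^{n_2}$ with $\omega(0)=0$, with the Borel $\sigma$-algebra of the Skorokhod topology; $\mathbb P$ is the law making $L_t^\alpha(\omega)=\omega(t)$ a two-sided $\alpha$-stable Lévy process; $\theta_t\omega=\omega(\cdot+t)-\omega(t)$ is the shift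 flow, which preserves $\mathbb P$. $\Omega$ is replaced, without change of notation, by a $\theta$-invariant subset of full measure on which $\xi(\omega)=\int_{-\infty}^0e^{-Fs}dL_s^\alpha(\omega)$ is defined, $t\mapsto\xi(\theta_t\omega)$ is the càdlàg stationary solution of $d\xi=F\xi\,dt+dL_t^\alpha$ (with sublinear growth in $t$), and the random differential system in the claim is solvable for every initial condition. In the set-builder definition of $\tilde{\mathcal M}^\varepsilon(\omega)$, $\tilde\phi^\varepsilon(\cdot,\omega,(x_0,y_0))$ is the solution of that random differential system starting at $(x_0,y_0)$ at time $0$. $C_{-\gamma}^-$ is the Banach space of continuous $(\phi^s,\phi^f):(-\infty,0]\to\mathbb R^{n_1}\times\mathbb R^{n_2}$ with finite norm $\sup_{t\le0}|e^{\gamma t}\phi^s_t|+\sup_{t\le0}|e^{\gamma t}\phi^f_t|$. Slow manifold. For a random dynamical system $\varphi$ on $\mathbb R^n$ over $\theta$ (jointly measurable, $\varphi(0,\omega,\cdot)=\mathrm{id}$, $\varphi(t+s,\omega,\cdot)=\varphi(t,\theta_s\omega,\varphi(s,\omega,\cdot))$), a random set is a family of nonempty closed sets $M(\omega)$ with $\omega\mapsto\inf_{z'\in M(\omega)}|z-z'|$ measurable for every $z$; it is (positively) invariant if $\varphi(t,\omega,M(\omega))\subseteq M(\theta_t\omega)$ (for $t\ge0$). A Lipschitz invariant manifold is an invariant random set that is the graph $\{(x,h(\omega,x)):x\in\mathbb R^{n_1}\}$ with $h(\omega,\cdot)$ Lipschitz for every $\omega$ and $h(\cdot,x)$ a random variable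 for every $x$. It has the exponential tracking property if for all $\omega\in\Omega$ and every $z\in\mathbb R^n$ there is $z'\in M(\omega)$ with $|\varphi(t,\omega,z)-\varphi(t,\omega,z')|\le C(z,z',\omega)e^{-ct}|z-z'|$ for $t\ge0$, where $C$ is a positive random variable depending on $z,z'$ and $c>0$ is a constant. A slow manifold is a Lipschitz invariant manifold with the exponential tracking property. *)

theory Defs
  imports "HOL-Probability.Probability"
begin

section \<open>Matrices\<close>

text \<open>The type of square matrices carries no ring structure in the library (multiplication on
  vectors is componentwise), so the exponential series is written out with the matrix product.\<close>

definition matrix_exp :: "real ^ 'n ^ 'n \<Rightarrow> real ^ 'n ^ 'n" where
  "matrix_exp A = (\<Sum>k. (1 / fact k) *\<^sub>R (((**) A ^^ k) (mat 1)))"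

definition complex_eigenvalue :: "real ^ 'n ^ 'n \<Rightarrow> complex \<Rightarrow> bool" where
  "complex_eigenvalue A l \<longleftrightarrow>
     (\<exists>v :: complex ^ 'n. v \<noteq> 0 \<and> (\<chi> i j. complex_of_real (A $ i $ j)) *v v = l *s v)"


section \<open>Two-sided paths and the Skorokhod topology\<close>

definition cadlag :: "(real \<Rightarrow> 'a::topological_space) \<Rightarrow> bool" where
  "cadlag w \<longleftrightarrow> (\<forall>t. (w \<longlongrightarrow> w t) (at_right t) \<and> (\<exists>l. (w \<longlongrightarrow> l) (at_left t)))"

definition cadlag0 :: "(real \<Rightarrow> 'a::real_normed_vector) set" where
  "cadlag0 = {w. cadlag w \<and> w 0 = 0}"

text \<open>Basic neighbourhoods of the (local, J1) Skorokhod topology: a time change, i.e. an increasing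
  bijection of the line, that is uniformly close to the identity brings the paths uniformly close
  on a compact interval. A sequence \<open>w n\<close> converges to \<open>w\<close> iff there are time changes
  \<open>l n\<close> with \<open>l n \<longlongrightarrow> id\<close> uniformly and
  \<open>w n \<circ> l n \<longlongrightarrow> w\<close> uniformly on compacts.\<close>

definition skorokhod_nbhd ::
    "(real \<Rightarrow> 'a::real_normed_vector) \<Rightarrow> real \<Rightarrow> real \<Rightarrow> (real \<Rightarrow> 'a) set" where
  "skorokhod_nbhd w N r =
     {w' \<in> cadlag0. \<exists>l :: real \<Rightarrow> real. strict_mono l \<and> surj l \<and>
        (\<forall>t. \<bar>l t - t\<bar> < r) \<and> (\<forall>t. \<bar>t\<bar> \<le> N \<longrightarrow> norm (w' (l t) - w t) < r)}"

definition skorokhod_topology :: "(real \<Rightarrow> 'a::real_normed_vector) topology" where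
  "skorokhod_topology = topology (\<lambda>U. U \<subseteq> cadlag0 \<and>
     (\<forall>w\<in>U. \<exists>N. \<exists>r>0. skorokhod_nbhd w N r \<subseteq> U))"

lemma skorokhod_nbhd_mono:
  "N' \<le> N \<Longrightarrow> r \<le> r' \<Longrightarrow> skorokhod_nbhd w N r \<subseteq> skorokhod_nbhd w N' r'"
  unfolding skorokhod_nbhd_def by clarify (meson order_less_le_trans order_trans)

lemma openin_skorokhod_topology:
  "openin skorokhod_topology U \<longleftrightarrow>
     U \<subseteq> cadlag0 \<and> (\<forall>w\<in>U. \<exists>N. \<exists>r>0. skorokhod_nbhd w N r \<subseteq> U)"
proof -
  let ?P = "\<lambda>U :: (real \<Rightarrow> 'a) set.
    U \<subseteq> cadlag0 \<and> (\<forall>w\<in>U. \<exists>N. \<exists>r>0. skorokhod_nbhd w N r \<subseteq> U)"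
  have "?P (U \<inter> V)" if U: "?P U" and V: "?P V" for U V
  proof (intro conjI ballI)
    show "U \<inter> V \<subseteq> cadlag0" using U by blast
    fix w assume "w \<in> U \<inter> V"
    then obtain N1 r1 N2 r2 where "r1 > 0" "skorokhod_nbhd w N1 r1 \<subseteq> U"
      and "r2 > 0" "skorokhod_nbhd w N2 r2 \<subseteq> V"
      using U V by (meson IntE)
    moreover have "skorokhod_nbhd w (max N1 N2) (min r1 r2) \<subseteq> skorokhod_nbhd w N1 r1"
      "skorokhod_nbhd w (max N1 N2) (min r1 r2) \<subseteq> skorokhod_nbhd w N2 r2"
      by (simp_all add: skorokhod_nbhd_mono)
    ultimately show "\<exists>N. \<exists>r>0. skorokhod_nbhd w N r \<subseteq> U \<inter> V"
      by (intro exI[of _ "max N1 N2"] exI[of _ "min r1 r2"]) auto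
  qed
  moreover have "?P (\<Union>\<K>)" if "\<forall>K\<in>\<K>. ?P K" for \<K>
    using that by (meson Union_iff Union_least Union_upper order_trans)
  ultimately have "istopology ?P"
    unfolding istopology_def by blast
  then show ?thesis
    by (simp add: skorokhod_topology_def topology_inverse')
qed

definition skorokhod_borel :: "(real \<Rightarrow> 'a::real_normed_vector) measure" where
  "skorokhod_borel = sigma cadlag0 {U. openin skorokhod_topology U}"

definition wshift :: "real \<Rightarrow> (real \<Rightarrow> 'a::real_normed_vector) \<Rightarrow> real \<Rightarrow> 'a" where
  "wshift t w = (\<lambda>s. w (s + t) - w t)"


section \<open>Two-sided stable Levy processes\<close>

definition two_sided_levy ::
    "'w measure \<Rightarrow> (real \<Rightarrow> 'w \<Rightarrow> 'a::euclidean_space) \<Rightarrow> bool" where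
  "two_sided_levy P L \<longleftrightarrow>
     prob_space P \<and>
     (\<forall>t. L t \<in> borel_measurable P) \<and>
     (AE w in P. L 0 w = 0) \<and>
     (\<forall>(t :: nat \<Rightarrow> real) n. strict_mono t \<longrightarrow>
        prob_space.indep_vars P (\<lambda>_. borel) (\<lambda>i w. L (t (Suc i)) w - L (t i) w) {..<n}) \<and>
     (\<forall>s t h. distr P borel (\<lambda>w. L (t + h) w - L (s + h) w)
            = distr P borel (\<lambda>w. L t w - L s w)) \<and>
     (\<forall>s. \<forall>e>0. ((\<lambda>t. measure P {w \<in> space P. norm (L t w - L s w) > e}) \<longlongrightarrow> 0) (at s))"

text \<open>For independent copies \<open>X\<close>, \<open>Y\<close> of the law, \<open>a X + b Y\<close> is equal in law to
  \<open>c X + d\<close> with \<open>c\<close> the \<open>\<alpha>\<close>-norm of \<open>(a, b)\<close>.\<close>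

definition stable_law :: "real \<Rightarrow> 'a::euclidean_space measure \<Rightarrow> bool" where
  "stable_law \<alpha> \<mu> \<longleftrightarrow>
     (\<forall>a>0. \<forall>b>0. \<exists>d.
        distr (\<mu> \<Otimes>\<^sub>M \<mu>) borel (\<lambda>(x, y). a *\<^sub>R x + b *\<^sub>R y)
        = distr \<mu> borel (\<lambda>x. (a powr \<alpha> + b powr \<alpha>) powr (1 / \<alpha>) *\<^sub>R x + d))"

definition two_sided_stable_levy ::
    "real \<Rightarrow> 'w measure \<Rightarrow> (real \<Rightarrow> 'w \<Rightarrow> 'a::euclidean_space) \<Rightarrow> bool" where
  "two_sided_stable_levy \<alpha> P L \<longleftrightarrow>
     two_sided_levy P L \<and> (\<forall>t>0. stable_law \<alpha> (distr P borel (L t)))"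


section \<open>The stationary Ornstein--Uhlenbeck variable\<close>

definition has_stieltjes_integral ::
    "(real \<Rightarrow> real ^ 'm ^ 'm) \<Rightarrow> (real \<Rightarrow> real ^ 'm) \<Rightarrow> real \<Rightarrow> real \<Rightarrow> real ^ 'm \<Rightarrow> bool" where
  "has_stieltjes_integral G w a b I \<longleftrightarrow>
     (\<forall>e>0. \<exists>d>0. \<forall>n (t :: nat \<Rightarrow> real) (\<tau> :: nat \<Rightarrow> real).
        t 0 = a \<and> t n = b \<and>
        (\<forall>i<n. t i < t (Suc i) \<and> t (Suc i) - t i < d \<and> t i \<le> \<tau> i \<and> \<tau> i \<le> t (Suc i)) \<longrightarrow>
        norm ((\<Sum>i<n. G (\<tau> i) *v (w (t (Suc i)) - w (t i))) - I) < e)"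

text \<open>The integrand \<open>exp (- F s)\<close> of the stochastic integral is deterministic and smooth, so the
  integral against a cadlag path is taken pathwise, as an improper Riemann--Stieltjes integral
  from minus infinity to 0. It agrees almost surely with the limit in probability of the
  Riemann sums.\<close>

definition has_ou_integral :: "real ^ 'm ^ 'm \<Rightarrow> (real \<Rightarrow> real ^ 'm) \<Rightarrow> real ^ 'm \<Rightarrow> bool" where
  "has_ou_integral F w I \<longleftrightarrow>
     (\<exists>J. (\<forall>T<0. has_stieltjes_integral (\<lambda>s. matrix_exp ((- s) *\<^sub>R F)) w T 0 (J T)) \<and>
          (J \<longlongrightarrow> I) at_bot)"

definition ou :: "real ^ 'm ^ 'm \<Rightarrow> (real \<Rightarrow> real ^ 'm) \<Rightarrow> real ^ 'm" where
  "ou F w = (THE I. has_ou_integral F w I)"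


section \<open>Random dynamical systems and slow manifolds\<close>

text \<open>The sample space, with its sigma-algebra, is the space of the measure \<open>W\<close>.\<close>

definition random_dynamical_system ::
    "'w measure \<Rightarrow> (real \<Rightarrow> 'w \<Rightarrow> 'w) \<Rightarrow> (real \<Rightarrow> 'w \<Rightarrow> 'z \<Rightarrow> 'z::euclidean_space) \<Rightarrow> bool" where
  "random_dynamical_system W \<theta> \<phi> \<longleftrightarrow>
     (\<lambda>(t, w, z). \<phi> t w z) \<in> borel_measurable (borel \<Otimes>\<^sub>M W \<Otimes>\<^sub>M borel) \<and>
     (\<forall>w\<in>space W. \<forall>z. \<phi> 0 w z = z) \<and>
     (\<forall>w\<in>space W. \<forall>t s z. \<phi> (t + s) w z = \<phi> t (\<theta> s w) (\<phi> s w z))"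

definition random_set :: "'w measure \<Rightarrow> ('w \<Rightarrow> 'z::metric_space set) \<Rightarrow> bool" where
  "random_set W M \<longleftrightarrow>
     (\<forall>w\<in>space W. M w \<noteq> {} \<and> closed (M w)) \<and>
     (\<forall>z. (\<lambda>w. infdist z (M w)) \<in> borel_measurable W)"

definition lipschitz_invariant_manifold ::
    "'w measure \<Rightarrow> (real \<Rightarrow> 'w \<Rightarrow> 'w) \<Rightarrow>
     (real \<Rightarrow> 'w \<Rightarrow> 'a \<times> 'b \<Rightarrow> 'a::euclidean_space \<times> 'b::euclidean_space) \<Rightarrow>
     ('w \<Rightarrow> ('a \<times> 'b) set) \<Rightarrow> bool" where
  "lipschitz_invariant_manifold W \<theta> \<phi> M \<longleftrightarrow>
     random_set W M \<and>
     (\<forall>w\<in>space W. \<forall>t. \<phi> t w ` M w \<subseteq> M (\<theta> t w)) \<and>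
     (\<exists>h :: 'w \<Rightarrow> 'a \<Rightarrow> 'b.
        (\<forall>w\<in>space W. M w = {(x, h w x) | x. True} \<and> (\<exists>L. L-lipschitz_on UNIV (h w))) \<and>
        (\<forall>x. (\<lambda>w. h w x) \<in> borel_measurable W))"

definition exponential_tracking ::
    "'w measure \<Rightarrow> (real \<Rightarrow> 'w \<Rightarrow> 'z \<Rightarrow> 'z::euclidean_space) \<Rightarrow> ('w \<Rightarrow> 'z set) \<Rightarrow> bool" where
  "exponential_tracking W \<phi> M \<longleftrightarrow>
     (\<exists>c>0. \<exists>C :: 'z \<Rightarrow> 'z \<Rightarrow> 'w \<Rightarrow> real.
        (\<forall>z z'. C z z' \<in> borel_measurable W \<and> (\<forall>w\<in>space W. C z z' w > 0)) \<and>
        (\<forall>w\<in>space W. \<forall>z. \<exists>z'\<in>M w. \<forall>t\<ge>0.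
           norm (\<phi> t w z - \<phi> t w z') \<le> C z z' w * exp (- c * t) * norm (z - z')))"

definition slow_manifold ::
    "'w measure \<Rightarrow> (real \<Rightarrow> 'w \<Rightarrow> 'w) \<Rightarrow>
     (real \<Rightarrow> 'w \<Rightarrow> 'a \<times> 'b \<Rightarrow> 'a::euclidean_space \<times> 'b::euclidean_space) \<Rightarrow>
     ('w \<Rightarrow> ('a \<times> 'b) set) \<Rightarrow> bool" where
  "slow_manifold W \<theta> \<phi> M \<longleftrightarrow>
     lipschitz_invariant_manifold W \<theta> \<phi> M \<and> exponential_tracking W \<phi> M"


section \<open>The slow-fast system\<close>

text \<open>Members are made canonical outside the half-line, so that equality of members is
  equality on the half-line.\<close>

definition C_minus :: "real \<Rightarrow> (real \<Rightarrow> 'a::euclidean_space \<times> 'b::euclidean_space) set" where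
  "C_minus \<gamma> = {u \<in> extensional {..0}. continuous_on {..0} u \<and>
     bdd_above ((\<lambda>t. norm (exp (\<gamma> * t) *\<^sub>R fst (u t))) ` {..0}) \<and>
     bdd_above ((\<lambda>t. norm (exp (\<gamma> * t) *\<^sub>R snd (u t))) ` {..0})}"

text \<open>Since the coefficients are only cadlag in time, the random differential system is understood
  in its integrated form, on the whole time axis.\<close>

definition random_ode_solution ::
    "real ^ 'n ^ 'n \<Rightarrow> real ^ 'm ^ 'm \<Rightarrow>
     (real ^ 'n \<Rightarrow> real ^ 'm \<Rightarrow> real ^ 'n) \<Rightarrow> (real ^ 'n \<Rightarrow> real ^ 'm \<Rightarrow> real ^ 'm) \<Rightarrow>
     real \<Rightarrow> real \<Rightarrow> (real \<Rightarrow> real ^ 'm) \<Rightarrow> (real ^ 'n) \<times> (real ^ 'm) \<Rightarrow>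
     (real \<Rightarrow> (real ^ 'n) \<times> (real ^ 'm)) \<Rightarrow> bool" where
  "random_ode_solution S F g1 g2 \<sigma> \<epsilon> w z u \<longleftrightarrow>
     continuous_on UNIV u \<and>
     (let f1 = (\<lambda>s. \<epsilon> *\<^sub>R (S *v fst (u s))
                  + \<epsilon> *\<^sub>R g1 (fst (u s)) (snd (u s) + \<sigma> *\<^sub>R ou F (wshift s w)));
          f2 = (\<lambda>s. F *v snd (u s)
                  + g2 (fst (u s)) (snd (u s) + \<sigma> *\<^sub>R ou F (wshift s w)))
      in \<forall>t. interval_lebesgue_integrable lborel 0 (ereal t) f1 \<and>
             interval_lebesgue_integrable lborel 0 (ereal t) f2 \<and>
             fst (u t) = fst z + (LBINT s=0..ereal t. f1 s) \<and>
             snd (u t) = snd z + (LBINT s=0..ereal t. f2 s))"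

definition random_ode_flow ::
    "real ^ 'n ^ 'n \<Rightarrow> real ^ 'm ^ 'm \<Rightarrow>
     (real ^ 'n \<Rightarrow> real ^ 'm \<Rightarrow> real ^ 'n) \<Rightarrow> (real ^ 'n \<Rightarrow> real ^ 'm \<Rightarrow> real ^ 'm) \<Rightarrow>
     real \<Rightarrow> real \<Rightarrow> real \<Rightarrow> (real \<Rightarrow> real ^ 'm) \<Rightarrow> (real ^ 'n) \<times> (real ^ 'm) \<Rightarrow>
     (real ^ 'n) \<times> (real ^ 'm)" where
  "random_ode_flow S F g1 g2 \<sigma> \<epsilon> t w z = (THE u. random_ode_solution S F g1 g2 \<sigma> \<epsilon> w z u) t"

definition integral_system_solution ::
    "real ^ 'n ^ 'n \<Rightarrow> real ^ 'm ^ 'm \<Rightarrow>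
     (real ^ 'n \<Rightarrow> real ^ 'm \<Rightarrow> real ^ 'n) \<Rightarrow> (real ^ 'n \<Rightarrow> real ^ 'm \<Rightarrow> real ^ 'm) \<Rightarrow>
     real \<Rightarrow> real \<Rightarrow> (real \<Rightarrow> real ^ 'm) \<Rightarrow> real ^ 'n \<Rightarrow>
     (real \<Rightarrow> (real ^ 'n) \<times> (real ^ 'm)) \<Rightarrow> bool" where
  "integral_system_solution S F g1 g2 \<sigma> \<epsilon> w x0 u \<longleftrightarrow>
     (let f1 = (\<lambda>t s. matrix_exp ((\<epsilon> * (t - s)) *\<^sub>R S)
                  *v g1 (fst (u s)) (snd (u s) + \<sigma> *\<^sub>R ou F (wshift s w)));
          f2 = (\<lambda>t s. matrix_exp ((t - s) *\<^sub>R F)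
                  *v g2 (fst (u s)) (snd (u s) + \<sigma> *\<^sub>R ou F (wshift s w)))
      in \<forall>t\<le>0. interval_lebesgue_integrable lborel 0 (ereal t) (f1 t) \<and>
               interval_lebesgue_integrable lborel (-\<infinity>) (ereal t) (f2 t) \<and>
               fst (u t) = matrix_exp ((\<epsilon> * t) *\<^sub>R S) *v x0
                           + \<epsilon> *\<^sub>R (LBINT s=0..ereal t. f1 t s) \<and>
               snd (u t) = (LBINT s=-\<infinity>..ereal t. f2 t s))"

definition integral_system_path ::
    "real ^ 'n ^ 'n \<Rightarrow> real ^ 'm ^ 'm \<Rightarrow>
     (real ^ 'n \<Rightarrow> real ^ 'm \<Rightarrow> real ^ 'n) \<Rightarrow> (real ^ 'n \<Rightarrow> real ^ 'm \<Rightarrow> real ^ 'm) \<Rightarrow>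
     real \<Rightarrow> real \<Rightarrow> real \<Rightarrow> (real \<Rightarrow> real ^ 'm) \<Rightarrow> real ^ 'n \<Rightarrow>
     real \<Rightarrow> (real ^ 'n) \<times> (real ^ 'm)" where
  "integral_system_path S F g1 g2 \<gamma> \<sigma> \<epsilon> w x0 =
     (THE u. u \<in> C_minus \<gamma> \<and> integral_system_solution S F g1 g2 \<sigma> \<epsilon> w x0 u)"

definition slow_graph ::
    "real ^ 'n ^ 'n \<Rightarrow> real ^ 'm ^ 'm \<Rightarrow>
     (real ^ 'n \<Rightarrow> real ^ 'm \<Rightarrow> real ^ 'n) \<Rightarrow> (real ^ 'n \<Rightarrow> real ^ 'm \<Rightarrow> real ^ 'm) \<Rightarrow>
     real \<Rightarrow> real \<Rightarrow> real \<Rightarrow> (real \<Rightarrow> real ^ 'm) \<Rightarrow> real ^ 'n \<Rightarrow> real ^ 'm" where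
  "slow_graph S F g1 g2 \<gamma> \<sigma> \<epsilon> w x0 =
     (let u = integral_system_path S F g1 g2 \<gamma> \<sigma> \<epsilon> w x0
      in LBINT s=-\<infinity>..0. matrix_exp ((- s) *\<^sub>R F)
           *v g2 (fst (u s)) (snd (u s) + \<sigma> *\<^sub>R ou F (wshift s w)))"

definition slow_set ::
    "real ^ 'n ^ 'n \<Rightarrow> real ^ 'm ^ 'm \<Rightarrow>
     (real ^ 'n \<Rightarrow> real ^ 'm \<Rightarrow> real ^ 'n) \<Rightarrow> (real ^ 'n \<Rightarrow> real ^ 'm \<Rightarrow> real ^ 'm) \<Rightarrow>
     real \<Rightarrow> real \<Rightarrow> real \<Rightarrow> (real \<Rightarrow> real ^ 'm) \<Rightarrow> ((real ^ 'n) \<times> (real ^ 'm)) set" where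
  "slow_set S F g1 g2 \<gamma> \<sigma> \<epsilon> w =
     {z. restrict (\<lambda>t. random_ode_flow S F g1 g2 \<sigma> \<epsilon> t w z) {..0} \<in> C_minus \<gamma>}"

definition slow_rho :: "real \<Rightarrow> real \<Rightarrow> real \<Rightarrow> real \<Rightarrow> real \<Rightarrow> real" where
  "slow_rho K \<gamma> \<gamma>s \<gamma>f \<epsilon> = \<epsilon> * K / (\<gamma> + \<epsilon> * \<gamma>s) - K / (\<gamma> + \<gamma>f)"

end

theory Submission
  imports Defs
begin

text \<open>For a fixed noise path everything is a contraction argument in a sup norm weighted by
  \<open>exp (- \<gamma> t)\<close>. On the negative half-line the Lyapunov--Perron operator has contraction constant
  \<open>\<rho>(\<epsilon>)\<close>; its fixed points are exactly the solutions whose past stays bounded in the weight, because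
  the free fast motion \<open>exp (t F) y\<close> leaves that class as \<open>t\<close> tends to minus infinity. This makes
  the slow set a graph, and its invariance is the cocycle property. On the positive half-line a second
  operator, for the difference of a given solution and a sought one on the graph, contracts when
  \<open>\<epsilon>\<close> is small and yields exponential tracking. The solutions are limits of Picard iterates, which
  are jointly measurable in time, path and initial value, since the stationary process is a limit of
  Riemann--Stieltjes sums and right continuous in time.\<close>


section \<open>The matrix exponential\<close>

text \<open>The weight exponent \<open>- \<gamma>\<close> lies strictly between the fast rate
  \<open>\<gamma>f\<close> and the slow rate \<open>\<epsilon> * \<gamma>s\<close>. Integrated
  against the weight, the fast kernel costs \<open>- K / (\<gamma> + \<gamma>f)\<close>, below one
  by the gap hypothesis, and the slow kernel costs
  \<open>\<epsilon> * K / (\<gamma> + \<epsilon> * \<gamma>s)\<close>, which vanishes with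
  \<epsilon>. The bound \<delta> is dictated by the tracking operator, whose constant exceeds
  \<rho>(\<epsilon>) by the product of the slow constant with the Lipschitz constant of the graph.
  The driving path is only cadlag, so solutions need not be differentiable. Hence the differential
  system is an integral equation, and its equivalence with the variation of constants formula rests
  on Fubini instead of a product rule. Sublinear growth of the path is used as growth below every
  exponential rate, which fits any weight. The objects of the claim are definite descriptions, which
  carry no measurability by themselves; this is why the fixed point theorem also delivers pointwise
  convergence of the iterates started at zero.\<close>

lemma has_vector_derivative_vecI:
  fixes f :: "real \<Rightarrow> 'a::real_normed_vector ^ 'n"
  assumes "\<And>i. ((\<lambda>t. f t $ i) has_vector_derivative f' $ i) (at x)"
  shows "(f has_vector_derivative f') (at x)"
  unfolding has_vector_derivative_def has_derivative_def
proof (intro conjI bounded_linear_scaleR_left vec_tendstoI)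
  show "((\<lambda>y. ((f y - f (Lim (at x) (\<lambda>x. x)) - (y - Lim (at x) (\<lambda>x. x)) *\<^sub>R f') /\<^sub>R
      norm (y - Lim (at x) (\<lambda>x. x))) $ i) \<longlongrightarrow> 0 $ i) (at x)" for i
    using assms[of i] unfolding has_vector_derivative_def has_derivative_def by simp
qed

lemma bounded_bilinear_matrix_vector_mult:
  "bounded_bilinear ((*v) :: real ^ 'n ^ 'm \<Rightarrow> real ^ 'n \<Rightarrow> real ^ 'm)"
  unfolding bilinear_conv_bounded_bilinear[symmetric] bilinear_def
  by (auto intro!: linearI simp: matrix_vector_right_distrib matrix_vector_mult_add_rdistrib
      matrix_vector_mult_scaleR scaleR_matrix_vector_assoc)

lemma bounded_bilinear_matrix_matrix_mult:
  "bounded_bilinear ((**) :: real ^ 'n ^ 'm \<Rightarrow> real ^ 'k ^ 'n \<Rightarrow> real ^ 'k ^ 'm)"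
  unfolding bilinear_conv_bounded_bilinear[symmetric] bilinear_def
  by (auto intro!: linearI simp: matrix_matrix_mult_def vec_eq_iff sum.distrib sum_distrib_left
      algebra_simps)

lemma bounded_linear_entry: "bounded_linear (\<lambda>X :: real ^ 'n ^ 'm. X $ i $ j)"
  by (rule bounded_linear_compose[of "\<lambda>x. x $ j" "\<lambda>x. x $ i"]) auto

lemma matrix_power_scaleR:
  fixes A :: "real ^ 'n ^ 'n"
  shows
  "((**) (t *\<^sub>R A) ^^ k) (mat 1) = t ^ k *\<^sub>R ((**) A ^^ k) (mat 1 :: real ^ 'n ^ 'n)"
  by (induction k) (simp_all add: matrix_scalar_ac scalar_matrix_assoc[symmetric])

lemma matrix_power_commute:
  fixes A :: "real ^ 'n ^ 'n"
  shows
  "((**) A ^^ k) (mat 1) ** A = A ** ((**) A ^^ k) (mat 1 :: real ^ 'n ^ 'n)"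
  by (induction k) (simp_all add: matrix_mul_assoc[symmetric])

text \<open>Left multiplication by \<open>A\<close> is a bounded linear map with some constant
  \<open>B\<close>, so powers grow at most like \<open>B ^ k\<close> and the series is dominated by
  the exponential series of \<open>\<bar>t\<bar> * B\<close>. No submultiplicative matrix norm is
  involved.\<close>

lemma summable_matrix_exp:
  fixes A :: "real ^ 'n ^ 'n"
  shows
  "summable (\<lambda>k. (t ^ k / fact k) *\<^sub>R ((**) A ^^ k) (mat 1 :: real ^ 'n ^ 'n))"
proof -
  obtain B where B: "B > 0" "\<And>X :: real ^ 'n ^ 'n. norm (A ** X) \<le> norm X * B"
    using bounded_linear.pos_bounded[OF
        bounded_bilinear.bounded_linear_right[OF bounded_bilinear_matrix_matrix_mult]] by blast
  have pow: "norm (((**) A ^^ k) (mat 1 :: real ^ 'n ^ 'n)) \<le> B ^ k * norm (mat 1 :: real ^ 'n ^ 'n)" for k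
  proof (induction k)
    case (Suc k)
    have "norm (((**) A ^^ Suc k) (mat 1 :: real ^ 'n ^ 'n))
        \<le> norm (((**) A ^^ k) (mat 1 :: real ^ 'n ^ 'n)) * B"
      using B(2) by simp
    also have "\<dots> \<le> B ^ k * norm (mat 1 :: real ^ 'n ^ 'n) * B"
      using Suc B(1) by (intro mult_right_mono) auto
    finally show ?case by (simp add: mult_ac)
  qed simp
  have "summable (\<lambda>k. ((\<bar>t\<bar> * B) ^ k /\<^sub>R fact k) * norm (mat 1 :: real ^ 'n ^ 'n))"
    by (intro summable_mult2 summable_exp_generic)
  then show ?thesis
  proof (rule summable_comparison_test')
    fix k
    have "norm ((t ^ k / fact k) *\<^sub>R ((**) A ^^ k) (mat 1 :: real ^ 'n ^ 'n))
        = \<bar>t\<bar> ^ k / fact k * norm (((**) A ^^ k) (mat 1 :: real ^ 'n ^ 'n))"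
      by (simp add: power_abs)
    also have "\<dots> \<le> \<bar>t\<bar> ^ k / fact k * (B ^ k * norm (mat 1 :: real ^ 'n ^ 'n))"
      by (intro mult_left_mono pow) auto
    finally show "norm ((t ^ k / fact k) *\<^sub>R ((**) A ^^ k) (mat 1 :: real ^ 'n ^ 'n))
        \<le> ((\<bar>t\<bar> * B) ^ k /\<^sub>R fact k) * norm (mat 1 :: real ^ 'n ^ 'n)"
      by (simp add: power_mult_distrib field_simps)
  qed
qed

lemma matrix_exp_scaleR:
  fixes A :: "real ^ 'n ^ 'n"
  shows
  "matrix_exp (t *\<^sub>R A) = (\<Sum>k. (t ^ k / fact k) *\<^sub>R ((**) A ^^ k) (mat 1 :: real ^ 'n ^ 'n))"
  by (simp add: matrix_exp_def matrix_power_scaleR)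

text \<open>Each entry becomes a real power series in \<open>t\<close>, which gives access to
  termwise differentiation.\<close>

lemma matrix_exp_nth:
  fixes A :: "real ^ 'n ^ 'n"
  shows
  "matrix_exp (t *\<^sub>R A) $ i $ j
    = (\<Sum>k. (((**) A ^^ k) (mat 1 :: real ^ 'n ^ 'n) $ i $ j / fact k) * t ^ k)"
proof -
  from bounded_linear.suminf[OF bounded_linear_entry summable_matrix_exp[of t A]] show ?thesis
    by (simp add: matrix_exp_scaleR mult_ac)
qed

lemma matrix_exp_0: "matrix_exp (0 :: real ^ 'n ^ 'n) = mat 1"
proof -
  have "matrix_exp (0 *\<^sub>R (0 :: real ^ 'n ^ 'n)) = mat 1"
    unfolding matrix_exp_scaleR by (subst suminf_finite[of "{0}"]) auto
  then show ?thesis by simp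
qed

lemma matrix_exp_commute:
  "matrix_exp (t *\<^sub>R A) ** A = A ** matrix_exp (t *\<^sub>R (A :: real ^ 'n ^ 'n))"
proof -
  interpret bounded_bilinear "(**) :: real ^ 'n ^ 'n \<Rightarrow> real ^ 'n ^ 'n \<Rightarrow> real ^ 'n ^ 'n"
    by (rule bounded_bilinear_matrix_matrix_mult)
  show ?thesis
    unfolding matrix_exp_scaleR
    by (subst bounded_linear.suminf[OF bounded_linear_left summable_matrix_exp],
        subst bounded_linear.suminf[OF bounded_linear_right summable_matrix_exp])
       (simp add: scaleR_left scaleR_right matrix_power_commute)
qed

lemma matrix_exp_has_vector_derivative:
  "((\<lambda>t. matrix_exp (t *\<^sub>R A)) has_vector_derivative
     A ** matrix_exp (t *\<^sub>R (A :: real ^ 'n ^ 'n))) (at t)"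
proof (intro has_vector_derivative_vecI)
  fix i j
  let ?P = "\<lambda>k. ((**) A ^^ k) (mat 1 :: real ^ 'n ^ 'n)"
  let ?c = "\<lambda>k. ?P k $ i $ j / fact k"
  have lin: "bounded_linear (\<lambda>X :: real ^ 'n ^ 'n. X $ i $ j)"
    by (rule bounded_linear_entry)
  have "summable (\<lambda>k. ?c k * s ^ k)" for s
    using bounded_linear.summable[OF lin summable_matrix_exp[of s A]] by (simp add: mult_ac)
  then have "((\<lambda>t. \<Sum>k. ?c k * t ^ k) has_field_derivative (\<Sum>k. diffs ?c k * t ^ k)) (at t)"
    by (rule termdiffs_strong_converges_everywhere)
  \<comment> \<open>Termwise differentiation shifts the coefficients by one; the factor
    \<open>k + 1\<close> cancels against the factorial, and the shifted power is \<open>A\<close>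
    times the old one.\<close>
  moreover have "(\<Sum>k. diffs ?c k * t ^ k) = (A ** matrix_exp (t *\<^sub>R A)) $ i $ j"
  proof -
    have lin': "bounded_linear (\<lambda>X :: real ^ 'n ^ 'n. (A ** X) $ i $ j)"
      using bounded_linear_compose[OF lin
          bounded_bilinear.bounded_linear_right[OF bounded_bilinear_matrix_matrix_mult]] .
    have "(A ** matrix_exp (t *\<^sub>R A)) $ i $ j
        = (\<Sum>k. (A ** ((t ^ k / fact k) *\<^sub>R ?P k)) $ i $ j)"
      unfolding matrix_exp_scaleR using bounded_linear.suminf[OF lin' summable_matrix_exp] by simp
    moreover have "(A ** ((t ^ k / fact k) *\<^sub>R ?P k)) $ i $ j = diffs ?c k * t ^ k" for k
    proof -
      have "(A ** ((t ^ k / fact k) *\<^sub>R ?P k)) = (t ^ k / fact k) *\<^sub>R ?P (Suc k)"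
        by (simp add: matrix_scalar_ac scalar_matrix_assoc[symmetric])
      moreover have "(1 + real k) * (?P (Suc k) $ i $ j / ((1 + real k) * fact k))
          = ?P (Suc k) $ i $ j / fact k"
      proof -
        have "1 + real k \<noteq> 0" by linarith
        then show ?thesis by (simp add: divide_simps)
      qed
      ultimately show ?thesis
        by (simp add: diffs_def del: funpow.simps)
    qed
    ultimately show ?thesis by simp
  qed
  ultimately show "((\<lambda>t. matrix_exp (t *\<^sub>R A) $ i $ j) has_vector_derivative
      (A ** matrix_exp (t *\<^sub>R A)) $ i $ j) (at t)"
    by (simp add: matrix_exp_nth has_real_derivative_iff_has_vector_derivative)
qed

lemma matrix_exp_vec_has_vector_derivative:
  "((\<lambda>t. matrix_exp (t *\<^sub>R A) *v x) has_vector_derivative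
     A *v (matrix_exp (t *\<^sub>R (A :: real ^ 'n ^ 'n)) *v x)) (at t within U)"
  using bounded_linear.has_vector_derivative[OF
      bounded_bilinear.bounded_linear_left[OF bounded_bilinear_matrix_vector_mult]
      has_vector_derivative_at_within[OF matrix_exp_has_vector_derivative]]
  by (simp add: matrix_vector_mul_assoc)

text \<open>The product of the exponentials at \<open>s + t - r\<close> and at \<open>r\<close> has
  zero derivative in \<open>r\<close>, because \<open>A\<close> commutes with its exponential; the
  values at \<open>r = 0\<close> and \<open>r = t\<close> are the two sides.\<close>

lemma matrix_exp_add:
  "matrix_exp ((s + t) *\<^sub>R A) = matrix_exp (s *\<^sub>R A) ** matrix_exp (t *\<^sub>R (A :: real ^ 'n ^ 'n))"
proof -
  let ?E = "\<lambda>t. matrix_exp (t *\<^sub>R A)"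
  have "((\<lambda>r. ?E (s + t - r) ** ?E r) has_vector_derivative 0) (at r)" for r
  proof -
    have E1: "((\<lambda>r. ?E (s + t - r)) has_vector_derivative - (A ** ?E (s + t - r))) (at r)"
    proof -
      have "((\<lambda>r. s + t - r) has_vector_derivative - 1) (at r)"
        by (auto intro!: derivative_eq_intros)
      from vector_diff_chain_at[OF this matrix_exp_has_vector_derivative[of A]]
      show ?thesis by (simp add: o_def)
    qed
    show ?thesis
      using bounded_bilinear.has_vector_derivative[OF bounded_bilinear_matrix_matrix_mult E1
          matrix_exp_has_vector_derivative[of A r]]
      by (simp add: bounded_bilinear.minus_left[OF bounded_bilinear_matrix_matrix_mult]
          matrix_mul_assoc matrix_exp_commute)
  qed
  then have "(\<lambda>r. ?E (s + t - r) ** ?E r) 0 = (\<lambda>r. ?E (s + t - r) ** ?E r) t"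
    using has_vector_derivative_zero_constant[of UNIV "\<lambda>r. ?E (s + t - r) ** ?E r"]
    by (metis UNIV_I convex_UNIV)
  then show ?thesis by (simp add: matrix_exp_0)
qed

lemma matrix_exp_add_vec:
  "matrix_exp ((s + t) *\<^sub>R A) *v x = matrix_exp (s *\<^sub>R A) *v (matrix_exp (t *\<^sub>R (A :: real ^ 'n ^ 'n)) *v x)"
  by (simp add: matrix_exp_add matrix_vector_mul_assoc)

lemma continuous_on_matrix_exp [continuous_intros]:
  assumes "continuous_on U f"
  shows "continuous_on U (\<lambda>s. matrix_exp (f s *\<^sub>R (A :: real ^ 'n ^ 'n)))"
proof -
  have "continuous_on UNIV (\<lambda>t. matrix_exp (t *\<^sub>R A))"
    using matrix_exp_has_vector_derivative
    by (auto intro!: continuous_at_imp_continuous_on has_vector_derivative_continuous)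
  from continuous_on_compose2[OF this assms] show ?thesis by simp
qed

lemma borel_measurable_matrix_exp [measurable]:
  "(\<lambda>t. matrix_exp (t *\<^sub>R (A :: real ^ 'n ^ 'n))) \<in> borel_measurable borel"
  by (intro borel_measurable_continuous_onI continuous_on_matrix_exp continuous_on_id)

lemma borel_measurable_matrix_vector_mult [measurable (raw)]:
  fixes f :: "'a \<Rightarrow> real ^ 'n ^ 'm"
  assumes "f \<in> borel_measurable M" "g \<in> borel_measurable M"
  shows "(\<lambda>x. f x *v g x) \<in> borel_measurable M"
  by (rule borel_measurable_continuous_Pair[OF assms])
     (intro bounded_bilinear.continuous_on[OF bounded_bilinear_matrix_vector_mult] continuous_intros)


section \<open>Contractions in weighted sup norms\<close>

text \<open>The product type carries the Euclidean norm, while the Lipschitz hypotheses are stated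
  with the sum of the component norms. Working with the sum keeps the contraction constant exactly
  \<rho>(\<epsilon>); the Euclidean norm returns only where a constant factor is harmless.\<close>

definition norm1 :: "'a::real_normed_vector \<times> 'b::real_normed_vector \<Rightarrow> real" where
  "norm1 p = norm (fst p) + norm (snd p)"

lemma norm1_nonneg [simp]: "0 \<le> norm1 p"
  by (simp add: norm1_def)

lemma norm1_zero [simp]: "norm1 0 = 0"
  by (simp add: norm1_def)

lemma norm1_eq_0 [simp]: "norm1 p = 0 \<longleftrightarrow> p = 0"
  by (simp add: norm1_def prod_eq_iff add_nonneg_eq_0_iff)

lemma norm1_triangle: "norm1 (p + q) \<le> norm1 p + norm1 q"
  unfolding norm1_def using norm_triangle_ineq[of "fst p" "fst q"] norm_triangle_ineq[of "snd p" "snd q"]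
  by simp

lemma norm1_diff_triangle: "norm1 (p - r) \<le> norm1 (p - q) + norm1 (q - r)"
  using norm1_triangle[of "p - q" "q - r"] by simp

lemma norm1_minus_commute: "norm1 (p - q) = norm1 (q - p)"
  by (simp add: norm1_def norm_minus_commute)

lemma norm_le_norm1: "norm p \<le> norm1 p"
  unfolding norm1_def norm_prod_def by (rule sqrt_sum_squares_le_sum) auto

lemma norm1_le_norm: "norm1 p \<le> 2 * norm p"
  unfolding norm1_def using norm_fst_le[of "fst p" "snd p"] norm_snd_le[of "snd p" "fst p"] by simp

lemma tendsto_norm1 [tendsto_intros]:
  "(f \<longlongrightarrow> p) G \<Longrightarrow> ((\<lambda>x. norm1 (f x)) \<longlongrightarrow> norm1 p) G"
  unfolding norm1_def by (intro tendsto_intros)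

lemma continuous_on_norm1 [continuous_intros]:
  "continuous_on U f \<Longrightarrow> continuous_on U (\<lambda>x. norm1 (f x))"
  unfolding norm1_def by (intro continuous_intros)

text \<open>The optimal constant \<open>B\<close> with \<open>d \<le> B W\<close> satisfies \<open>B \<le> c + \<rho> B\<close>.\<close>

lemma weighted_bound:
  fixes d W :: "'t \<Rightarrow> real"
  assumes W: "\<And>t. t \<in> I \<Longrightarrow> 0 < W t" and d: "\<And>t. t \<in> I \<Longrightarrow> 0 \<le> d t"
    and \<rho>: "0 \<le> \<rho>" "\<rho> < 1" and c: "0 \<le> c"
    and bounded: "\<And>t. t \<in> I \<Longrightarrow> d t \<le> B0 * W t"
    and improve: "\<And>B t. 0 \<le> B \<Longrightarrow> (\<And>s. s \<in> I \<Longrightarrow> d s \<le> B * W s) \<Longrightarrow> t \<in> I \<Longrightarrow>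
      d t \<le> (c + \<rho> * B) * W t"
    and t: "t \<in> I"
  shows "d t \<le> c / (1 - \<rho>) * W t"
proof -
  let ?Q = "(\<lambda>s. d s / W s) ` I"
  define B where "B = Sup ?Q"
  have bdd: "bdd_above ?Q"
    using bounded W by (intro bdd_aboveI2[of _ _ B0]) (simp add: divide_le_eq)
  have le: "d s \<le> B * W s" if "s \<in> I" for s
    using cSup_upper[OF imageI[OF that] bdd] W[OF that] by (simp add: B_def divide_le_eq)
  have "0 \<le> d t / W t" using W[OF t] d[OF t] by simp
  also have "\<dots> \<le> B" unfolding B_def by (intro cSup_upper imageI t bdd)
  finally have "0 \<le> B" .
  have "B \<le> c + \<rho> * B"
    unfolding B_def using t improve[OF \<open>0 \<le> B\<close> le] W
    by (intro cSup_least) (auto simp: divide_le_eq B_def)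
  then have "B \<le> c / (1 - \<rho>)"
    using \<rho> by (simp add: field_simps)
  then show ?thesis
    using le[OF t] W[OF t] by (meson less_imp_le mult_right_mono order_trans)
qed

text \<open>Banach's theorem with the weighted distance replaced by explicit bounds
  \<open>B * W t\<close>, so that no metric space of functions has to be set up. Completeness of the
  target gives pointwise limits and \<open>closed\<close> puts the limit back into \<open>X\<close>.
  The convergence of the iterates is part of the conclusion because measurability in parameters is
  read off from it.\<close>

lemma weighted_fixpoint:
  fixes T :: "('t \<Rightarrow> 'a::banach \<times> 'b::banach) \<Rightarrow> 't \<Rightarrow> 'a \<times> 'b"
  assumes W: "\<And>t. 0 \<le> W t"
    and closed: "\<And>v u C. (\<And>n. v n \<in> X) \<Longrightarrow> (\<And>t. (\<lambda>n. v n t) \<longlonglongrightarrow> u t) \<Longrightarrow>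
      (\<And>n t. norm1 (v n t - u t) \<le> C * W t) \<Longrightarrow> u \<in> X"
    and T: "\<And>u. u \<in> X \<Longrightarrow> T u \<in> X"
    and contr: "\<And>u v B t. u \<in> X \<Longrightarrow> v \<in> X \<Longrightarrow> 0 \<le> B \<Longrightarrow>
      (\<And>s. norm1 (u s - v s) \<le> B * W s) \<Longrightarrow> norm1 (T u t - T v t) \<le> \<rho> * B * W t"
    and \<rho>: "0 \<le> \<rho>" "\<rho> < 1"
    and u0: "u0 \<in> X" and B0: "\<And>t. norm1 (T u0 t - u0 t) \<le> B0 * W t" "0 \<le> B0"
  shows "\<exists>u\<in>X. T u = u \<and> (\<forall>t. (\<lambda>n. (T ^^ n) u0 t) \<longlonglongrightarrow> u t)"
proof -
  define v where "v n = (T ^^ n) u0" for n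
  have vX: "v n \<in> X" for n
    unfolding v_def by (induction n) (auto intro: u0 T)
  have step: "norm1 (v (Suc n) t - v n t) \<le> \<rho> ^ n * B0 * W t" for n t
  proof (induction n arbitrary: t)
    case (Suc n)
    have "norm1 (T (v (Suc n)) t - T (v n) t) \<le> \<rho> * (\<rho> ^ n * B0) * W t"
      using Suc \<rho> B0 by (intro contr vX) auto
    then show ?case by (simp add: v_def mult_ac)
  qed (simp add: v_def B0)
  \<comment> \<open>Telescoping and the geometric series; the bound is uniform in \<open>k\<close>,
    so it survives the limit and becomes the rate of convergence to \<open>u\<close>.\<close>
  have dist: "norm1 (v (n + k) t - v n t) \<le> \<rho> ^ n * (B0 / (1 - \<rho>)) * W t" for n k t
  proof -
    have "norm1 (v (n + k) t - v n t) \<le> (\<Sum>i<k. \<rho> ^ (n + i) * B0 * W t)"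
    proof (induction k)
      case (Suc k)
      have "norm1 (v (n + Suc k) t - v n t)
          \<le> norm1 (v (Suc (n + k)) t - v (n + k) t) + norm1 (v (n + k) t - v n t)"
        using norm1_diff_triangle by simp
      also have "\<dots> \<le> \<rho> ^ (n + k) * B0 * W t + (\<Sum>i<k. \<rho> ^ (n + i) * B0 * W t)"
        using Suc step by (intro add_mono)
      finally show ?case by simp
    qed simp
    also have "\<dots> = \<rho> ^ n * (B0 * W t) * (\<Sum>i<k. \<rho> ^ i)"
      by (simp add: sum_distrib_left power_add mult_ac)
    also have "\<dots> \<le> \<rho> ^ n * (B0 * W t) * (1 / (1 - \<rho>))"
    proof (intro mult_left_mono)
      show "(\<Sum>i<k. \<rho> ^ i) \<le> 1 / (1 - \<rho>)"
        using \<rho> by (subst sum_gp_strict) (auto intro!: divide_right_mono)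
    qed (use \<rho> B0 W in auto)
    finally show ?thesis by (simp add: field_simps)
  qed
  have \<rho>_lim: "(\<lambda>n. \<rho> ^ n * C) \<longlonglongrightarrow> 0" for C
    using LIMSEQ_power_zero[of \<rho>] \<rho> by (intro tendsto_mult_left_zero) auto
  have "\<exists>l. (\<lambda>n. v n t) \<longlonglongrightarrow> l" for t
  proof -
    have "Cauchy (\<lambda>n. v n t)"
    proof (rule metric_CauchyI)
      fix e :: real assume "e > 0"
      then have "eventually (\<lambda>n. \<rho> ^ n * (B0 / (1 - \<rho>) * W t) < e / 2) sequentially"
        using order_tendstoD(2)[OF \<rho>_lim, of "e / 2" "B0 / (1 - \<rho>) * W t"] by linarith
      then obtain N where N: "\<rho> ^ N * (B0 / (1 - \<rho>) * W t) < e / 2"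
        by (auto simp: eventually_sequentially)
      have near: "norm (v n t - v N t) < e / 2" if "n \<ge> N" for n
      proof -
        have "norm1 (v n t - v N t) \<le> \<rho> ^ N * (B0 / (1 - \<rho>)) * W t"
          using dist[of N "n - N" t] that by simp
        also have "\<dots> = \<rho> ^ N * (B0 / (1 - \<rho>) * W t)" by (rule mult.assoc)
        finally show ?thesis using N norm_le_norm1[of "v n t - v N t"] by linarith
      qed
      show "\<exists>M. \<forall>m\<ge>M. \<forall>n\<ge>M. dist (v m t) (v n t) < e"
      proof (intro exI allI impI)
        fix m n assume "m \<ge> N" "n \<ge> N"
        then show "dist (v m t) (v n t) < e"
          using near[of m] near[of n] dist_triangle_half_l[of "v m t" "v N t" e "v n t"]
          by (simp add: dist_norm)
      qed
    qed
    then show ?thesis by (simp add: Cauchy_convergent_iff convergent_def)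
  qed
  then obtain u where u: "\<And>t. (\<lambda>n. v n t) \<longlonglongrightarrow> u t" by metis
  have rate: "norm1 (v n t - u t) \<le> \<rho> ^ n * (B0 / (1 - \<rho>)) * W t" for n t
  proof (rule LIMSEQ_le_const2)
    show "(\<lambda>k. norm1 (v n t - v (k + n) t)) \<longlonglongrightarrow> norm1 (v n t - u t)"
      by (intro tendsto_intros LIMSEQ_ignore_initial_segment u)
    show "\<exists>N. \<forall>k\<ge>N. norm1 (v n t - v (k + n) t) \<le> \<rho> ^ n * (B0 / (1 - \<rho>)) * W t"
      using dist[of n _ t] by (auto simp: norm1_minus_commute add.commute)
  qed
  have "u \<in> X"
  proof (rule closed[OF vX u])
    fix n t
    have "\<rho> ^ n * (B0 / (1 - \<rho>)) * W t \<le> 1 * (B0 / (1 - \<rho>)) * W t"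
      using \<rho> B0 W by (intro mult_right_mono power_le_one) auto
    then show "norm1 (v n t - u t) \<le> B0 / (1 - \<rho>) * W t"
      using rate[of n t] by simp
  qed
  moreover have "T u t = u t" for t
  proof -
    \<comment> \<open>The iterate \<open>v (Suc n)\<close> is \<open>T (v n)\<close>, and the
      contraction turns the rate for \<open>v n\<close> into convergence of \<open>T (v n) t\<close>
      to \<open>T u t\<close>; uniqueness of limits identifies \<open>T u\<close> with
      \<open>u\<close>.\<close>
    have "(\<lambda>n. norm1 (v (Suc n) t - T u t)) \<longlonglongrightarrow> 0"
    proof (rule tendsto_sandwich[OF _ _ tendsto_const])
      show "(\<lambda>n. \<rho> ^ n * (\<rho> * (B0 / (1 - \<rho>)) * W t)) \<longlonglongrightarrow> 0" by (rule \<rho>_lim)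
      have "norm1 (T (v n) t - T u t) \<le> \<rho> * (\<rho> ^ n * (B0 / (1 - \<rho>))) * W t" for n
        using rate B0 \<rho> by (intro contr vX \<open>u \<in> X\<close>) auto
      then show "\<forall>\<^sub>F n in sequentially. norm1 (v (Suc n) t - T u t)
          \<le> \<rho> ^ n * (\<rho> * (B0 / (1 - \<rho>)) * W t)"
        by (simp add: v_def mult_ac)
    qed auto
    moreover have "(\<lambda>n. norm1 (v (Suc n) t - T u t)) \<longlonglongrightarrow> norm1 (u t - T u t)"
      by (intro tendsto_intros LIMSEQ_Suc u)
    ultimately have "norm1 (u t - T u t) = 0" by (rule LIMSEQ_unique[symmetric])
    then show ?thesis by simp
  qed
  ultimately show ?thesis using u by (auto simp: v_def)
qed

text \<open>Members vanish off \<open>I\<close>, so that agreement on \<open>I\<close> is equality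
  of functions. Borel measurability stands in for continuity: it passes to pointwise limits, and
  continuity of a fixed point is recovered from the integral equation that it satisfies.\<close>

definition wspace :: "real set \<Rightarrow> (real \<Rightarrow> real) \<Rightarrow> (real \<Rightarrow> 'a::euclidean_space \<times> 'b::euclidean_space) set" where
  "wspace I W = {u \<in> borel_measurable borel. (\<forall>t. t \<notin> I \<longrightarrow> u t = 0) \<and>
     (\<exists>B\<ge>0. \<forall>t. norm1 (u t) \<le> B * W t)}"

lemma wspaceI:
  assumes "u \<in> borel_measurable borel" "\<And>t. t \<notin> I \<Longrightarrow> u t = 0" "0 \<le> B" "\<And>t. norm1 (u t) \<le> B * W t"
  shows "u \<in> wspace I W"
  using assms unfolding wspace_def by blast

lemma wspace_measurable: "u \<in> wspace I W \<Longrightarrow> u \<in> borel_measurable borel"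
  unfolding wspace_def by blast

lemma wspace_outside: "u \<in> wspace I W \<Longrightarrow> t \<notin> I \<Longrightarrow> u t = 0"
  unfolding wspace_def by blast

lemma wspace_bound:
  assumes "u \<in> wspace I W"
  obtains B where "0 \<le> B" "\<And>t. norm1 (u t) \<le> B * W t"
  using assms unfolding wspace_def by blast

lemma zero_wspace: "(\<lambda>_. 0) \<in> wspace I W"
  by (rule wspaceI[where B = 0]) auto

lemma wspace_closed:
  assumes W: "\<And>t. 0 \<le> W t" and v: "\<And>n. v n \<in> wspace I W" "\<And>t. (\<lambda>n. v n t) \<longlonglongrightarrow> u t"
    and C: "\<And>n t. norm1 (v n t - u t) \<le> C * W t"
  shows "u \<in> wspace I W"
proof -
  obtain B where B: "0 \<le> B" "\<And>t. norm1 (v 0 t) \<le> B * W t" using wspace_bound[OF v(1)] by metis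
  show ?thesis
  proof (rule wspaceI)
    show "u \<in> borel_measurable borel"
      by (rule borel_measurable_LIMSEQ_metric[OF wspace_measurable[OF v(1)] v(2)])
    show "u t = 0" if "t \<notin> I" for t
    proof -
      have "(\<lambda>n. v n t) = (\<lambda>n. 0)" using wspace_outside[OF v(1) that] by simp
      then show ?thesis using v(2)[of t] LIMSEQ_unique[OF tendsto_const] by metis
    qed
    show "0 \<le> B + \<bar>C\<bar>" using B by simp
    fix t
    have "norm1 (u t) \<le> norm1 (v 0 t) + norm1 (v 0 t - u t)"
      using norm1_triangle[of "v 0 t" "u t - v 0 t"] by (simp add: norm1_minus_commute)
    moreover have "C * W t \<le> \<bar>C\<bar> * W t" using W by (intro mult_right_mono) auto
    ultimately show "norm1 (u t) \<le> (B + \<bar>C\<bar>) * W t"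
      using B(2)[of t] C[of 0 t] unfolding distrib_right by linarith
  qed
qed


section \<open>Oriented integrals\<close>

text \<open>The density of the oriented integral from \<open>0\<close> to \<open>t\<close>; it makes the integral over a
  moving interval an integral with a jointly measurable parameter.\<close>

definition orient :: "real \<Rightarrow> real \<Rightarrow> real" where
  "orient t s = indicator {0<..<t} s - indicator {t<..<0} s"

lemma orient_pos: "0 \<le> t \<Longrightarrow> orient t s = indicator {0<..<t} s"
  by (simp add: orient_def)

lemma orient_neg: "t \<le> 0 \<Longrightarrow> orient t s = - indicator {t<..<0} s"
  by (simp add: orient_def)

lemma abs_orient_le [simp]: "\<bar>orient t s\<bar> \<le> 1"
  by (auto simp: orient_def split: split_indicator)

lemma orient_nonzero: "orient t s \<noteq> 0 \<Longrightarrow> 0 < s \<and> s < t \<or> t < s \<and> s < 0"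
  by (auto simp: orient_def split: split_indicator_asm)

lemma borel_measurable_orient [measurable (raw)]:
  assumes [measurable]: "f \<in> borel_measurable M" "g \<in> borel_measurable M"
  shows "(\<lambda>x. orient (f x) (g x)) \<in> borel_measurable M"
proof -
  have "(\<lambda>x. orient (f x) (g x)) = (\<lambda>x. (if 0 < g x \<and> g x < f x then 1 else 0)
      - (if f x < g x \<and> g x < 0 then 1 else 0))"
    by (auto simp: orient_def fun_eq_iff indicator_def)
  also have "\<dots> \<in> borel_measurable M" by measurable
  finally show ?thesis .
qed

lemma interval_integral_orient:
  "(LBINT s=0..ereal t. f s) = (LBINT s. orient t s *\<^sub>R f s)"
  by (simp add: interval_lebesgue_integral_def zero_ereal_def set_lebesgue_integral_def
      orient_pos orient_neg)

lemma interval_integrable_orient: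
  "interval_lebesgue_integrable lborel 0 (ereal t) f \<longleftrightarrow> integrable lborel (\<lambda>s. orient t s *\<^sub>R f s)"
  by (simp add: interval_lebesgue_integrable_def zero_ereal_def set_integrable_def
      orient_pos orient_neg)

lemma exp_integral_lessThan:
  fixes c t :: real
  assumes "c > 0"
  shows "integrable lborel (\<lambda>s. indicator {..<t} s * exp (c * s))"
    and "(LBINT s. indicator {..<t} s * exp (c * s)) = exp (c * t) / c"
proof -
  have A: "(((\<lambda>s::real. exp (c * s) / c) \<circ> real_of_ereal) \<longlongrightarrow> 0) (at_right (- \<infinity>))"
    unfolding ereal_tendsto_simps
    using assms by (auto intro!: tendsto_divide_zero exp_at_bot[THEN filterlim_compose]
        filterlim_tendsto_pos_mult_at_bot[OF tendsto_const] filterlim_ident)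
  have B: "(((\<lambda>s::real. exp (c * s) / c) \<circ> real_of_ereal) \<longlongrightarrow> exp (c * t) / c) (at_left (ereal t))"
    unfolding ereal_tendsto_simps by (intro tendsto_intros) (use assms in auto)
  have D: "((\<lambda>s::real. exp (c * s) / c) has_real_derivative exp (c * x)) (at x)" for x
    using assms by (auto intro!: derivative_eq_intros)
  note FTC = interval_integral_FTC_nonneg[OF _ D _ _ A B]
  show "integrable lborel (\<lambda>s. indicator {..<t} s * exp (c * s))"
    using FTC(1) by (simp add: set_integrable_def)
  show "(LBINT s. indicator {..<t} s * exp (c * s)) = exp (c * t) / c"
    using FTC(2) by (simp add: interval_lebesgue_integral_def set_lebesgue_integral_def)
qed

text \<open>Reflection \<open>s \<mapsto> - s\<close> of the integral over the other
  half-line.\<close>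

lemma exp_integral_greaterThan:
  fixes c t :: real
  assumes "c > 0"
  shows "integrable lborel (\<lambda>s. indicator {t<..} s * exp (- c * s))"
    and "(LBINT s. indicator {t<..} s * exp (- c * s)) = exp (- c * t) / c"
proof -
  have eq: "indicator {t<..} (0 + (- 1) * s) * exp (- c * (0 + (- 1) * s))
      = indicator {..<- t} s * exp (c * s)" for s :: real
    by (auto simp: indicator_def)
  show "integrable lborel (\<lambda>s. indicator {t<..} s * exp (- c * s))"
    using exp_integral_lessThan(1)[OF assms, of "- t"] eq
    by (subst lborel_integrable_real_affine_iff[of "-1" _ 0, symmetric]) simp_all
  show "(LBINT s. indicator {t<..} s * exp (- c * s)) = exp (- c * t) / c"
    using exp_integral_lessThan(2)[OF assms, of "- t"] eq
    by (subst lborel_integral_real_affine[of "-1" _ 0]) simp_all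
qed

lemma integral_le_exp_lessThan:
  fixes q :: "real \<Rightarrow> 'a::euclidean_space"
  assumes "c > 0" "0 \<le> B" and [measurable]: "q \<in> borel_measurable borel"
    and le: "\<And>s. norm (q s) \<le> B * (indicator {..<t} s * exp (c * s))"
  shows "integrable lborel q" and "norm (LBINT s. q s) \<le> B * (exp (c * t) / c)"
proof -
  have int: "integrable lborel (\<lambda>s. B * (indicator {..<t} s * exp (c * s)))"
    by (intro integrable_mult_right exp_integral_lessThan assms)
  show "integrable lborel q"
    by (rule Bochner_Integration.integrable_bound[OF int]) (use le \<open>0 \<le> B\<close> in \<open>auto simp: abs_mult\<close>)
  have "norm (LBINT s. q s) \<le> (LBINT s. B * (indicator {..<t} s * exp (c * s)))"
    using int \<open>integrable lborel q\<close> le by (intro Bochner_Integration.integral_norm_bound_integral) auto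
  then show "norm (LBINT s. q s) \<le> B * (exp (c * t) / c)"
    using exp_integral_lessThan(2)[OF \<open>c > 0\<close>] by simp
qed

lemma integral_le_exp_greaterThan:
  fixes q :: "real \<Rightarrow> 'a::euclidean_space"
  assumes "c > 0" "0 \<le> B" and [measurable]: "q \<in> borel_measurable borel"
    and le: "\<And>s. norm (q s) \<le> B * (indicator {t<..} s * exp (- c * s))"
  shows "integrable lborel q" and "norm (LBINT s. q s) \<le> B * (exp (- c * t) / c)"
proof -
  have int: "integrable lborel (\<lambda>s. B * (indicator {t<..} s * exp (- c * s)))"
    by (intro integrable_mult_right exp_integral_greaterThan assms)
  show "integrable lborel q"
    by (rule Bochner_Integration.integrable_bound[OF int]) (use le \<open>0 \<le> B\<close> in \<open>auto simp: abs_mult\<close>)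
  have "norm (LBINT s. q s) \<le> (LBINT s. B * (indicator {t<..} s * exp (- c * s)))"
    using int \<open>integrable lborel q\<close> le by (intro Bochner_Integration.integral_norm_bound_integral) auto
  then show "norm (LBINT s. q s) \<le> B * (exp (- c * t) / c)"
    using exp_integral_greaterThan(2)[OF \<open>c > 0\<close>] by simp
qed

text \<open>The interval from \<open>0\<close> to \<open>t\<close> is enlarged to a half-line ending
  at \<open>t\<close>, which costs nothing in the bound that matters. The gain \<open>1 / c\<close>
  is what makes Volterra operators contract once the exponent \<open>c\<close> of the weight is
  large.\<close>

lemma integral_orient_le_exp:
  fixes q :: "real \<Rightarrow> 'a::euclidean_space"
  assumes c: "c > 0" "0 \<le> B" and [measurable]: "q \<in> borel_measurable borel"
    and le: "\<And>s. orient t s \<noteq> 0 \<Longrightarrow> norm (q s) \<le> B * exp (c * \<bar>s\<bar>)"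
  shows "integrable lborel (\<lambda>s. orient t s *\<^sub>R q s)"
    and "norm (LBINT s. orient t s *\<^sub>R q s) \<le> B * (exp (c * \<bar>t\<bar>) / c)"
proof -
  have *: "integrable lborel (\<lambda>s. orient t s *\<^sub>R q s) \<and>
    norm (LBINT s. orient t s *\<^sub>R q s) \<le> B * (exp (c * \<bar>t\<bar>) / c)"
  proof (cases "0 \<le> t")
    case True
    then have "norm (orient t s *\<^sub>R q s) \<le> B * (indicator {..<t} s * exp (c * s))" for s
      using le[of s] c by (auto simp: orient_pos split: split_indicator)
    from integral_le_exp_lessThan[OF c _ this] True show ?thesis by simp
  next
    case False
    then have "norm (orient t s *\<^sub>R q s) \<le> B * (indicator {t<..} s * exp (- c * s))" for s
      using le[of s] c by (auto simp: orient_neg split: split_indicator)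
    from integral_le_exp_greaterThan[OF c _ this] False show ?thesis by simp
  qed
  show "integrable lborel (\<lambda>s. orient t s *\<^sub>R q s)"
    and "norm (LBINT s. orient t s *\<^sub>R q s) \<le> B * (exp (c * \<bar>t\<bar>) / c)"
    using * by auto
qed

lemma integrable_orient_bounded:
  fixes q :: "real \<Rightarrow> 'a::euclidean_space"
  assumes "q \<in> borel_measurable borel"
    and le: "\<And>s. orient t s \<noteq> 0 \<Longrightarrow> norm (q s) \<le> B"
  shows "integrable lborel (\<lambda>s. orient t s *\<^sub>R q s)"
proof (rule integral_orient_le_exp(1)[of 1 "max B 0"])
  fix s assume "orient t s \<noteq> 0"
  from le[OF this] have "norm (q s) \<le> max B 0 * 1" by simp
  also have "\<dots> \<le> max B 0 * exp (1 * \<bar>s\<bar>)" by (intro mult_left_mono) auto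
  finally show "norm (q s) \<le> max B 0 * exp (1 * \<bar>s\<bar>)" .
qed (use assms in auto)

lemma integrable_orient_continuous_mult:
  fixes q :: "real \<Rightarrow> 'a::euclidean_space" and E :: "real \<Rightarrow> 'a \<Rightarrow> 'b::euclidean_space"
  assumes int: "integrable lborel (\<lambda>s. orient t s *\<^sub>R q s)"
    and lin: "\<And>s. linear (E s)"
    and [measurable]: "(\<lambda>s. E s (orient t s *\<^sub>R q s)) \<in> borel_measurable borel"
    and "0 \<le> C" and le: "\<And>s x. orient t s \<noteq> 0 \<Longrightarrow> norm (E s x) \<le> C * norm x"
  shows "integrable lborel (\<lambda>s. orient t s *\<^sub>R E s (q s))"
proof -
  have "norm (E s (orient t s *\<^sub>R q s)) \<le> norm (C *\<^sub>R orient t s *\<^sub>R q s)" for s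
  proof (cases "orient t s = 0")
    case False
    then show ?thesis
      using le[OF False, of "orient t s *\<^sub>R q s"] \<open>0 \<le> C\<close> by (simp add: abs_mult mult.assoc)
  qed (simp add: linear_0[OF lin])
  then have "integrable lborel (\<lambda>s. E s (orient t s *\<^sub>R q s))"
    by (intro Bochner_Integration.integrable_bound[OF integrable_scaleR_right[OF int, of C]]) auto
  then show ?thesis by (simp add: linear_scale[OF lin])
qed

text \<open>Dominated convergence along a sequence \<open>T n\<close> tending to \<open>t\<close>.
  The set of its terms and its limit is compact, hence has a largest element \<open>M\<close> and a
  smallest element \<open>m\<close>, both in \<open>I\<close>, and the densities for
  \<open>M\<close> and \<open>m\<close> together dominate all others. So integrability at the points
  of \<open>I\<close> suffices, even if \<open>I\<close> is not an interval.\<close>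

lemma continuous_on_orient_integral:
  fixes q :: "real \<Rightarrow> 'a::euclidean_space"
  assumes int: "\<And>t. t \<in> I \<Longrightarrow> integrable lborel (\<lambda>s. orient t s *\<^sub>R q s)"
  shows "continuous_on I (\<lambda>t. LBINT s. orient t s *\<^sub>R q s)"
  unfolding continuous_on_sequentially
proof (safe, unfold o_def)
  fix t and T :: "nat \<Rightarrow> real" assume "t \<in> I" and TI: "\<forall>n. T n \<in> I" and T: "T \<longlonglongrightarrow> t"
  have "compact (insert t (range T))" using compact_sequence_with_limit[OF T] by simp
  then obtain M m where Mm: "M \<in> insert t (range T)" "m \<in> insert t (range T)"
      "\<And>r. r \<in> insert t (range T) \<Longrightarrow> m \<le> r \<and> r \<le> M"
    using compact_attains_sup[of "insert t (range T)"] compact_attains_inf[of "insert t (range T)"]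
    by blast
  then have MmI: "M \<in> I" "m \<in> I" using TI \<open>t \<in> I\<close> by auto
  show "(\<lambda>n. LBINT s. orient (T n) s *\<^sub>R q s) \<longlonglongrightarrow> (LBINT s. orient t s *\<^sub>R q s)"
  proof (rule integral_dominated_convergence)
    show "integrable lborel (\<lambda>s. norm (orient M s *\<^sub>R q s) + norm (orient m s *\<^sub>R q s))"
      by (intro Bochner_Integration.integrable_add integrable_norm int MmI)
    show "AE s in lborel. (\<lambda>n. orient (T n) s *\<^sub>R q s) \<longlonglongrightarrow> orient t s *\<^sub>R q s"
    proof (rule AE_mp[OF AE_lborel_singleton[of t]], rule AE_I2, rule impI)
      fix s :: real assume "s \<noteq> t"
      then have "\<forall>\<^sub>F n in sequentially. orient (T n) s = orient t s"
      proof (cases "s < t")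
        case True
        then have "\<forall>\<^sub>F n in sequentially. s < T n" using order_tendstoD(1)[OF T] by simp
        then show ?thesis by eventually_elim (use True in \<open>auto simp: orient_def split: split_indicator\<close>)
      next
        case False
        then have "t < s" using \<open>s \<noteq> t\<close> by simp
        then have "\<forall>\<^sub>F n in sequentially. T n < s" using order_tendstoD(2)[OF T] by simp
        then show ?thesis by eventually_elim (use \<open>t < s\<close> in \<open>auto simp: orient_def split: split_indicator\<close>)
      qed
      then show "(\<lambda>n. orient (T n) s *\<^sub>R q s) \<longlonglongrightarrow> orient t s *\<^sub>R q s"
        by (intro tendsto_eventually) (auto elim: eventually_mono)
    qed
    show "AE s in lborel. norm (orient (T n) s *\<^sub>R q s)
        \<le> norm (orient M s *\<^sub>R q s) + norm (orient m s *\<^sub>R q s)" for n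
      using Mm(3)[of "T n"] by (intro AE_I2) (auto simp: orient_def split: split_indicator)
  qed (use int TI \<open>t \<in> I\<close> in \<open>auto dest: borel_measurable_integrable\<close>)
qed

text \<open>In the weight \<open>exp (2 * L * \<bar>s\<bar>)\<close> the integral operator has norm
  at most \<open>1 / 2\<close>, so \<open>weighted_bound\<close> with \<open>c = 0\<close> forces
  \<open>d\<close> to vanish.\<close>

lemma gronwall_zero:
  fixes d :: "real \<Rightarrow> real"
  assumes meas: "d \<in> borel_measurable borel" and "L > 0"
    and d: "\<And>s. s \<in> closed_segment 0 t \<Longrightarrow> 0 \<le> d s \<and> d s \<le> B0"
    and le: "\<And>s. s \<in> closed_segment 0 t \<Longrightarrow> d s \<le> L * (LBINT r. \<bar>orient s r\<bar> * d r)"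
    and s: "s \<in> closed_segment 0 t"
  shows "d s = 0"
proof -
  have seg: "r \<in> closed_segment 0 t" if "orient s r \<noteq> 0" "s \<in> closed_segment 0 t" for s r
    using that orient_nonzero[of s r] by (auto simp: closed_segment_eq_real_ivl split: if_splits)
  \<comment> \<open>For fixed \<open>s\<close> the density has the constant sign of
    \<open>s\<close>, so the absolute value can be moved into the integrand.\<close>
  have abs_eq: "\<bar>orient s r\<bar> * x = orient s r *\<^sub>R (sgn s * x)" for s r x
    by (auto simp: orient_def split: split_indicator)
  have "d s \<le> 0 / (1 - 1 / 2) * exp (2 * L * \<bar>s\<bar>)"
  proof (rule weighted_bound[where I = "closed_segment 0 t" and ?B0.0 = B0
        and W = "\<lambda>s. exp (2 * L * \<bar>s\<bar>)" and d = d])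
    fix s assume s: "s \<in> closed_segment 0 t"
    have "1 \<le> exp (2 * L * \<bar>s\<bar>)" using \<open>L > 0\<close> by simp
    moreover have "0 \<le> B0" using d[OF s] by linarith
    ultimately show "d s \<le> B0 * exp (2 * L * \<bar>s\<bar>)"
      using d[OF s] mult_left_mono[of 1 "exp (2 * L * \<bar>s\<bar>)" B0] by simp
  next
    fix B s
    assume B: "0 \<le> B" "\<And>s. s \<in> closed_segment 0 t \<Longrightarrow> d s \<le> B * exp (2 * L * \<bar>s\<bar>)"
      and s: "s \<in> closed_segment 0 t"
    have "norm (LBINT r. orient s r *\<^sub>R (sgn s * d r)) \<le> B * (exp (2 * L * \<bar>s\<bar>) / (2 * L))"
    proof (rule integral_orient_le_exp(2))
      fix r assume "orient s r \<noteq> 0"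
      from seg[OF this s] B(2) d show "norm (sgn s * d r) \<le> B * exp (2 * L * \<bar>r\<bar>)"
        by (auto simp: abs_mult abs_sgn_eq intro: order_trans)
    qed (use meas B \<open>L > 0\<close> in auto)
    then have "(LBINT r. \<bar>orient s r\<bar> * d r) \<le> B * (exp (2 * L * \<bar>s\<bar>) / (2 * L))"
      by (simp add: abs_eq)
    then have "L * (LBINT r. \<bar>orient s r\<bar> * d r) \<le> L * (B * (exp (2 * L * \<bar>s\<bar>) / (2 * L)))"
      using \<open>L > 0\<close> by (intro mult_left_mono) auto
    also have "\<dots> = 1 / 2 * B * exp (2 * L * \<bar>s\<bar>)"
      using \<open>L > 0\<close> by simp
    finally have "L * (LBINT r. \<bar>orient s r\<bar> * d r) \<le> 1 / 2 * B * exp (2 * L * \<bar>s\<bar>)" .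
    then show "d s \<le> (0 + 1 / 2 * B) * exp (2 * L * \<bar>s\<bar>)"
      using le[OF s] by simp
  qed (use d s in auto)
  then show ?thesis using d[OF s] by simp
qed


section \<open>Variation of constants\<close>

lemma matrix_exp_bound:
  fixes A :: "real ^ 'n ^ 'n"
  obtains C where "0 < C" "\<And>r y. \<bar>r\<bar> \<le> T \<Longrightarrow> norm (matrix_exp (r *\<^sub>R A) *v y) \<le> C * norm y"
proof -
  obtain K where K: "0 < K" "\<And>(X :: real ^ 'n ^ 'n) (y :: real ^ 'n). norm (X *v y) \<le> norm X * norm y * K"
    using bounded_bilinear.pos_bounded[OF bounded_bilinear_matrix_vector_mult] by blast
  have "compact ((\<lambda>r. matrix_exp (r *\<^sub>R A)) ` {- T..T})"
    by (intro compact_continuous_image continuous_intros) auto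
  then have "bounded ((\<lambda>r. matrix_exp (r *\<^sub>R A)) ` {- T..T})" by (rule compact_imp_bounded)
  then obtain B where B: "0 < B" "\<And>r. r \<in> {- T..T} \<Longrightarrow> norm (matrix_exp (r *\<^sub>R A)) \<le> B"
    unfolding bounded_pos by auto
  show ?thesis
  proof (rule that[of "B * K"])
    fix r and y :: "real ^ 'n" assume "\<bar>r\<bar> \<le> T"
    then have "norm (matrix_exp (r *\<^sub>R A)) * norm y * K \<le> B * norm y * K"
      using B(2)[of r] K by (intro mult_right_mono) (auto simp: abs_le_iff)
    then show "norm (matrix_exp (r *\<^sub>R A) *v y) \<le> B * K * norm y"
      using K(2)[of "matrix_exp (r *\<^sub>R A)" y] by (simp add: mult_ac)
  qed (use B K in auto)
qed

lemma orient_segment: "orient t s \<noteq> 0 \<Longrightarrow> s \<in> closed_segment 0 t"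
  using orient_nonzero[of t s] by (auto simp: closed_segment_eq_real_ivl)

lemma segment_orient_le: "s \<in> closed_segment 0 t \<Longrightarrow> \<bar>orient s r\<bar> \<le> \<bar>orient t r\<bar>"
  by (auto simp: orient_def closed_segment_eq_real_ivl split: split_indicator if_splits)

lemma integrable_orient_segment:
  fixes f :: "real \<Rightarrow> 'a::euclidean_space"
  assumes [measurable]: "f \<in> borel_measurable borel"
    and "integrable lborel (\<lambda>s. orient t s *\<^sub>R f s)" "r \<in> closed_segment 0 t"
  shows "integrable lborel (\<lambda>s. orient r s *\<^sub>R f s)"
  using segment_orient_le[OF assms(3)]
  by (intro Bochner_Integration.integrable_bound[OF assms(2)]) (auto intro!: mult_right_mono)

lemma integrable_orient_matrix_exp:
  fixes A :: "real ^ 'n ^ 'n"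
  assumes [measurable]: "f \<in> borel_measurable borel"
    and "integrable lborel (\<lambda>s. orient t s *\<^sub>R f s)"
  shows "integrable lborel (\<lambda>s. orient t s *\<^sub>R (matrix_exp ((t - s) *\<^sub>R A) *v f s))"
proof -
  obtain C where C: "0 < C" "\<And>r y. \<bar>r\<bar> \<le> \<bar>t\<bar> \<Longrightarrow> norm (matrix_exp (r *\<^sub>R A) *v y) \<le> C * norm y"
    using matrix_exp_bound by blast
  show ?thesis
  proof (rule integrable_orient_continuous_mult[OF assms(2), where C = C])
    fix s x assume "orient t s \<noteq> 0"
    then show "norm (matrix_exp ((t - s) *\<^sub>R A) *v x) \<le> C * norm x"
      using orient_nonzero[of t s] by (intro C) auto
  qed (use C in auto)
qed

text \<open>The inner integral of the Fubini argument for variation of constants. The product of the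
  two densities restricts \<open>r\<close> to lie between \<open>s\<close> and \<open>t\<close>, and
  the fundamental theorem of calculus applies to
  \<open>r \<mapsto> exp ((r - s) A) y\<close>.\<close>

lemma orient_mult_integral:
  fixes A :: "real ^ 'n ^ 'n"
  shows "(LBINT r. (orient t r * orient r s) *\<^sub>R (A *v (matrix_exp ((r - s) *\<^sub>R A) *v y)))
    = orient t s *\<^sub>R (matrix_exp ((t - s) *\<^sub>R A) *v y - y)" (is "?lhs = ?rhs")
proof -
  let ?g = "\<lambda>r. A *v (matrix_exp ((r - s) *\<^sub>R A) *v y)"
  have FTC: "(LBINT r=ereal a..ereal b. ?g r)
      = matrix_exp ((b - s) *\<^sub>R A) *v y - matrix_exp ((a - s) *\<^sub>R A) *v y" for a b
  proof (rule interval_integral_FTC_finite)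
    show "continuous_on {min a b..max a b} ?g"
      by (intro bounded_bilinear.continuous_on[OF bounded_bilinear_matrix_vector_mult]
          continuous_intros)
    have "((\<lambda>r. matrix_exp ((r - s) *\<^sub>R A) *v y) has_vector_derivative ?g x) (at x)" for x
    proof -
      have "((\<lambda>r. r - s) has_vector_derivative 1) (at x)"
        by (auto intro!: derivative_eq_intros)
      from vector_diff_chain_at[OF this matrix_exp_vec_has_vector_derivative[of A y _ UNIV]]
      show ?thesis by (simp add: o_def)
    qed
    then show "((\<lambda>r. matrix_exp ((r - s) *\<^sub>R A) *v y) has_vector_derivative ?g x)
        (at x within {min a b..max a b})" for x
      by (rule has_vector_derivative_at_within)
  qed
  consider "0 < s \<and> s < t" | "t < s \<and> s < 0" | "orient t s = 0"
    using orient_nonzero[of t s] by blast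
  then show ?thesis
  proof cases
    case 1
    have "orient t r * orient r s = indicator {s<..<t} r" for r
      using 1 by (auto simp: orient_def split: split_indicator)
    then have "?lhs = (LBINT r=ereal s..ereal t. ?g r)"
      using 1 by (simp only: interval_lebesgue_integral_def set_lebesgue_integral_def
          einterval_eq ereal_less_eq less_imp_le if_True)
    also have "\<dots> = ?rhs"
      using 1 unfolding FTC by (simp add: matrix_exp_0 orient_def)
    finally show ?thesis .
  next
    \<comment> \<open>Both densities are \<open>- 1\<close> here, so their product is again an
      indicator; the integral now runs upwards from \<open>t\<close> to \<open>s\<close>, which
      restores the sign of \<open>orient t s\<close>.\<close>
    case 2
    have "orient t r * orient r s = indicator {t<..<s} r" for r
      using 2 by (auto simp: orient_def split: split_indicator)
    then have "?lhs = (LBINT r=ereal t..ereal s. ?g r)"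
      using 2 by (simp only: interval_lebesgue_integral_def set_lebesgue_integral_def
          einterval_eq ereal_less_eq less_imp_le if_True)
    also have "\<dots> = ?rhs"
      using 2 unfolding FTC by (simp add: matrix_exp_0 orient_def)
    finally show ?thesis .
  next
    case 3
    have 0: "orient t r * orient r s = 0" for r
    proof (rule ccontr)
      assume "orient t r * orient r s \<noteq> 0"
      then have "orient t r \<noteq> 0" "orient r s \<noteq> 0" by auto
      then have "0 < s \<and> s < t \<or> t < s \<and> s < 0" using orient_nonzero[of t r] orient_nonzero[of r s] by auto
      then have "orient t s \<noteq> 0" by (auto simp: orient_def)
      then show False using 3 by simp
    qed
    have "(\<lambda>r. (orient t r * orient r s) *\<^sub>R (A *v (matrix_exp ((r - s) *\<^sub>R A) *v y))) = (\<lambda>r. 0)"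
      by (rule ext) (simp only: 0 scaleR_zero_left)
    then show ?thesis by (simp only: 3 scaleR_zero_left Bochner_Integration.integral_zero)
  qed
qed

lemma orient_matrix_exp_integral:
  fixes A :: "real ^ 'n ^ 'n"
  shows "integrable lborel (\<lambda>r. orient t r *\<^sub>R (A *v (matrix_exp (r *\<^sub>R A) *v y)))"
    and "(LBINT r. orient t r *\<^sub>R (A *v (matrix_exp (r *\<^sub>R A) *v y)))
      = matrix_exp (t *\<^sub>R A) *v y - y"
proof -
  let ?g = "\<lambda>r. A *v (matrix_exp (r *\<^sub>R A) *v y)"
  have cont: "continuous_on U ?g" for U
    by (intro bounded_bilinear.continuous_on[OF bounded_bilinear_matrix_vector_mult]
        continuous_intros)
  have "bounded (?g ` closed_segment 0 t)"
    by (intro compact_imp_bounded compact_continuous_image cont compact_segment)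
  then obtain B where "\<And>r. r \<in> closed_segment 0 t \<Longrightarrow> norm (?g r) \<le> B"
    by (auto simp: bounded_iff)
  then show "integrable lborel (\<lambda>r. orient t r *\<^sub>R ?g r)"
    by (intro integrable_orient_bounded[where B = B])
       (auto dest: orient_segment)
  have "(LBINT r=ereal 0..ereal t. ?g r) = matrix_exp (t *\<^sub>R A) *v y - matrix_exp (0 *\<^sub>R A) *v y"
    by (intro interval_integral_FTC_finite cont matrix_exp_vec_has_vector_derivative)
  then show "(LBINT r. orient t r *\<^sub>R ?g r) = matrix_exp (t *\<^sub>R A) *v y - y"
    by (simp only: zero_ereal_def[symmetric] interval_integral_orient scaleR_zero_left matrix_exp_0 matrix_vector_mul_lid)
qed

text \<open>Fubini on the triangle, with
  \<open>exp ((t - s) A) = 1 + (\<integral> A exp ((r - s) A) dr)\<close>, the integral running from \<open>s\<close> to \<open>t\<close>.\<close>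

lemma mild_imp_integrated:
  fixes A :: "real ^ 'n ^ 'n" and f u :: "real \<Rightarrow> real ^ 'n"
  assumes meas [measurable]: "f \<in> borel_measurable borel"
    and int: "integrable lborel (\<lambda>s. orient t s *\<^sub>R f s)"
    and u: "\<And>r. r \<in> closed_segment 0 t \<Longrightarrow>
      u r = matrix_exp (r *\<^sub>R A) *v u0
        + (LBINT s. orient r s *\<^sub>R (matrix_exp ((r - s) *\<^sub>R A) *v f s))"
  shows "integrable lborel (\<lambda>r. orient t r *\<^sub>R (A *v u r + f r))"
    and "u t = u0 + (LBINT r. orient t r *\<^sub>R (A *v u r + f r))"
proof -
  let ?E = "\<lambda>t. matrix_exp (t *\<^sub>R A)"
  let ?h = "\<lambda>s r. (orient t r * orient r s) *\<^sub>R (A *v (?E (r - s) *v f s))"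
  define m where "m r = (LBINT s. orient r s *\<^sub>R (?E (r - s) *v f s))" for r
  obtain C where C: "0 < C" "\<And>r y. \<bar>r\<bar> \<le> \<bar>t\<bar> \<Longrightarrow> norm (?E r *v y) \<le> C * norm y"
    using matrix_exp_bound by blast
  obtain L where L: "0 < L" "\<And>y. norm (A *v y) \<le> norm y * L"
    using bounded_linear.pos_bounded[OF matrix_vector_mul_bounded_linear] by blast
  \<comment> \<open>Domination by a product of a function of \<open>s\<close> and a function of
    \<open>r\<close>, both integrable. This makes Fubini applicable with \<open>f\<close> merely
    measurable and integrable.\<close>
  have h_le: "norm (?h s r) \<le> \<bar>orient t r\<bar> * (L * C * norm (orient t s *\<^sub>R f s))" for s r
  proof (cases "orient t r = 0 \<or> orient r s = 0")
    case False
    then have rs: "\<bar>r - s\<bar> \<le> \<bar>t\<bar>" "\<bar>orient r s\<bar> \<le> \<bar>orient t s\<bar>"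
      using orient_nonzero[of t r] orient_nonzero[of r s] orient_segment[of t r]
      by (auto intro: segment_orient_le)
    have "norm (A *v (?E (r - s) *v f s)) \<le> norm (?E (r - s) *v f s) * L" by (rule L)
    also have "\<dots> \<le> C * norm (f s) * L" using L C rs by (intro mult_right_mono) auto
    finally have "norm (?h s r) \<le> \<bar>orient t r\<bar> * \<bar>orient r s\<bar> * (C * norm (f s) * L)"
      by (auto simp: abs_mult intro!: mult_left_mono)
    also have "\<dots> \<le> \<bar>orient t r\<bar> * \<bar>orient t s\<bar> * (C * norm (f s) * L)"
      using rs C L by (intro mult_right_mono mult_left_mono) auto
    finally show ?thesis by (simp add: mult_ac)
  qed (use C L in auto)
  have int1: "integrable lborel (orient t)"
    using integrable_orient_bounded[of "\<lambda>_. 1 :: real" t 1] by simp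
  have int_h: "integrable (lborel \<Otimes>\<^sub>M lborel) (\<lambda>(s, r). ?h s r)"
  proof (rule Bochner_Integration.integrable_bound)
    show "integrable (lborel \<Otimes>\<^sub>M lborel)
        (\<lambda>(s, r). (L * C * norm (orient t s *\<^sub>R f s)) * \<bar>orient t r\<bar>)"
    proof (rule lborel_pair.Fubini_integrable)
      show "integrable lborel (\<lambda>s. LBINT r. norm (case (s, r) of (s, r) \<Rightarrow>
          (L * C * norm (orient t s *\<^sub>R f s)) * \<bar>orient t r\<bar>))"
      proof -
        have "integrable lborel (\<lambda>s. norm (orient t s *\<^sub>R f s) * (L * C * (LBINT r. \<bar>orient t r\<bar>)))"
          by (intro integrable_mult_left integrable_norm int)
        then show ?thesis using C L by (simp add: abs_mult mult_ac)
      qed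
    qed (use int1 in auto)
    show "AE x in lborel \<Otimes>\<^sub>M lborel. norm (case x of (s, r) \<Rightarrow> ?h s r) \<le>
        norm (case x of (s, r) \<Rightarrow> (L * C * norm (orient t s *\<^sub>R f s)) * \<bar>orient t r\<bar>)"
    proof (rule AE_I2, clarify)
      fix s r
      have "norm (?h s r) \<le> (L * C * norm (orient t s *\<^sub>R f s)) * \<bar>orient t r\<bar>"
        using h_le[of r s] by (simp only: mult.commute)
      then show "norm (?h s r) \<le> norm ((L * C * norm (orient t s *\<^sub>R f s)) * \<bar>orient t r\<bar>)"
        unfolding real_norm_def by linarith
    qed
  qed simp
  have inner: "(LBINT s. ?h s r) = orient t r *\<^sub>R (A *v m r)" for r
  proof (cases "orient t r = 0")
    case False
    then have "integrable lborel (\<lambda>s. orient r s *\<^sub>R (?E (r - s) *v f s))"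
      by (intro integrable_orient_matrix_exp integrable_orient_segment[OF _ int] orient_segment meas)
    then have "A *v m r = (LBINT s. A *v (orient r s *\<^sub>R (?E (r - s) *v f s)))"
      unfolding m_def by (intro integral_bounded_linear[symmetric]) auto
    then show ?thesis
      by (simp only: matrix_vector_mult_scaleR scaleR_scaleR[symmetric] integral_scaleR_right)
  qed simp
  have int_m: "integrable lborel (\<lambda>r. orient t r *\<^sub>R (A *v m r))"
    using lborel_pair.integrable_snd[OF int_h] by (simp add: inner)
  have "(LBINT r. orient t r *\<^sub>R (A *v m r)) = (LBINT r. (LBINT s. ?h s r))"
    by (simp add: inner)
  also have "\<dots> = (LBINT s. (LBINT r. ?h s r))"
    by (rule lborel_pair.Fubini_integral[OF int_h])
  also have "\<dots> = (LBINT s. orient t s *\<^sub>R (?E (t - s) *v f s - f s))"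
    by (simp add: orient_mult_integral)
  also have "\<dots> = m t - (LBINT s. orient t s *\<^sub>R f s)"
    unfolding m_def using int integrable_orient_matrix_exp[OF meas int]
    by (simp add: scaleR_diff_right)
  finally have m_eq: "(LBINT r. orient t r *\<^sub>R (A *v m r))
      = m t - (LBINT s. orient t s *\<^sub>R f s)" .
  have eq: "orient t r *\<^sub>R (A *v u r + f r) = orient t r *\<^sub>R (A *v (?E r *v u0))
      + orient t r *\<^sub>R (A *v m r) + orient t r *\<^sub>R f r" for r
  proof (cases "orient t r = 0")
    case False
    then show ?thesis
      using u[OF orient_segment] by (simp add: m_def matrix_vector_right_distrib scaleR_right_distrib)
  qed simp
  show "integrable lborel (\<lambda>r. orient t r *\<^sub>R (A *v u r + f r))"
    unfolding eq by (intro Bochner_Integration.integrable_add orient_matrix_exp_integral int_m int)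
  show "u t = u0 + (LBINT r. orient t r *\<^sub>R (A *v u r + f r))"
    unfolding eq using int int_m m_eq orient_matrix_exp_integral[of t A u0] u[of t]
    by (simp add: m_def)
qed

text \<open>Neither \<open>u\<close> nor \<open>v\<close> is assumed continuous, measurable or
  bounded: on the segment all of this follows from the equation, whose right side is continuous in
  the upper limit. The distance, cut off outside the segment, then satisfies the hypotheses of
  \<open>gronwall_zero\<close>.\<close>

lemma integral_equation_unique:
  fixes G :: "real \<Rightarrow> 'a::euclidean_space \<Rightarrow> 'a"
  assumes L: "L > 0" "\<And>s p q. norm (G s p - G s q) \<le> L * norm (p - q)"
    and u: "\<And>r. r \<in> closed_segment 0 t \<Longrightarrow> integrable lborel (\<lambda>s. orient r s *\<^sub>R G s (u s)) \<and>
      u r = z + (LBINT s. orient r s *\<^sub>R G s (u s))"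
    and v: "\<And>r. r \<in> closed_segment 0 t \<Longrightarrow> integrable lborel (\<lambda>s. orient r s *\<^sub>R G s (v s)) \<and>
      v r = z + (LBINT s. orient r s *\<^sub>R G s (v s))"
  shows "u t = v t"
proof -
  let ?J = "closed_segment 0 t"
  define d where "d r = indicator ?J r *\<^sub>R norm (u r - v r)" for r
  have sub: "closed_segment 0 r \<subseteq> ?J" if "r \<in> ?J" for r
    using that by (simp add: subset_closed_segment)
  have "continuous_on ?J (\<lambda>r. z + (LBINT s. orient r s *\<^sub>R G s (w s)))"
    if "\<And>r. r \<in> ?J \<Longrightarrow> integrable lborel (\<lambda>s. orient r s *\<^sub>R G s (w s))" for w
    by (intro continuous_on_add continuous_on_const continuous_on_orient_integral that)
  then have cu: "continuous_on ?J u" and cv: "continuous_on ?J v"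
    using u v by (auto cong: continuous_on_cong)
  have cuv: "continuous_on ?J (\<lambda>r. norm (u r - v r))" by (intro continuous_intros cu cv)
  have md [measurable]: "d \<in> borel_measurable borel"
    unfolding d_def by (rule borel_measurable_continuous_on_indicator[OF _ cuv]) simp
  have "bounded ((\<lambda>r. norm (u r - v r)) ` ?J)"
    by (intro compact_imp_bounded compact_continuous_image cuv compact_segment)
  then obtain B where B: "\<And>r. r \<in> ?J \<Longrightarrow> norm (u r - v r) \<le> B"
    unfolding bounded_iff by auto
  have le: "d r \<le> L * (LBINT s. \<bar>orient r s\<bar> * d s)" if r: "r \<in> ?J" for r
  proof -
    have "integrable lborel (\<lambda>s. orient r s *\<^sub>R d s)"
    proof (rule integrable_orient_bounded[OF md])
      fix s assume "orient r s \<noteq> 0"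
      then have "s \<in> ?J" using orient_segment sub[OF r] by blast
      then show "norm (d s) \<le> B" using B by (simp add: d_def)
    qed
    then have "integrable lborel (\<lambda>s. norm (orient r s *\<^sub>R d s))" by (rule integrable_norm)
    moreover have "norm (orient r s *\<^sub>R d s) = \<bar>orient r s\<bar> * d s" for s
      by (simp add: d_def abs_mult)
    ultimately have int_d: "integrable lborel (\<lambda>s. \<bar>orient r s\<bar> * d s)" by (simp only:)
    have "u r - v r = (LBINT s. orient r s *\<^sub>R G s (u s) - orient r s *\<^sub>R G s (v s))"
      using u[OF r] v[OF r] by simp
    then have "d r \<le> (LBINT s. L * (\<bar>orient r s\<bar> * d s))"
      using r u[OF r] v[OF r] int_d
    proof (simp only: d_def[of r] indicator_simps scaleR_one,
        intro Bochner_Integration.integral_norm_bound_integral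
          Bochner_Integration.integrable_diff integrable_mult_right, simp_all only: simp_thms)
      fix s
      show "norm (orient r s *\<^sub>R G s (u s) - orient r s *\<^sub>R G s (v s)) \<le> L * (\<bar>orient r s\<bar> * d s)"
      proof (cases "orient r s = 0")
        case False
        then have "s \<in> ?J" using orient_segment sub[OF r] by blast
        then show ?thesis
          using mult_left_mono[OF L(2)[of s "u s" "v s"], of "\<bar>orient r s\<bar>"]
          by (simp add: d_def mult_ac flip: scaleR_diff_right)
      qed simp
    qed
    then show ?thesis by simp
  qed
  have "d t = 0"
    by (rule gronwall_zero[OF md L(1) _ le, where t = t and ?B0.0 = B]) (auto simp: d_def B)
  then show ?thesis by (simp add: d_def)
qed

text \<open>No second computation is needed: the right side of the formula solves the integrated
  equation by \<open>mild_imp_integrated\<close>, and that equation has only one solution.\<close>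

lemma integrated_imp_mild:
  fixes A :: "real ^ 'n ^ 'n" and f u :: "real \<Rightarrow> real ^ 'n"
  assumes meas: "f \<in> borel_measurable borel"
    and int: "integrable lborel (\<lambda>s. orient t s *\<^sub>R f s)"
    and u: "\<And>r. r \<in> closed_segment 0 t \<Longrightarrow> integrable lborel (\<lambda>s. orient r s *\<^sub>R (A *v u s + f s)) \<and>
      u r = u0 + (LBINT s. orient r s *\<^sub>R (A *v u s + f s))"
  shows "u t = matrix_exp (t *\<^sub>R A) *v u0
        + (LBINT s. orient t s *\<^sub>R (matrix_exp ((t - s) *\<^sub>R A) *v f s))"
proof -
  let ?E = "\<lambda>t. matrix_exp (t *\<^sub>R A)"
  define v where "v r = ?E r *v u0 + (LBINT s. orient r s *\<^sub>R (?E (r - s) *v f s))" for r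
  obtain L where L: "0 < L" "\<And>y. norm (A *v y) \<le> norm y * L"
    using bounded_linear.pos_bounded[OF matrix_vector_mul_bounded_linear] by blast
  have "u t = v t"
  proof (rule integral_equation_unique[where G = "\<lambda>s p. A *v p + f s" and z = u0, OF L(1) _ u])
    show "norm (A *v p + f s - (A *v q + f s)) \<le> L * norm (p - q)" for s p q
      using L(2)[of "p - q"] by (simp add: matrix_vector_mult_diff_distrib mult.commute)
    show "integrable lborel (\<lambda>s. orient r s *\<^sub>R (A *v v s + f s)) \<and>
      v r = u0 + (LBINT s. orient r s *\<^sub>R (A *v v s + f s))" if "r \<in> closed_segment 0 t" for r
      using mild_imp_integrated[OF meas integrable_orient_segment[OF meas int that], of v A u0]
      by (auto simp: v_def)
  qed
  then show ?thesis by (simp add: v_def)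
qed


section \<open>The flow of the random differential system\<close>

lemma exp_linear_bound: "0 < c \<Longrightarrow> 1 + \<bar>t\<bar> \<le> (1 + 1 / c) * exp (c * \<bar>t :: real\<bar>)"
proof -
  assume c: "0 < c"
  have "c * \<bar>t\<bar> \<le> exp (c * \<bar>t\<bar>)" using exp_ge_add_one_self[of "c * \<bar>t\<bar>"] by linarith
  then have "\<bar>t\<bar> \<le> 1 / c * exp (c * \<bar>t\<bar>)" using c by (simp add: field_simps)
  moreover have "1 \<le> exp (c * \<bar>t\<bar>)" using c by simp
  ultimately show ?thesis unfolding distrib_right mult_1 by linarith
qed

text \<open>What the pathwise analysis asks of the noise: growth below every exponential rate in
  both time directions. The class is invariant under time shifts, and one bound serves both the
  weight with exponent \<gamma> and the steeper weight used to construct the flow.\<close>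

definition tame :: "(real \<Rightarrow> 'a::real_normed_vector) \<Rightarrow> bool" where
  "tame \<xi> \<longleftrightarrow> \<xi> \<in> borel_measurable borel \<and> (\<forall>c>0. \<exists>C. \<forall>t. norm (\<xi> t) \<le> C * exp (c * \<bar>t\<bar>))"

lemma tame_measurable [measurable_dest]: "tame \<xi> \<Longrightarrow> \<xi> \<in> borel_measurable borel"
  by (simp add: tame_def)

lemma tame_bound:
  assumes "tame \<xi>" "c > 0"
  obtains C where "0 \<le> C" "\<And>t. norm (\<xi> t) \<le> C * exp (c * \<bar>t\<bar>)"
proof -
  obtain C where C: "\<And>t. norm (\<xi> t) \<le> C * exp (c * \<bar>t\<bar>)"
    using assms unfolding tame_def by blast
  have "0 \<le> C" using order_trans[OF norm_ge_zero C[of 0]] by simp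
  then show ?thesis using C that by blast
qed

lemma tame_shift:
  assumes "tame \<xi>"
  shows "tame (\<lambda>r. \<xi> (r + s))"
  unfolding tame_def
proof (intro conjI allI impI)
  note [measurable] = tame_measurable[OF assms]
  show "(\<lambda>r. \<xi> (r + s)) \<in> borel_measurable borel" by measurable
  fix c :: real assume "c > 0"
  then obtain C where C: "0 \<le> C" "\<And>t. norm (\<xi> t) \<le> C * exp (c * \<bar>t\<bar>)"
    using tame_bound[OF assms] by blast
  have "norm (\<xi> (t + s)) \<le> C * exp (c * \<bar>s\<bar>) * exp (c * \<bar>t\<bar>)" for t
  proof -
    have "c * \<bar>t + s\<bar> \<le> c * (\<bar>s\<bar> + \<bar>t\<bar>)" using \<open>c > 0\<close> by (intro mult_left_mono) auto
    then have "C * exp (c * \<bar>t + s\<bar>) \<le> C * exp (c * (\<bar>s\<bar> + \<bar>t\<bar>))"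
      using C(1) by (intro mult_left_mono) auto
    then show ?thesis using C(2)[of "t + s"] by (simp add: distrib_left exp_add mult_ac)
  qed
  then show "\<exists>C. \<forall>t. norm (\<xi> (t + s)) \<le> C * exp (c * \<bar>t\<bar>)" by blast
qed

text \<open>Additivity of oriented intervals at the level of densities. The excluded points are the
  end points, which the open intervals omit; they form a null set.\<close>

lemma orient_shift: "s \<notin> {t, 0, r} \<Longrightarrow> orient t s - orient r s = orient (t - r) (s - r)"
  by (auto simp: orient_def split: split_indicator)

lemma integral_orient_shift:
  fixes q :: "real \<Rightarrow> 'a::euclidean_space"
  assumes [measurable]: "q \<in> borel_measurable borel"
    and t: "integrable lborel (\<lambda>s. orient (t + r) s *\<^sub>R q s)"
    and r: "integrable lborel (\<lambda>s. orient r s *\<^sub>R q s)"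
  shows "integrable lborel (\<lambda>s. orient t s *\<^sub>R q (s + r))"
    and "(LBINT s. orient (t + r) s *\<^sub>R q s)
      = (LBINT s. orient r s *\<^sub>R q s) + (LBINT s. orient t s *\<^sub>R q (s + r))"
proof -
  let ?d = "\<lambda>s. orient (t + r) s *\<^sub>R q s - orient r s *\<^sub>R q s"
  let ?e = "\<lambda>s. ?d (r + 1 * s)"
  have d: "integrable lborel ?d" by (intro Bochner_Integration.integrable_diff t r)
  then have e: "integrable lborel ?e"
    by (subst lborel_integrable_real_affine_iff) auto
  have AE: "AE s in lborel. ?e s = orient t s *\<^sub>R q (s + r)"
  proof -
    have "AE s in lborel. s \<notin> {t, 0, - r}"
      by (intro AE_not_in finite_imp_null_set_lborel) auto
    then show ?thesis
    proof (rule AE_mp, intro AE_I2 impI)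
      fix s assume "s \<notin> {t, 0, - r}"
      then have "orient (t + r) (s + r) - orient r (s + r) = orient t s"
        using orient_shift[of "s + r" "t + r" r] by auto
      then show "?e s = orient t s *\<^sub>R q (s + r)"
        by (simp add: add.commute[of r] flip: scaleR_diff_left)
    qed
  qed
  have q: "(\<lambda>s. orient t s *\<^sub>R q (s + r)) \<in> borel_measurable lborel" by measurable
  show "integrable lborel (\<lambda>s. orient t s *\<^sub>R q (s + r))"
    by (rule integrable_cong_AE_imp[OF e q]) (use AE in auto)
  have "(LBINT s. orient t s *\<^sub>R q (s + r)) = integral\<^sup>L lborel ?e"
    by (rule integral_cong_AE[OF q borel_measurable_integrable[OF e]]) (use AE in auto)
  also have "\<dots> = integral\<^sup>L lborel ?d"
    by (subst lborel_integral_real_affine[of 1 ?d r]) auto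
  finally show "(LBINT s. orient (t + r) s *\<^sub>R q s)
      = (LBINT s. orient r s *\<^sub>R q s) + (LBINT s. orient t s *\<^sub>R q (s + r))"
    using t r by simp
qed

text \<open>The library rules for the projections concern the product of two Borel algebras rather than
  the Borel algebra of the product type.\<close>

lemma borel_measurable_fst_pair:
  "f \<in> borel_measurable M \<Longrightarrow> (\<lambda>x. fst (f x :: 'a::real_normed_vector \<times> 'b::real_normed_vector)) \<in> borel_measurable M"
  by (rule borel_measurable_continuous_on[OF continuous_on_fst[OF continuous_on_id]])

lemma borel_measurable_snd_pair:
  "f \<in> borel_measurable M \<Longrightarrow> (\<lambda>x. snd (f x :: 'a::real_normed_vector \<times> 'b::real_normed_vector)) \<in> borel_measurable M"
  by (rule borel_measurable_continuous_on[OF continuous_on_snd[OF continuous_on_id]])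

abbreviation ou_path where "ou_path F w \<equiv> \<lambda>s. ou F (wshift s w)"

text \<open>The noise is not part of the locale but an argument \<xi> of its constants, so that the
  shifted noise is just another argument. Smallness of \<epsilon> enters through the hypothesis
  \<open>cs + cf < 1\<close>, and its stronger form for tracking, on the lemmas concerned; the flow
  is thus available for every positive \<epsilon>.\<close>

locale slow_fast =
  fixes S :: "real ^ 'n ^ 'n" and F :: "real ^ 'm ^ 'm"
    and g1 :: "real ^ 'n \<Rightarrow> real ^ 'm \<Rightarrow> real ^ 'n"
    and g2 :: "real ^ 'n \<Rightarrow> real ^ 'm \<Rightarrow> real ^ 'm"
    and \<sigma> \<gamma>s \<gamma>f K \<gamma> \<epsilon> :: real
  assumes \<sigma>_pos: "\<sigma> > 0" and \<epsilon>_pos: "\<epsilon> > 0" and \<gamma>s_pos: "\<gamma>s > 0" and K_pos: "K > 0"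
    and \<gamma>_pos: "\<gamma> > 0" and gap: "K < - (\<gamma> + \<gamma>f)"
    and g_zero: "g1 0 0 = 0" "g2 0 0 = 0"
    and exp_S: "t \<le> 0 \<Longrightarrow> norm (matrix_exp (t *\<^sub>R S) *v x) \<le> exp (\<gamma>s * t) * norm x"
    and exp_F: "0 \<le> t \<Longrightarrow> norm (matrix_exp (t *\<^sub>R F) *v y) \<le> exp (\<gamma>f * t) * norm y"
    and g1_lipschitz: "norm (g1 x1 y1 - g1 x2 y2) \<le> K * (norm (x1 - x2) + norm (y1 - y2))"
    and g2_lipschitz: "norm (g2 x1 y1 - g2 x2 y2) \<le> K * (norm (x1 - x2) + norm (y1 - y2))"
begin

abbreviation ES :: "real \<Rightarrow> real ^ 'n ^ 'n" where "ES t \<equiv> matrix_exp ((\<epsilon> * t) *\<^sub>R S)"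
abbreviation EF :: "real \<Rightarrow> real ^ 'm ^ 'm" where "EF t \<equiv> matrix_exp (t *\<^sub>R F)"

abbreviation wt :: "real \<Rightarrow> real" where "wt t \<equiv> exp (- \<gamma> * t)"

definition nl1 :: "real ^ 'm \<Rightarrow> (real ^ 'n) \<times> (real ^ 'm) \<Rightarrow> real ^ 'n" where
  "nl1 e p = g1 (fst p) (snd p + \<sigma> *\<^sub>R e)"

definition nl2 :: "real ^ 'm \<Rightarrow> (real ^ 'n) \<times> (real ^ 'm) \<Rightarrow> real ^ 'm" where
  "nl2 e p = g2 (fst p) (snd p + \<sigma> *\<^sub>R e)"

definition field :: "real ^ 'm \<Rightarrow> (real ^ 'n) \<times> (real ^ 'm) \<Rightarrow> (real ^ 'n) \<times> (real ^ 'm)" where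
  "field e p = (\<epsilon> *\<^sub>R (S *v fst p) + \<epsilon> *\<^sub>R nl1 e p, F *v snd p + nl2 e p)"

text \<open>The set \<open>I\<close> of times lets a solution on a half-line be compared with the
  global one: at a time \<open>t\<close> only the values between \<open>0\<close> and
  \<open>t\<close> enter.\<close>

definition integral_curve ::
    "real set \<Rightarrow> (real \<Rightarrow> real ^ 'm) \<Rightarrow> (real ^ 'n) \<times> (real ^ 'm) \<Rightarrow>
     (real \<Rightarrow> (real ^ 'n) \<times> (real ^ 'm)) \<Rightarrow> bool" where
  "integral_curve I \<xi> z u \<longleftrightarrow> (\<forall>t\<in>I. integrable lborel (\<lambda>s. orient t s *\<^sub>R field (\<xi> s) (u s)) \<and>
     u t = z + (LBINT s. orient t s *\<^sub>R field (\<xi> s) (u s)))"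

lemma nl_lipschitz:
  "norm (nl1 e p - nl1 e q) \<le> K * norm1 (p - q)" "norm (nl2 e p - nl2 e q) \<le> K * norm1 (p - q)"
  using g1_lipschitz[of "fst p" "snd p + \<sigma> *\<^sub>R e" "fst q" "snd q + \<sigma> *\<^sub>R e"]
    g2_lipschitz[of "fst p" "snd p + \<sigma> *\<^sub>R e" "fst q" "snd q + \<sigma> *\<^sub>R e"]
  by (auto simp: nl1_def nl2_def norm1_def)

lemma nl_growth:
  "norm (nl1 e p) \<le> K * norm1 p + K * \<sigma> * norm e" "norm (nl2 e p) \<le> K * norm1 p + K * \<sigma> * norm e"
proof -
  have "norm (snd p + \<sigma> *\<^sub>R e) \<le> norm (snd p) + \<sigma> * norm e"
    using norm_triangle_ineq[of "snd p" "\<sigma> *\<^sub>R e"] \<sigma>_pos by simp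
  then have "K * (norm (fst p) + norm (snd p + \<sigma> *\<^sub>R e)) \<le> K * (norm (fst p) + (norm (snd p) + \<sigma> * norm e))"
    using K_pos by (intro mult_left_mono add_left_mono) auto
  then show "norm (nl1 e p) \<le> K * norm1 p + K * \<sigma> * norm e" "norm (nl2 e p) \<le> K * norm1 p + K * \<sigma> * norm e"
    using g1_lipschitz[of "fst p" "snd p + \<sigma> *\<^sub>R e" 0 0] g2_lipschitz[of "fst p" "snd p + \<sigma> *\<^sub>R e" 0 0] g_zero
    by (auto simp: nl1_def nl2_def norm1_def algebra_simps)
qed

lemma continuous_on_g:
  "continuous_on UNIV (\<lambda>p. g1 (fst p) (snd p))" "continuous_on UNIV (\<lambda>p. g2 (fst p) (snd p))"
proof -
  have *: "continuous_on UNIV (\<lambda>p. g (fst p) (snd p))"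
    if "\<And>x1 y1 x2 y2. norm (g x1 y1 - g x2 y2) \<le> K * (norm (x1 - x2) + norm (y1 - y2))"
    for g :: "real ^ 'n \<Rightarrow> real ^ 'm \<Rightarrow> real ^ 'k"
  proof (rule lipschitz_on_continuous_on[of "2 * K"], rule lipschitz_onI)
    fix p q :: "(real ^ 'n) \<times> (real ^ 'm)"
    have "norm (g (fst p) (snd p) - g (fst q) (snd q)) \<le> K * norm1 (p - q)"
      using that by (simp add: norm1_def)
    also have "\<dots> \<le> K * (2 * norm (p - q))" using K_pos by (intro mult_left_mono norm1_le_norm) simp
    finally show "dist (g (fst p) (snd p)) (g (fst q) (snd q)) \<le> 2 * K * dist p q"
      by (simp add: dist_norm)
  qed (use K_pos in auto)
  show "continuous_on UNIV (\<lambda>p. g1 (fst p) (snd p))" "continuous_on UNIV (\<lambda>p. g2 (fst p) (snd p))"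
    by (intro * g1_lipschitz g2_lipschitz)+
qed

lemma borel_measurable_nl [measurable (raw)]:
  assumes [measurable]: "e \<in> borel_measurable M" "p \<in> borel_measurable M"
  shows "(\<lambda>x. nl1 (e x) (p x)) \<in> borel_measurable M" "(\<lambda>x. nl2 (e x) (p x)) \<in> borel_measurable M"
proof -
  have [measurable]: "(\<lambda>x. snd (p x)) \<in> borel_measurable M"
    using assms(2) by (rule borel_measurable_snd_pair)
  have f: "(\<lambda>x. fst (p x)) \<in> borel_measurable M" "(\<lambda>x. snd (p x) + \<sigma> *\<^sub>R e x) \<in> borel_measurable M"
    using assms(2) by (rule borel_measurable_fst_pair) measurable
  show "(\<lambda>x. nl1 (e x) (p x)) \<in> borel_measurable M" "(\<lambda>x. nl2 (e x) (p x)) \<in> borel_measurable M"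
    unfolding nl1_def nl2_def
    using borel_measurable_continuous_Pair[OF f continuous_on_g(1)]
      borel_measurable_continuous_Pair[OF f continuous_on_g(2)] by auto
qed

lemma borel_measurable_field [measurable (raw)]:
  assumes [measurable]: "e \<in> borel_measurable M" "p \<in> borel_measurable M"
  shows "(\<lambda>x. field (e x) (p x)) \<in> borel_measurable M"
proof -
  note [measurable] = borel_measurable_fst_pair[OF assms(2)] borel_measurable_snd_pair[OF assms(2)]
  show ?thesis unfolding field_def by (intro borel_measurable_Pair) measurable
qed

definition Lip where "Lip = \<epsilon> * onorm ((*v) S) + onorm ((*v) F) + (\<epsilon> + 1) * K"

lemma Lip_pos: "0 < Lip"
proof -
  have "0 \<le> onorm ((*v) S)" "0 \<le> onorm ((*v) F)" by (intro onorm_pos_le; simp)+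
  then show ?thesis
    unfolding Lip_def using \<epsilon>_pos K_pos by (intro add_nonneg_pos add_nonneg_nonneg) auto
qed

lemma field_lipschitz: "norm1 (field e p - field e q) \<le> Lip * norm1 (p - q)"
proof -
  let ?d = "p - q"
  have on: "0 \<le> onorm ((*v) S)" "0 \<le> onorm ((*v) F)" by (intro onorm_pos_le; simp)+
  have "norm (fst (field e p - field e q)) = norm (\<epsilon> *\<^sub>R (S *v fst ?d) + \<epsilon> *\<^sub>R (nl1 e p - nl1 e q))"
    by (simp add: field_def matrix_vector_mult_diff_distrib algebra_simps)
  also have "\<dots> \<le> \<epsilon> * norm (S *v fst ?d) + \<epsilon> * norm (nl1 e p - nl1 e q)"
    using norm_triangle_ineq[of "\<epsilon> *\<^sub>R (S *v fst ?d)" "\<epsilon> *\<^sub>R (nl1 e p - nl1 e q)"] \<epsilon>_pos by simp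
  also have "\<dots> \<le> \<epsilon> * (onorm ((*v) S) * norm1 ?d) + \<epsilon> * (K * norm1 ?d)"
  proof (intro add_mono mult_left_mono nl_lipschitz)
    have "norm (S *v fst ?d) \<le> onorm ((*v) S) * norm (fst ?d)" by (rule onorm) simp
    also have "\<dots> \<le> onorm ((*v) S) * norm1 ?d" using on by (intro mult_left_mono) (auto simp: norm1_def)
    finally show "norm (S *v fst ?d) \<le> onorm ((*v) S) * norm1 ?d" .
  qed (use \<epsilon>_pos in auto)
  finally have 1: "norm (fst (field e p - field e q)) \<le> \<epsilon> * (onorm ((*v) S) * norm1 ?d) + \<epsilon> * (K * norm1 ?d)" .
  have "norm (snd (field e p - field e q)) = norm (F *v snd ?d + (nl2 e p - nl2 e q))"
    by (simp add: field_def matrix_vector_mult_diff_distrib algebra_simps)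
  also have "\<dots> \<le> norm (F *v snd ?d) + norm (nl2 e p - nl2 e q)" by (rule norm_triangle_ineq)
  also have "\<dots> \<le> onorm ((*v) F) * norm1 ?d + K * norm1 ?d"
  proof (intro add_mono nl_lipschitz)
    have "norm (F *v snd ?d) \<le> onorm ((*v) F) * norm (snd ?d)" by (rule onorm) simp
    also have "\<dots> \<le> onorm ((*v) F) * norm1 ?d" using on by (intro mult_left_mono) (auto simp: norm1_def)
    finally show "norm (F *v snd ?d) \<le> onorm ((*v) F) * norm1 ?d" .
  qed
  finally have 2: "norm (snd (field e p - field e q)) \<le> onorm ((*v) F) * norm1 ?d + K * norm1 ?d" .
  show ?thesis
    using 1 2 unfolding norm1_def[of "field e p - field e q"] Lip_def by (simp add: algebra_simps)
qed

lemma field_growth: "norm1 (field e p) \<le> Lip * norm1 p + (\<epsilon> + 1) * K * \<sigma> * norm e"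
proof -
  have "norm1 (field e p) \<le> norm1 (field e p - field e 0) + norm1 (field e 0)"
    using norm1_triangle[of "field e p - field e 0" "field e 0"] by simp
  moreover have "norm1 (field e 0) \<le> (\<epsilon> + 1) * (K * \<sigma> * norm e)"
  proof -
    have "\<epsilon> * norm (nl1 e 0) \<le> \<epsilon> * (K * \<sigma> * norm e)"
      using nl_growth(1)[of e 0] \<epsilon>_pos by (intro mult_left_mono) auto
    moreover have "norm (nl2 e 0) \<le> K * \<sigma> * norm e" using nl_growth(2)[of e 0] by simp
    moreover have "norm1 (field e 0) = \<epsilon> * norm (nl1 e 0) + norm (nl2 e 0)"
      using \<epsilon>_pos by (simp add: field_def norm1_def)
    ultimately show ?thesis unfolding distrib_right mult_1 by linarith
  qed
  ultimately show ?thesis using field_lipschitz[of e p 0] by (simp add: mult_ac)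
qed

lemma integral_curve_continuous:
  assumes "integral_curve I \<xi> z u"
  shows "continuous_on I u"
proof -
  have "continuous_on I (\<lambda>t. z + (LBINT s. orient t s *\<^sub>R field (\<xi> s) (u s)))"
    using assms unfolding integral_curve_def
    by (intro continuous_on_add continuous_on_const continuous_on_orient_integral) auto
  then show ?thesis
    using assms unfolding integral_curve_def by (auto cong: continuous_on_cong)
qed

lemma integral_curve_unique:
  assumes u: "integral_curve I \<xi> z u" and v: "integral_curve I \<xi> z v"
    and t: "closed_segment 0 t \<subseteq> I"
  shows "u t = v t"
proof (rule integral_equation_unique[where G = "\<lambda>s. field (\<xi> s)" and L = "2 * Lip"])
  show "0 < 2 * Lip" using Lip_pos by simp
  show "norm (field (\<xi> s) p - field (\<xi> s) q) \<le> 2 * Lip * norm (p - q)" for s p q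
  proof -
    have "norm (field (\<xi> s) p - field (\<xi> s) q) \<le> Lip * norm1 (p - q)"
      using norm_le_norm1 field_lipschitz by (rule order_trans)
    also have "\<dots> \<le> Lip * (2 * norm (p - q))"
      using Lip_pos by (intro mult_left_mono norm1_le_norm) simp
    finally show ?thesis by simp
  qed
qed (use u v t in \<open>auto simp: integral_curve_def\<close>)

lemma integral_curve_at_0: "integral_curve I \<xi> z u \<Longrightarrow> 0 \<in> I \<Longrightarrow> u 0 = z"
  by (simp add: integral_curve_def orient_def)

definition picard where
  "picard \<xi> z u t = z + (LBINT s. orient t s *\<^sub>R field (\<xi> s) (u s))"

text \<open>A global Lipschitz constant and a steep weight give a contraction on the whole line at
  once, so there is no continuation of local solutions.\<close>

lemma picard_converges:
  assumes "tame \<xi>"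
  shows "\<exists>u. integral_curve UNIV \<xi> z u \<and> (\<forall>t. (\<lambda>n. (picard \<xi> z ^^ n) (\<lambda>_. 0) t) \<longlonglongrightarrow> u t)"
proof -
  note [measurable] = tame_measurable[OF assms]
  \<comment> \<open>The integral gains \<open>Lip / l\<close>, and passing from \<open>norm\<close>
    back to \<open>norm1\<close> costs a factor 2; the exponent \<open>4 * Lip\<close> leaves the
    contraction constant \<open>1 / 2\<close>.\<close>
  define l where "l = 4 * Lip"
  have l: "l > 0" using Lip_pos by (simp add: l_def)
  let ?W = "\<lambda>t. exp (l * \<bar>t\<bar>)"
  let ?X = "wspace UNIV ?W :: (real \<Rightarrow> (real ^ 'n) \<times> (real ^ 'm)) set"
  obtain C where C: "0 \<le> C" "\<And>t. norm (\<xi> t) \<le> C * ?W t" using tame_bound[OF assms l] by blast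
  define D where "D = (\<epsilon> + 1) * K * \<sigma> * C"
  have D: "0 \<le> D" using \<epsilon>_pos K_pos \<sigma>_pos C by (simp add: D_def)
  have growth: "norm (field (\<xi> s) p) \<le> (Lip * B + D) * ?W s" if "norm1 p \<le> B * ?W s" for s p B
  proof -
    have "norm (field (\<xi> s) p) \<le> Lip * norm1 p + (\<epsilon> + 1) * K * \<sigma> * norm (\<xi> s)"
      using norm_le_norm1 field_growth by (rule order_trans)
    also have "\<dots> \<le> Lip * (B * ?W s) + (\<epsilon> + 1) * K * \<sigma> * (C * ?W s)"
      using that C Lip_pos \<epsilon>_pos K_pos \<sigma>_pos by (intro add_mono mult_left_mono) auto
    finally show ?thesis by (simp add: D_def algebra_simps)
  qed
  have int: "integrable lborel (\<lambda>s. orient t s *\<^sub>R field (\<xi> s) (u s)) \<and>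
      norm (LBINT s. orient t s *\<^sub>R field (\<xi> s) (u s)) \<le> (Lip * B + D) * (?W t / l)"
    if "u \<in> borel_measurable borel" "0 \<le> B" "\<And>s. norm1 (u s) \<le> B * ?W s" for u B t
  proof -
    have "norm (field (\<xi> s) (u s)) \<le> (Lip * B + D) * ?W s" for s by (intro growth that)
    from integral_orient_le_exp[OF l _ _ this] show ?thesis using that D Lip_pos by auto
  qed
  have bound: "norm1 (picard \<xi> z u t) \<le> (norm1 z + 2 * ((Lip * B + D) / l)) * ?W t"
    if u: "u \<in> borel_measurable borel" "0 \<le> B" "\<And>s. norm1 (u s) \<le> B * ?W s" for u B t
  proof -
    have "norm1 (picard \<xi> z u t) \<le> norm1 z + 2 * norm (LBINT s. orient t s *\<^sub>R field (\<xi> s) (u s))"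
      unfolding picard_def by (intro norm1_triangle[THEN order_trans] add_left_mono norm1_le_norm)
    also have "\<dots> \<le> norm1 z * ?W t + 2 * ((Lip * B + D) * (?W t / l))"
      using int[OF u, of t] l mult_left_mono[of 1 "?W t" "norm1 z"] by simp
    finally show ?thesis by (simp add: algebra_simps add_divide_distrib)
  qed
  have "\<exists>u\<in>?X. picard \<xi> z u = u \<and> (\<forall>t. (\<lambda>n. (picard \<xi> z ^^ n) (\<lambda>_. 0) t) \<longlonglongrightarrow> u t)"
  proof (rule weighted_fixpoint[where W = ?W and \<rho> = "1 / 2" and ?B0.0 = "norm1 z + 2 * (D / l)"])
    show "u \<in> ?X" if "\<And>n. v n \<in> ?X" "\<And>t. (\<lambda>n. v n t) \<longlonglongrightarrow> u t"
      "\<And>n t. norm1 (v n t - u t) \<le> C * ?W t" for v u C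
      by (rule wspace_closed[OF _ that]) simp
  next
    fix u assume "u \<in> ?X"
    then obtain B where B: "0 \<le> B" "\<And>s. norm1 (u s) \<le> B * ?W s" using wspace_bound by metis
    note u [measurable] = wspace_measurable[OF \<open>u \<in> ?X\<close>]
    have "picard \<xi> z u \<in> borel_measurable borel" unfolding picard_def by measurable
    then show "picard \<xi> z u \<in> ?X"
      by (rule wspaceI[OF _ _ _ bound[OF u B]]) (use B D l Lip_pos in auto)
  next
    fix u v B t
    assume X: "u \<in> ?X" "v \<in> ?X" and B: "0 \<le> B" "\<And>s. norm1 (u s - v s) \<le> B * ?W s"
    obtain Bu Bv where uv: "0 \<le> Bu" "\<And>s. norm1 (u s) \<le> Bu * ?W s" "0 \<le> Bv" "\<And>s. norm1 (v s) \<le> Bv * ?W s"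
      using wspace_bound[OF X(1)] wspace_bound[OF X(2)] by metis
    note [measurable] = wspace_measurable[OF X(1)] wspace_measurable[OF X(2)]
    have "picard \<xi> z u t - picard \<xi> z v t
        = (LBINT s. orient t s *\<^sub>R (field (\<xi> s) (u s) - field (\<xi> s) (v s)))"
      using int[of u Bu t] int[of v Bv t] uv X[THEN wspace_measurable] by (simp add: picard_def scaleR_diff_right)
    then have "norm1 (picard \<xi> z u t - picard \<xi> z v t)
        \<le> 2 * norm (LBINT s. orient t s *\<^sub>R (field (\<xi> s) (u s) - field (\<xi> s) (v s)))"
      by (simp add: norm1_le_norm)
    also have "\<dots> \<le> 2 * (Lip * B * (?W t / l))"
    proof (intro mult_left_mono integral_orient_le_exp(2))
      show "norm (field (\<xi> s) (u s) - field (\<xi> s) (v s)) \<le> Lip * B * ?W s" for s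
      proof -
        have "norm (field (\<xi> s) (u s) - field (\<xi> s) (v s)) \<le> Lip * norm1 (u s - v s)"
          using norm_le_norm1 field_lipschitz by (rule order_trans)
        also have "\<dots> \<le> Lip * (B * ?W s)" using Lip_pos B by (intro mult_left_mono) auto
        finally show ?thesis by simp
      qed
    qed (use l Lip_pos B in auto)
    finally show "norm1 (picard \<xi> z u t - picard \<xi> z v t) \<le> 1 / 2 * B * ?W t"
      using Lip_pos by (simp add: l_def)
  next
    show "norm1 (picard \<xi> z (\<lambda>_. 0) t - 0) \<le> (norm1 z + 2 * (D / l)) * ?W t" for t
      using bound[of "\<lambda>_. 0" 0 t] by simp
  qed (use D l zero_wspace in auto)
  then obtain u where u: "u \<in> ?X" "picard \<xi> z u = u"
    "\<forall>t. (\<lambda>n. (picard \<xi> z ^^ n) (\<lambda>_. 0) t) \<longlonglongrightarrow> u t" by blast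
  obtain B where "0 \<le> B" "\<And>s. norm1 (u s) \<le> B * ?W s" using wspace_bound[OF u(1)] by metis
  from int[OF wspace_measurable[OF u(1)] this] fun_cong[OF u(2)] have "integral_curve UNIV \<xi> z u"
    by (auto simp: integral_curve_def picard_def)
  with u(3) show ?thesis by blast
qed

definition flow where
  "flow \<xi> t z = (THE u. integral_curve UNIV \<xi> z u) t"

lemma flow_eq: "integral_curve UNIV \<xi> z u \<Longrightarrow> flow \<xi> t z = u t"
  unfolding flow_def by (subst the_equality[of _ u]) (auto intro: integral_curve_unique)

lemma integral_curve_flow:
  assumes "tame \<xi>"
  shows "integral_curve UNIV \<xi> z (\<lambda>t. flow \<xi> t z)"
  using picard_converges[OF assms, of z] flow_eq by (metis (no_types, lifting) ext)

lemma picard_tendsto_flow: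
  "tame \<xi> \<Longrightarrow> (\<lambda>n. (picard \<xi> z ^^ n) (\<lambda>_. 0) t) \<longlonglongrightarrow> flow \<xi> t z"
  using picard_converges[of \<xi> z] flow_eq by metis

lemma flow_eq_on:
  assumes "tame \<xi>" "integral_curve I \<xi> z u" "closed_segment 0 t \<subseteq> I"
  shows "flow \<xi> t z = u t"
proof (rule integral_curve_unique[OF _ assms(2,3)])
  show "integral_curve I \<xi> z (\<lambda>t. flow \<xi> t z)"
    using integral_curve_flow[OF assms(1), of z] unfolding integral_curve_def by blast
qed

lemma flow_0: "tame \<xi> \<Longrightarrow> flow \<xi> 0 z = z"
  using integral_curve_at_0[OF integral_curve_flow] by simp

text \<open>Splitting the integral at time \<open>s\<close> and translating shows that
  \<open>t \<mapsto> flow \<xi> (t + s) z\<close> solves the equation driven by the shifted path;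
  uniqueness does the rest, for times of either sign.\<close>

lemma flow_cocycle:
  assumes "tame \<xi>"
  shows "flow \<xi> (t + s) z = flow (\<lambda>r. \<xi> (r + s)) t (flow \<xi> s z)"
proof -
  let ?q = "\<lambda>r. field (\<xi> r) (flow \<xi> r z)"
  have c: "integrable lborel (\<lambda>r. orient t r *\<^sub>R ?q r)"
    "flow \<xi> t z = z + (LBINT r. orient t r *\<^sub>R ?q r)" for t
    using integral_curve_flow[OF assms, of z] unfolding integral_curve_def by blast+
  note [measurable] = tame_measurable[OF assms]
  have [measurable]: "(\<lambda>r. flow \<xi> r z) \<in> borel_measurable borel"
    using integral_curve_continuous[OF integral_curve_flow[OF assms]]
    by (rule borel_measurable_continuous_onI)
  have q: "?q \<in> borel_measurable borel" by measurable
  have "integral_curve UNIV (\<lambda>r. \<xi> (r + s)) (flow \<xi> s z) (\<lambda>t. flow \<xi> (t + s) z)"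
    unfolding integral_curve_def
  proof (intro ballI conjI)
    fix t
    show "integrable lborel (\<lambda>r. orient t r *\<^sub>R field (\<xi> (r + s)) (flow \<xi> (r + s) z))"
      by (rule integral_orient_shift(1)[OF q c(1) c(1)])
    show "flow \<xi> (t + s) z = flow \<xi> s z
        + (LBINT r. orient t r *\<^sub>R field (\<xi> (r + s)) (flow \<xi> (r + s) z))"
      unfolding c(2)[of "t + s"] c(2)[of s] integral_orient_shift(2)[OF q c(1) c(1)] by (rule add.assoc[symmetric])
  qed
  then show ?thesis by (rule flow_eq[symmetric])
qed

end


section \<open>The Lyapunov--Perron equation on the negative half-line\<close>

lemma integrable_Pair_iff:
  fixes f :: "'x \<Rightarrow> 'a::euclidean_space" and g :: "'x \<Rightarrow> 'b::euclidean_space"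
  shows "integrable M (\<lambda>x. (f x, g x)) \<longleftrightarrow> integrable M f \<and> integrable M g"
proof
  assume "integrable M (\<lambda>x. (f x, g x))"
  from integrable_bounded_linear[OF bounded_linear_fst this]
    integrable_bounded_linear[OF bounded_linear_snd this]
  show "integrable M f \<and> integrable M g" by simp
next
  assume "integrable M f \<and> integrable M g"
  then have "integrable M (\<lambda>x. (f x, 0) + (0, g x))"
    by (intro Bochner_Integration.integrable_add
        integrable_bounded_linear[OF bounded_linear_Pair[OF bounded_linear_ident bounded_linear_zero]]
        integrable_bounded_linear[OF bounded_linear_Pair[OF bounded_linear_zero bounded_linear_ident]]) auto
  then show "integrable M (\<lambda>x. (f x, g x))" by simp
qed

lemma integral_Pair:
  fixes f :: "'x \<Rightarrow> 'a::euclidean_space" and g :: "'x \<Rightarrow> 'b::euclidean_space"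
  assumes "integrable M f" "integrable M g"
  shows "(\<integral>x. (f x, g x) \<partial>M) = (\<integral>x. f x \<partial>M, \<integral>x. g x \<partial>M)"
proof -
  have "integrable M (\<lambda>x. (f x, g x))" using assms by (simp add: integrable_Pair_iff)
  from integral_bounded_linear[OF bounded_linear_fst this] integral_bounded_linear[OF bounded_linear_snd this]
  show ?thesis by (simp add: prod_eq_iff)
qed

context slow_fast
begin

lemma integral_curve_iff:
  "integral_curve I \<xi> z u \<longleftrightarrow> (\<forall>t\<in>I.
     integrable lborel (\<lambda>s. orient t s *\<^sub>R (\<epsilon> *\<^sub>R (S *v fst (u s)) + \<epsilon> *\<^sub>R nl1 (\<xi> s) (u s))) \<and>
     integrable lborel (\<lambda>s. orient t s *\<^sub>R (F *v snd (u s) + nl2 (\<xi> s) (u s))) \<and>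
     fst (u t) = fst z + (LBINT s. orient t s *\<^sub>R (\<epsilon> *\<^sub>R (S *v fst (u s)) + \<epsilon> *\<^sub>R nl1 (\<xi> s) (u s))) \<and>
     snd (u t) = snd z + (LBINT s. orient t s *\<^sub>R (F *v snd (u s) + nl2 (\<xi> s) (u s))))"
  (is "_ \<longleftrightarrow> (\<forall>t\<in>I. ?P t)")
proof -
  have "integrable lborel (\<lambda>s. orient t s *\<^sub>R field (\<xi> s) (u s)) \<and>
     u t = z + (LBINT s. orient t s *\<^sub>R field (\<xi> s) (u s)) \<longleftrightarrow> ?P t" for t
  proof -
    let ?f = "\<lambda>s. orient t s *\<^sub>R (\<epsilon> *\<^sub>R (S *v fst (u s)) + \<epsilon> *\<^sub>R nl1 (\<xi> s) (u s))"
    let ?g = "\<lambda>s. orient t s *\<^sub>R (F *v snd (u s) + nl2 (\<xi> s) (u s))"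
    have "(\<lambda>s. orient t s *\<^sub>R field (\<xi> s) (u s)) = (\<lambda>s. (?f s, ?g s))"
      by (simp add: field_def)
    then show ?thesis
      using integral_Pair[of lborel ?f ?g] by (auto simp only: integrable_Pair_iff prod_eq_iff fst_add snd_add fst_conv snd_conv)
  qed
  then show ?thesis unfolding integral_curve_def by blast
qed

text \<open>The costs of the slow and of the fast convolution in the weight; their sum is
  \<open>slow_rho\<close>. The second does not depend on \<epsilon>.\<close>

definition cs where "cs = \<epsilon> * K / (\<gamma> + \<epsilon> * \<gamma>s)"
definition cf where "cf = - K / (\<gamma> + \<gamma>f)"

lemma slow_rho_eq: "slow_rho K \<gamma> \<gamma>s \<gamma>f \<epsilon> = cs + cf"
  by (simp add: slow_rho_def cs_def cf_def)

lemma rate_pos: "0 < \<gamma> + \<epsilon> * \<gamma>s" "0 < - (\<gamma> + \<gamma>f)"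
proof -
  show "0 < \<gamma> + \<epsilon> * \<gamma>s" using \<gamma>_pos \<epsilon>_pos \<gamma>s_pos by (intro add_pos_pos mult_pos_pos)
  show "0 < - (\<gamma> + \<gamma>f)" using gap K_pos by linarith
qed

lemma cs_pos: "0 < cs"
  unfolding cs_def using rate_pos(1) \<epsilon>_pos K_pos by simp

lemma cf_pos: "0 < cf"
  unfolding cf_def using rate_pos(2) K_pos by (intro divide_neg_neg) auto

lemma cf_eq: "K / - (\<gamma> + \<gamma>f) = cf"
  unfolding cf_def by (metis minus_divide_left minus_divide_right)

text \<open>The slow kernel is run backwards from \<open>s\<close> to \<open>t < s\<close>, where it
  decays at rate \<open>\<epsilon> * \<gamma>s\<close>; against the weight this integrates to the
  denominator \<open>\<gamma> + \<epsilon> * \<gamma>s\<close>. The set \<open>M\<close> is left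
  free because it is \<open>{t<..<0}\<close> for the past and \<open>{t<..}\<close> for
  tracking.\<close>

lemma slow_convolution:
  assumes [measurable]: "p \<in> borel_measurable borel" "M \<in> sets borel"
    and M: "M \<subseteq> {t<..}" and B: "0 \<le> B" "\<And>s. s \<in> M \<Longrightarrow> norm (p s) \<le> B * wt s"
  shows "integrable lborel (\<lambda>s. indicator M s *\<^sub>R (ES (t - s) *v p s))"
    and "norm (LBINT s. indicator M s *\<^sub>R (ES (t - s) *v p s))
      \<le> B / (\<gamma> + \<epsilon> * \<gamma>s) * wt t"
proof -
  let ?q = "\<lambda>s. indicator M s *\<^sub>R (ES (t - s) *v p s)"
  let ?C = "B * exp (\<epsilon> * \<gamma>s * t)"
  have le: "norm (?q s) \<le> ?C * (indicator {t<..} s * exp (- (\<gamma> + \<epsilon> * \<gamma>s) * s))" for s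
  proof (cases "s \<in> M")
    case True
    then have "t < s" using M by auto
    have "norm (ES (t - s) *v p s) \<le> exp (\<gamma>s * (\<epsilon> * (t - s))) * norm (p s)"
      using \<open>t < s\<close> \<epsilon>_pos by (intro exp_S) (simp add: mult_le_0_iff)
    also have "\<dots> \<le> exp (\<gamma>s * (\<epsilon> * (t - s))) * (B * wt s)"
      using B True by (intro mult_left_mono) auto
    also have "\<dots> = ?C * exp (- (\<gamma> + \<epsilon> * \<gamma>s) * s)"
      by (simp add: algebra_simps flip: exp_add)
    finally show ?thesis using True \<open>t < s\<close> by simp
  qed (use B in simp)
  have m: "?q \<in> borel_measurable borel" by measurable
  show "integrable lborel ?q"
    by (rule integral_le_exp_greaterThan(1)[OF rate_pos(1) _ m le]) (use B in simp)
  have "norm (integral\<^sup>L lborel ?q) \<le> ?C * (exp (- (\<gamma> + \<epsilon> * \<gamma>s) * t) / (\<gamma> + \<epsilon> * \<gamma>s))"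
    by (rule integral_le_exp_greaterThan(2)[OF rate_pos(1) _ m le]) (use B in simp)
  also have "\<dots> = B / (\<gamma> + \<epsilon> * \<gamma>s) * wt t"
    by (simp add: algebra_simps flip: exp_add)
  finally show "norm (integral\<^sup>L lborel ?q) \<le> B / (\<gamma> + \<epsilon> * \<gamma>s) * wt t" .
qed

text \<open>The fast kernel decays forwards at rate \<open>\<gamma>f\<close>, faster than the
  weight, so the integral converges at minus infinity. The set \<open>M\<close> is
  \<open>{..<t}\<close> for the past and \<open>{0<..<t}\<close> for tracking.\<close>

lemma fast_convolution:
  assumes [measurable]: "p \<in> borel_measurable borel" "M \<in> sets borel"
    and M: "M \<subseteq> {..<t}" and B: "0 \<le> B" "\<And>s. s \<in> M \<Longrightarrow> norm (p s) \<le> B * wt s"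
  shows "integrable lborel (\<lambda>s. indicator M s *\<^sub>R (EF (t - s) *v p s))"
    and "norm (LBINT s. indicator M s *\<^sub>R (EF (t - s) *v p s))
      \<le> B / - (\<gamma> + \<gamma>f) * wt t"
proof -
  let ?q = "\<lambda>s. indicator M s *\<^sub>R (EF (t - s) *v p s)"
  let ?C = "B * exp (\<gamma>f * t)"
  have le: "norm (?q s) \<le> ?C * (indicator {..<t} s * exp (- (\<gamma> + \<gamma>f) * s))" for s
  proof (cases "s \<in> M")
    case True
    then have "s < t" using M by auto
    have "norm (EF (t - s) *v p s) \<le> exp (\<gamma>f * (t - s)) * norm (p s)"
      using \<open>s < t\<close> by (intro exp_F) simp
    also have "\<dots> \<le> exp (\<gamma>f * (t - s)) * (B * wt s)"
      using B True by (intro mult_left_mono) auto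
    also have "\<dots> = ?C * exp (- (\<gamma> + \<gamma>f) * s)"
      by (simp add: algebra_simps flip: exp_add)
    finally show ?thesis using True \<open>s < t\<close> by simp
  qed (use B in simp)
  have m: "?q \<in> borel_measurable borel" by measurable
  show "integrable lborel ?q"
    by (rule integral_le_exp_lessThan(1)[OF rate_pos(2) _ m le]) (use B in simp)
  have "norm (integral\<^sup>L lborel ?q) \<le> ?C * (exp (- (\<gamma> + \<gamma>f) * t) / - (\<gamma> + \<gamma>f))"
    by (rule integral_le_exp_lessThan(2)[OF rate_pos(2) _ m le]) (use B in simp)
  also have "\<dots> = B * (exp (\<gamma>f * t) * exp (- (\<gamma> + \<gamma>f) * t)) / - (\<gamma> + \<gamma>f)"
    by (simp only: mult.assoc times_divide_eq_right)
  also have "exp (\<gamma>f * t) * exp (- (\<gamma> + \<gamma>f) * t) = wt t"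
    by (simp add: algebra_simps flip: exp_add)
  finally show "norm (integral\<^sup>L lborel ?q) \<le> B / - (\<gamma> + \<gamma>f) * wt t"
    by (simp only: times_divide_eq_left)
qed

section \<open>The Lyapunov-Perron operator and its contraction estimate\<close>

abbreviation backward :: "(real \<Rightarrow> (real ^ 'n) \<times> (real ^ 'm)) set" where
  "backward \<equiv> wspace {..0} (\<lambda>t. wt t)"

lemma nl_weighted_bound:
  assumes \<xi>: "tame \<xi>" and B: "0 \<le> B" and u: "\<And>t. t \<le> 0 \<Longrightarrow> norm1 (u t) \<le> B * wt t"
  obtains C where "0 \<le> C" "\<And>s. s \<le> 0 \<Longrightarrow> norm (nl1 (\<xi> s) (u s)) \<le> C * wt s"
    "\<And>s. s \<le> 0 \<Longrightarrow> norm (nl2 (\<xi> s) (u s)) \<le> C * wt s"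
proof -
  obtain D where D: "0 \<le> D" "\<And>t. norm (\<xi> t) \<le> D * exp (\<gamma> * \<bar>t\<bar>)" using tame_bound[OF \<xi> \<gamma>_pos] by blast
  have "K * norm1 (u s) + K * \<sigma> * norm (\<xi> s) \<le> (K * B + K * \<sigma> * D) * wt s" if "s \<le> 0" for s
  proof -
    have "K * norm1 (u s) + K * \<sigma> * norm (\<xi> s) \<le> K * (B * wt s) + K * \<sigma> * (D * wt s)"
      using u[OF that] D(2)[of s] that K_pos \<sigma>_pos by (intro add_mono mult_left_mono) auto
    then show ?thesis by (simp add: algebra_simps)
  qed
  note le = nl_growth[THEN order_trans, OF this]
  show ?thesis
  proof (rule that)
    show "0 \<le> K * B + K * \<sigma> * D" using K_pos \<sigma>_pos B D by simp
  qed (fact le)+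
qed

text \<open>The slow component carries the free datum \<open>x0\<close> at time \<open>0\<close>;
  the fast one has no free datum, since starting at minus infinity selects the motion that stays in
  the weight. The value zero for positive times keeps the result in \<open>backward\<close>.\<close>

definition lp ::
    "(real \<Rightarrow> real ^ 'm) \<Rightarrow> real ^ 'n \<Rightarrow> (real \<Rightarrow> (real ^ 'n) \<times> (real ^ 'm)) \<Rightarrow>
     real \<Rightarrow> (real ^ 'n) \<times> (real ^ 'm)" where
  "lp \<xi> x0 u t = (if t \<le> 0 then
     (ES t *v x0
        + \<epsilon> *\<^sub>R (LBINT s. orient t s *\<^sub>R (ES (t - s) *v nl1 (\<xi> s) (u s))),
      LBINT s. indicator {..<t} s *\<^sub>R (EF (t - s) *v nl2 (\<xi> s) (u s))) else 0)"

lemma backward_integrable: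
  assumes \<xi>: "tame \<xi>" and u: "u \<in> backward"
  shows "t \<le> 0 \<Longrightarrow> integrable lborel (\<lambda>s. orient t s *\<^sub>R (ES (t - s) *v nl1 (\<xi> s) (u s)))"
    and "t \<le> 0 \<Longrightarrow> integrable lborel (\<lambda>s. indicator {..<t} s *\<^sub>R (EF (t - s) *v nl2 (\<xi> s) (u s)))"
    and "t \<le> 0 \<Longrightarrow> integrable lborel (\<lambda>s. orient t s *\<^sub>R nl1 (\<xi> s) (u s))"
    and "t \<le> 0 \<Longrightarrow> integrable lborel (\<lambda>s. orient t s *\<^sub>R nl2 (\<xi> s) (u s))"
    and "\<exists>C\<ge>0. \<forall>t. norm1 (lp \<xi> x0 u t) \<le> C * wt t"
proof -
  note [measurable] = tame_measurable[OF \<xi>] wspace_measurable[OF u]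
  obtain B where B: "0 \<le> B" "\<And>t. norm1 (u t) \<le> B * wt t" using wspace_bound[OF u] by blast
  from nl_weighted_bound[OF \<xi> B] obtain C where C: "0 \<le> C"
    "\<And>s. s \<le> 0 \<Longrightarrow> norm (nl1 (\<xi> s) (u s)) \<le> C * wt s"
    "\<And>s. s \<le> 0 \<Longrightarrow> norm (nl2 (\<xi> s) (u s)) \<le> C * wt s" by blast
  have m: "(\<lambda>s. nl1 (\<xi> s) (u s)) \<in> borel_measurable borel" "(\<lambda>s. nl2 (\<xi> s) (u s)) \<in> borel_measurable borel"
    by measurable
  have 1: "integrable lborel (\<lambda>s. indicator {t<..<0} s *\<^sub>R (ES (t - s) *v nl1 (\<xi> s) (u s))) \<and>
      norm (LBINT s. indicator {t<..<0} s *\<^sub>R (ES (t - s) *v nl1 (\<xi> s) (u s)))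
        \<le> C / (\<gamma> + \<epsilon> * \<gamma>s) * wt t" for t
    using C m by (intro conjI slow_convolution) auto
  show S: "integrable lborel (\<lambda>s. orient t s *\<^sub>R (ES (t - s) *v nl1 (\<xi> s) (u s)))"
    if "t \<le> 0" for t
    using 1[of t] that by (simp add: orient_neg)
  have 2: "integrable lborel (\<lambda>s. indicator {..<t} s *\<^sub>R (EF (t - s) *v nl2 (\<xi> s) (u s))) \<and>
      norm (LBINT s. indicator {..<t} s *\<^sub>R (EF (t - s) *v nl2 (\<xi> s) (u s)))
        \<le> C / - (\<gamma> + \<gamma>f) * wt t" if "t \<le> 0" for t
    using C m that by (intro conjI fast_convolution) auto
  then show "integrable lborel (\<lambda>s. indicator {..<t} s *\<^sub>R (EF (t - s) *v nl2 (\<xi> s) (u s)))"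
    if "t \<le> 0" for t
    using that by blast
  have le: "C * wt s = C * exp (\<gamma> * \<bar>s\<bar>)" if "s \<le> 0" for s using that by simp
  have neg: "s \<le> 0" if "t \<le> 0" "orient t s \<noteq> 0" for t s using orient_nonzero[OF that(2)] that(1) by auto
  show "integrable lborel (\<lambda>s. orient t s *\<^sub>R nl1 (\<xi> s) (u s))"
    "integrable lborel (\<lambda>s. orient t s *\<^sub>R nl2 (\<xi> s) (u s))" if "t \<le> 0" for t
  proof -
    have "norm (nl1 (\<xi> s) (u s)) \<le> C * exp (\<gamma> * \<bar>s\<bar>)" "norm (nl2 (\<xi> s) (u s)) \<le> C * exp (\<gamma> * \<bar>s\<bar>)"
      if "orient t s \<noteq> 0" for s
      using C(2,3)[OF neg[OF \<open>t \<le> 0\<close> that]] unfolding le[OF neg[OF \<open>t \<le> 0\<close> that]] .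
    from integral_orient_le_exp(1)[OF \<gamma>_pos C(1) m(1) this(1)]
      integral_orient_le_exp(1)[OF \<gamma>_pos C(1) m(2) this(2)]
    show "integrable lborel (\<lambda>s. orient t s *\<^sub>R nl1 (\<xi> s) (u s))"
      "integrable lborel (\<lambda>s. orient t s *\<^sub>R nl2 (\<xi> s) (u s))" by blast+
  qed
  define D where "D = norm x0 + \<epsilon> * (C / (\<gamma> + \<epsilon> * \<gamma>s)) + C / - (\<gamma> + \<gamma>f)"
  have "0 \<le> D" unfolding D_def using rate_pos C \<epsilon>_pos by (intro add_nonneg_nonneg mult_nonneg_nonneg divide_nonneg_pos) auto
  moreover have "norm1 (lp \<xi> x0 u t) \<le> D * wt t" for t
  proof (cases "t \<le> 0")
    case True
    have "norm (ES t *v x0) \<le> exp (\<gamma>s * (\<epsilon> * t)) * norm x0"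
      using True \<epsilon>_pos by (intro exp_S) (simp add: mult_le_0_iff)
    also have "\<dots> \<le> wt t * norm x0"
    proof (intro mult_right_mono)
      have "\<gamma>s * (\<epsilon> * t) \<le> 0" "- \<gamma> * t \<ge> 0" using True \<epsilon>_pos \<gamma>s_pos \<gamma>_pos by (auto simp: mult_le_0_iff)
      then show "exp (\<gamma>s * (\<epsilon> * t)) \<le> wt t" by simp
    qed simp
    finally have "norm (ES t *v x0) \<le> norm x0 * wt t" by (simp add: mult.commute)
    moreover have "norm (\<epsilon> *\<^sub>R (LBINT s. orient t s *\<^sub>R (ES (t - s) *v nl1 (\<xi> s) (u s))))
        \<le> \<epsilon> * (C / (\<gamma> + \<epsilon> * \<gamma>s) * wt t)"
      using mult_left_mono[OF conjunct2[OF 1[of t]], of \<epsilon>] True \<epsilon>_pos by (simp add: orient_neg)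
    ultimately have "norm (fst (lp \<xi> x0 u t)) \<le> norm x0 * wt t + \<epsilon> * (C / (\<gamma> + \<epsilon> * \<gamma>s) * wt t)"
      unfolding lp_def using True by (auto intro: norm_triangle_mono)
    moreover have "norm (snd (lp \<xi> x0 u t)) \<le> C / - (\<gamma> + \<gamma>f) * wt t"
      unfolding lp_def using 2[OF True] True by simp
    ultimately show ?thesis unfolding D_def norm1_def distrib_right by (simp add: mult.assoc)
  qed (use \<open>0 \<le> D\<close> in \<open>simp add: lp_def\<close>)
  ultimately show "\<exists>C\<ge>0. \<forall>t. norm1 (lp \<xi> x0 u t) \<le> C * wt t" by blast
qed

lemma lp_backward:
  assumes "tame \<xi>" "u \<in> backward"
  shows "lp \<xi> x0 u \<in> backward"
proof -
  note [measurable] = tame_measurable[OF assms(1)] wspace_measurable[OF assms(2)]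
  have ind: "indicator {..<t} s = (if s < t then 1 else 0 :: real)" for s t :: real by simp
  have "(\<lambda>t. LBINT s. orient t s *\<^sub>R (ES (t - s) *v nl1 (\<xi> s) (u s))) \<in> borel_measurable borel"
    "(\<lambda>t. LBINT s. (if s < t then 1 else 0) *\<^sub>R (EF (t - s) *v nl2 (\<xi> s) (u s))) \<in> borel_measurable borel"
    by measurable
  then have "lp \<xi> x0 u \<in> borel_measurable borel"
    unfolding lp_def ind by (intro measurable_If borel_measurable_Pair) measurable
  moreover obtain C where "0 \<le> C" "\<And>t. norm1 (lp \<xi> x0 u t) \<le> C * wt t"
    using backward_integrable(5)[OF assms, of x0] by blast
  ultimately show ?thesis by (intro wspaceI[where B = C]) (auto simp: lp_def)
qed

text \<open>One estimate for two purposes: with \<open>x0 = x1\<close> it is the contraction, with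
  different data the Lipschitz dependence. The datum enters the slow component only, which is why
  the second bound contains no \<open>norm (x0 - x1)\<close>.\<close>

lemma lp_diff:
  assumes \<xi>: "tame \<xi>" and u: "u \<in> backward" and v: "v \<in> backward"
    and B: "0 \<le> B" "\<And>s. s \<le> 0 \<Longrightarrow> norm1 (u s - v s) \<le> B * wt s" and t: "t \<le> 0"
  shows "norm (fst (lp \<xi> x0 u t) - fst (lp \<xi> x1 v t)) \<le> (norm (x0 - x1) + cs * B) * wt t"
    and "norm (snd (lp \<xi> x0 u t) - snd (lp \<xi> x1 v t)) \<le> cf * B * wt t"
proof -
  note [measurable] = tame_measurable[OF \<xi>] wspace_measurable[OF u] wspace_measurable[OF v]
  have KB: "0 \<le> K * B" using K_pos B by simp
  have "K * norm1 (u s - v s) \<le> K * B * wt s" if "s \<le> 0" for s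
    using mult_left_mono[OF B(2)[OF that], of K] K_pos by simp
  note le = nl_lipschitz[THEN order_trans, OF this]
  have m: "(\<lambda>s. nl1 (\<xi> s) (u s) - nl1 (\<xi> s) (v s)) \<in> borel_measurable borel"
    "(\<lambda>s. nl2 (\<xi> s) (u s) - nl2 (\<xi> s) (v s)) \<in> borel_measurable borel" by measurable
    have "fst (lp \<xi> x0 u t) - fst (lp \<xi> x1 v t) = ES t *v (x0 - x1)
      - \<epsilon> *\<^sub>R (LBINT s. indicator {t<..<0} s *\<^sub>R (ES (t - s) *v (nl1 (\<xi> s) (u s) - nl1 (\<xi> s) (v s))))"
    using backward_integrable(1)[OF \<xi> u t] backward_integrable(1)[OF \<xi> v t] t
    by (simp add: lp_def orient_neg matrix_vector_mult_diff_distrib scaleR_diff_right)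
  also have "norm \<dots> \<le> exp (\<gamma>s * (\<epsilon> * t)) * norm (x0 - x1) + \<epsilon> * (K * B / (\<gamma> + \<epsilon> * \<gamma>s) * wt t)"
  proof (rule norm_triangle_le_diff, rule add_mono)
    show "norm (ES t *v (x0 - x1)) \<le> exp (\<gamma>s * (\<epsilon> * t)) * norm (x0 - x1)"
      using t \<epsilon>_pos by (intro exp_S) (simp add: mult_le_0_iff)
    have "norm (LBINT s. indicator {t<..<0} s *\<^sub>R (ES (t - s) *v (nl1 (\<xi> s) (u s) - nl1 (\<xi> s) (v s))))
        \<le> K * B / (\<gamma> + \<epsilon> * \<gamma>s) * wt t"
      using m KB le(1) by (intro slow_convolution) auto
    then show "norm (\<epsilon> *\<^sub>R (LBINT s. indicator {t<..<0} s *\<^sub>R (ES (t - s) *v (nl1 (\<xi> s) (u s) - nl1 (\<xi> s) (v s)))))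
        \<le> \<epsilon> * (K * B / (\<gamma> + \<epsilon> * \<gamma>s) * wt t)"
      unfolding norm_scaleR using \<epsilon>_pos by (simp only: abs_of_pos mult_left_mono less_imp_le)
  qed
  also have "\<dots> \<le> wt t * norm (x0 - x1) + \<epsilon> * (K * B / (\<gamma> + \<epsilon> * \<gamma>s) * wt t)"
  proof (intro add_right_mono mult_right_mono)
    have "\<gamma>s * (\<epsilon> * t) \<le> 0" "- \<gamma> * t \<ge> 0" using t \<epsilon>_pos \<gamma>s_pos \<gamma>_pos by (auto simp: mult_le_0_iff)
    then show "exp (\<gamma>s * (\<epsilon> * t)) \<le> wt t" by simp
  qed simp
  also have "\<dots> = (norm (x0 - x1) + cs * B) * wt t" by (simp add: cs_def algebra_simps)
  finally show "norm (fst (lp \<xi> x0 u t) - fst (lp \<xi> x1 v t)) \<le> (norm (x0 - x1) + cs * B) * wt t" .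
  have "snd (lp \<xi> x0 u t) - snd (lp \<xi> x1 v t)
      = (LBINT s. indicator {..<t} s *\<^sub>R (EF (t - s) *v (nl2 (\<xi> s) (u s) - nl2 (\<xi> s) (v s))))"
    using backward_integrable(2)[OF \<xi> u t] backward_integrable(2)[OF \<xi> v t] t
    by (simp add: lp_def matrix_vector_mult_diff_distrib scaleR_diff_right)
  also have "norm \<dots> \<le> K * B / - (\<gamma> + \<gamma>f) * wt t"
    using m KB le(2) t by (intro fast_convolution) auto
  also have "\<dots> = K / - (\<gamma> + \<gamma>f) * B * wt t" by simp
  also have "K / - (\<gamma> + \<gamma>f) = cf" by (rule cf_eq)
  finally show "norm (snd (lp \<xi> x0 u t) - snd (lp \<xi> x1 v t)) \<le> cf * B * wt t" .
qed

text \<open>The first bound is the optimal constant from \<open>weighted_bound\<close>. Feeding it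
  once more into the fast half of \<open>lp_diff\<close> improves \<open>1 / (1 - \<rho>)\<close> to
  \<open>cf / (1 - \<rho>)\<close> for the fast component, which is the Lipschitz constant of the
  claim.\<close>

lemma lp_lipschitz:
  assumes \<rho>: "cs + cf < 1" and \<xi>: "tame \<xi>"
    and u: "u \<in> backward" "lp \<xi> x0 u = u" and v: "v \<in> backward" "lp \<xi> x1 v = v" and t: "t \<le> 0"
  shows "norm1 (u t - v t) \<le> norm (x0 - x1) / (1 - (cs + cf)) * wt t"
    and "norm (snd (u t) - snd (v t)) \<le> cf * (norm (x0 - x1) / (1 - (cs + cf))) * wt t"
proof -
  obtain Bu Bv where B: "\<And>t. norm1 (u t) \<le> Bu * wt t" "\<And>t. norm1 (v t) \<le> Bv * wt t"
    using wspace_bound[OF u(1)] wspace_bound[OF v(1)] by metis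
  have le: "norm1 (u t - v t) \<le> norm (x0 - x1) / (1 - (cs + cf)) * wt t" if "t \<le> 0" for t
  proof (rule weighted_bound[where I = "{..0}" and W = "\<lambda>t. wt t" and d = "\<lambda>t. norm1 (u t - v t)"
        and ?B0.0 = "Bu + Bv"])
    show "norm1 (u s - v s) \<le> (Bu + Bv) * wt s" for s
      using norm1_diff_triangle[of "u s" "v s" 0] B(1)[of s] B(2)[of s]
      unfolding distrib_right by (simp add: norm1_def)
    fix B t assume B: "0 \<le> B" "\<And>s. s \<in> {..0} \<Longrightarrow> norm1 (u s - v s) \<le> B * wt s" and "t \<in> {..0 :: real}"
    then have t: "t \<le> 0" by simp
    have B': "norm1 (u s - v s) \<le> B * wt s" if "s \<le> 0" for s using B(2) that by simp
    have "norm1 (u t - v t) \<le> (norm (x0 - x1) + cs * B) * wt t + cf * B * wt t"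
      using lp_diff[OF \<xi> u(1) v(1) B(1) B' t, of x0 x1] by (simp only: u(2) v(2) norm1_def fst_diff snd_diff add_mono)
    then show "norm1 (u t - v t) \<le> (norm (x0 - x1) + (cs + cf) * B) * wt t"
      by (simp only: distrib_right add.assoc)
  qed (use \<rho> cs_pos cf_pos that in auto)
  show "norm1 (u t - v t) \<le> norm (x0 - x1) / (1 - (cs + cf)) * wt t" by (rule le[OF t])
  have "0 \<le> norm (x0 - x1) / (1 - (cs + cf))" using \<rho> by simp
  from lp_diff(2)[OF \<xi> u(1) v(1) this le t, of x0 x1]
  show "norm (snd (u t) - snd (v t)) \<le> cf * (norm (x0 - x1) / (1 - (cs + cf))) * wt t"
    by (simp only: u(2) v(2))
qed

lemma lp_unique:
  assumes "cs + cf < 1" "tame \<xi>" "u \<in> backward" "lp \<xi> x0 u = u" "v \<in> backward" "lp \<xi> x0 v = v"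
  shows "u = v"
proof
  fix t show "u t = v t"
  proof (cases "t \<le> 0")
    case True
    have "norm1 (u t - v t) \<le> 0" using lp_lipschitz(1)[OF assms True] by simp
    then have "norm1 (u t - v t) = 0" using norm1_nonneg by (rule antisym)
    then show ?thesis by simp
  next
    case False
    then show ?thesis using wspace_outside[OF assms(3)] wspace_outside[OF assms(5)] by simp
  qed
qed

lemma lp_converges:
  assumes \<rho>: "cs + cf < 1" and \<xi>: "tame \<xi>"
  shows "\<exists>u\<in>backward. lp \<xi> x0 u = u \<and> (\<forall>t. (\<lambda>n. (lp \<xi> x0 ^^ n) (\<lambda>_. 0) t) \<longlonglongrightarrow> u t)"
proof -
  obtain B0 where B0: "0 \<le> B0" "\<And>t. norm1 (lp \<xi> x0 (\<lambda>_. 0) t) \<le> B0 * wt t"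
    using backward_integrable(5)[OF \<xi> zero_wspace] by blast
  show ?thesis
  proof (rule weighted_fixpoint[where W = "\<lambda>t. wt t" and \<rho> = "cs + cf" and ?B0.0 = B0])
    show "u \<in> backward" if "\<And>n. v n \<in> backward" "\<And>t. (\<lambda>n. v n t) \<longlonglongrightarrow> u t"
      "\<And>n t. norm1 (v n t - u t) \<le> C * wt t" for v u C
      by (rule wspace_closed[OF _ that]) simp
  next
    fix u v B t
    assume uv: "u \<in> backward" "v \<in> backward" and B: "0 \<le> B" "\<And>s. norm1 (u s - v s) \<le> B * wt s"
    show "norm1 (lp \<xi> x0 u t - lp \<xi> x0 v t) \<le> (cs + cf) * B * wt t"
    proof (cases "t \<le> 0")
      case True
      have "norm1 (lp \<xi> x0 u t - lp \<xi> x0 v t)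
          \<le> (norm (x0 - x0) + cs * B) * wt t + cf * B * wt t"
        unfolding norm1_def fst_diff snd_diff by (intro add_mono lp_diff \<xi> uv B True)
      then show ?thesis by (simp add: algebra_simps)
    qed (use B cs_pos cf_pos in \<open>simp add: lp_def\<close>)
  next
    show "norm1 (lp \<xi> x0 (\<lambda>_. 0) t - 0) \<le> B0 * wt t" for t
      using B0(2) by simp
  qed (use \<rho> cs_pos cf_pos B0 zero_wspace lp_backward[OF \<xi>] in auto)
qed

section \<open>The fixed point, its graph map and its relation to the differential system\<close>

definition lpsol where
  "lpsol \<xi> x0 = (THE u. u \<in> backward \<and> lp \<xi> x0 u = u)"

definition graph where
  "graph \<xi> x0 = snd (lpsol \<xi> x0 0)"

lemma lpsol_eq:
  assumes "cs + cf < 1" "tame \<xi>" "u \<in> backward" "lp \<xi> x0 u = u"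
  shows "lpsol \<xi> x0 = u"
  unfolding lpsol_def using assms lp_unique by (intro the_equality) blast+

lemma lpsol:
  assumes "cs + cf < 1" "tame \<xi>"
  shows "lpsol \<xi> x0 \<in> backward" "lp \<xi> x0 (lpsol \<xi> x0) = lpsol \<xi> x0"
    "(\<lambda>n. (lp \<xi> x0 ^^ n) (\<lambda>_. 0) t) \<longlonglongrightarrow> lpsol \<xi> x0 t"
  using lp_converges[OF assms, of x0] lpsol_eq[OF assms] by blast+

lemma lp_fst_0: "fst (lp \<xi> x0 u 0) = x0"
  by (simp add: lp_def matrix_exp_0 orient_def)

lemma lpsol_0: "cs + cf < 1 \<Longrightarrow> tame \<xi> \<Longrightarrow> lpsol \<xi> x0 0 = (x0, graph \<xi> x0)"
  using lpsol(2)[of \<xi> x0] lp_fst_0[of \<xi> x0 "lpsol \<xi> x0"] by (simp add: graph_def prod_eq_iff)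

lemma graph_lipschitz:
  assumes "cs + cf < 1" "tame \<xi>"
  shows "norm (graph \<xi> x0 - graph \<xi> x1) \<le> cf / (1 - (cs + cf)) * norm (x0 - x1)"
  using lp_lipschitz(2)[OF assms lpsol(1,2)[OF assms, of x0] lpsol(1,2)[OF assms, of x1], of 0]
  by (simp add: graph_def mult.commute)

text \<open>The integral up to \<open>t\<close> is the integral up to \<open>0\<close> corrected by
  the part between, and \<open>EF t\<close> can be taken out of the former. This replaces the
  condition at minus infinity by an initial value at \<open>0\<close>, the form to which variation
  of constants applies.\<close>

lemma fast_split:
  assumes \<xi>: "tame \<xi>" and u: "u \<in> backward" and t: "t \<le> 0"
  shows "snd (lp \<xi> x0 u t) = EF t *v snd (lp \<xi> x0 u 0)
    + (LBINT s. orient t s *\<^sub>R (EF (t - s) *v nl2 (\<xi> s) (u s)))"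
proof -
  note [measurable] = tame_measurable[OF \<xi>] wspace_measurable[OF u]
  let ?f = "\<lambda>s. nl2 (\<xi> s) (u s)"
  let ?q = "\<lambda>s. EF (t - s) *v ?f s"
  let ?g = "\<lambda>s. indicator {..<0} s *\<^sub>R (EF (0 - s) *v ?f s)"
  have g: "integrable lborel ?g" by (rule backward_integrable(2)[OF \<xi> u]) simp
  have shift: "EF t *v (EF (0 - s) *v y) = EF (t - s) *v y" for s y
    using matrix_exp_add_vec[of t "0 - s" F y] by simp
  have Eg: "integrable lborel (\<lambda>s. indicator {..<0} s *\<^sub>R ?q s)"
    "EF t *v (LBINT s. ?g s) = (LBINT s. indicator {..<0} s *\<^sub>R ?q s)"
    using integrable_bounded_linear[OF matrix_vector_mul_bounded_linear[of "EF t"] g]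
      integral_bounded_linear[OF matrix_vector_mul_bounded_linear[of "EF t"] g]
    by (simp_all only: matrix_vector_mult_scaleR shift)
  have o: "integrable lborel (\<lambda>s. orient t s *\<^sub>R ?q s)"
    by (intro integrable_orient_matrix_exp backward_integrable(4)[OF \<xi> u t]) measurable
  have "snd (lp \<xi> x0 u t) = (LBINT s. indicator {..<t} s *\<^sub>R ?q s)"
    using t by (simp add: lp_def)
  also have "\<dots> = (LBINT s. indicator {..<0} s *\<^sub>R ?q s + orient t s *\<^sub>R ?q s)"
  proof (rule integral_cong_AE)
    have "AE s in lborel. s \<noteq> t" by (rule AE_lborel_singleton)
    then show "AE s in lborel. indicator {..<t} s *\<^sub>R ?q s = indicator {..<0} s *\<^sub>R ?q s + orient t s *\<^sub>R ?q s"
    proof (rule AE_mp, intro AE_I2 impI)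
      fix s assume "s \<noteq> t"
      then have "(indicator {..<t} s :: real) = indicator {..<0} s + orient t s"
        using t by (auto simp: orient_def split: split_indicator)
      then show "indicator {..<t} s *\<^sub>R ?q s = indicator {..<0} s *\<^sub>R ?q s + orient t s *\<^sub>R ?q s"
        by (simp only: scaleR_left_distrib)
    qed
  qed measurable
  also have "\<dots> = (LBINT s. indicator {..<0} s *\<^sub>R ?q s) + (LBINT s. orient t s *\<^sub>R ?q s)"
    by (rule Bochner_Integration.integral_add[OF Eg(1) o])
  finally show ?thesis
    unfolding Eg(2)[symmetric] by (simp add: lp_def)
qed

text \<open>Reads the slow equation as a linear one with generator
  \<open>\<epsilon> *\<^sub>R S\<close> and forcing \<open>\<epsilon> *\<^sub>R f\<close>.\<close>

lemma slow_mild: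
  "ES t *v x
     + \<epsilon> *\<^sub>R (LBINT s. orient t s *\<^sub>R (ES (t - s) *v f s))
   = matrix_exp (t *\<^sub>R (\<epsilon> *\<^sub>R S)) *v x
     + (LBINT s. orient t s *\<^sub>R (matrix_exp ((t - s) *\<^sub>R (\<epsilon> *\<^sub>R S)) *v (\<epsilon> *\<^sub>R f s)))"
proof -
  have *: "orient t s *\<^sub>R (matrix_exp ((t - s) *\<^sub>R (\<epsilon> *\<^sub>R S)) *v (\<epsilon> *\<^sub>R f s))
      = \<epsilon> *\<^sub>R (orient t s *\<^sub>R (ES (t - s) *v f s))" for s
    by (simp add: matrix_vector_mult_scaleR mult.commute)
  show ?thesis
    unfolding * integral_scaleR_right by (simp only: scaleR_scaleR mult.commute)
qed

text \<open>With \<open>slow_mild\<close> and \<open>fast_split\<close> both components of a fixed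
  point have variation of constants form from time \<open>0\<close>, so
  \<open>mild_imp_integrated\<close> applies to each.\<close>

lemma lp_integral_curve:
  assumes \<xi>: "tame \<xi>" and u: "u \<in> backward" "lp \<xi> x0 u = u"
  shows "integral_curve {..0} \<xi> (u 0) u"
  unfolding integral_curve_iff
proof (rule ballI)
  fix t :: real assume "t \<in> {..0}"
  then have t: "t \<le> 0" by simp
  have seg: "r \<le> 0" if "r \<in> closed_segment 0 t" for r
    using that t by (auto simp: closed_segment_eq_real_ivl split: if_splits)
  note [measurable] = tame_measurable[OF \<xi>] wspace_measurable[OF u(1)]
  have m: "(\<lambda>s. \<epsilon> *\<^sub>R nl1 (\<xi> s) (u s)) \<in> borel_measurable borel" "(\<lambda>s. nl2 (\<xi> s) (u s)) \<in> borel_measurable borel"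
    by measurable
  have i1: "integrable lborel (\<lambda>s. orient t s *\<^sub>R \<epsilon> *\<^sub>R nl1 (\<xi> s) (u s))"
    using integrable_scaleR_right[OF backward_integrable(3)[OF \<xi> u(1) t], of \<epsilon>] by (simp add: mult.commute)
  have i2: "integrable lborel (\<lambda>s. orient t s *\<^sub>R nl2 (\<xi> s) (u s))"
    by (rule backward_integrable(4)[OF \<xi> u(1) t])
  have "fst (u r) = matrix_exp (r *\<^sub>R (\<epsilon> *\<^sub>R S)) *v fst (u 0)
     + (LBINT s. orient r s *\<^sub>R (matrix_exp ((r - s) *\<^sub>R (\<epsilon> *\<^sub>R S)) *v (\<epsilon> *\<^sub>R nl1 (\<xi> s) (u s))))"
    if "r \<in> closed_segment 0 t" for r
  proof -
    have "fst (u r) = fst (lp \<xi> x0 u r)" by (simp only: u(2))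
    moreover have "fst (u 0) = x0" using lp_fst_0[of \<xi> x0 u] by (simp only: u(2))
    ultimately show ?thesis using seg[OF that] unfolding slow_mild[symmetric] by (simp add: lp_def)
  qed
  note 1 = mild_imp_integrated[OF m(1) i1 this]
  have "snd (u r) = EF r *v snd (u 0)
     + (LBINT s. orient r s *\<^sub>R (EF (r - s) *v nl2 (\<xi> s) (u s)))"
    if "r \<in> closed_segment 0 t" for r
    using fast_split[OF \<xi> u(1) seg[OF that], of x0] by (simp only: u(2))
  note 2 = mild_imp_integrated[OF m(2) i2 this]
  show "integrable lborel (\<lambda>s. orient t s *\<^sub>R (\<epsilon> *\<^sub>R (S *v fst (u s)) + \<epsilon> *\<^sub>R nl1 (\<xi> s) (u s))) \<and>
     integrable lborel (\<lambda>s. orient t s *\<^sub>R (F *v snd (u s) + nl2 (\<xi> s) (u s))) \<and>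
     fst (u t) = fst (u 0) + (LBINT s. orient t s *\<^sub>R (\<epsilon> *\<^sub>R (S *v fst (u s)) + \<epsilon> *\<^sub>R nl1 (\<xi> s) (u s))) \<and>
     snd (u t) = snd (u 0) + (LBINT s. orient t s *\<^sub>R (F *v snd (u s) + nl2 (\<xi> s) (u s)))"
    using 1 2 by (simp only: scaleR_matrix_vector_assoc simp_thms)
qed

text \<open>Variation of constants shows that \<open>u\<close> and its image under \<open>lp\<close>
  have the same slow component, while their fast components differ by \<open>EF t\<close> applied to
  a fixed vector. It remains to see that this vector is zero.\<close>

lemma integral_curve_lp:
  assumes \<xi>: "tame \<xi>" and u: "u \<in> backward" and curve: "integral_curve {..0} \<xi> z u"
  shows "lp \<xi> (fst z) u = u"
proof -
  note [measurable] = tame_measurable[OF \<xi>] wspace_measurable[OF u]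
  have m: "(\<lambda>s. \<epsilon> *\<^sub>R nl1 (\<xi> s) (u s)) \<in> borel_measurable borel" "(\<lambda>s. nl2 (\<xi> s) (u s)) \<in> borel_measurable borel"
    by measurable
  let ?L = "lp \<xi> (fst z) u"
  have cont: "continuous_on {..0} u" by (rule integral_curve_continuous[OF curve])
  have main: "fst (u t) = fst (?L t) \<and> snd (u t) - snd (?L t) = EF t *v (snd z - snd (?L 0))"
    if t: "t \<le> 0" for t
  proof -
    have seg: "closed_segment 0 t \<subseteq> {..0}"
      using t by (auto simp: closed_segment_eq_real_ivl split: if_splits)
    have i1: "integrable lborel (\<lambda>s. orient t s *\<^sub>R \<epsilon> *\<^sub>R nl1 (\<xi> s) (u s))"
      using integrable_scaleR_right[OF backward_integrable(3)[OF \<xi> u t], of \<epsilon>] by (simp add: mult.commute)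
    have i2: "integrable lborel (\<lambda>s. orient t s *\<^sub>R nl2 (\<xi> s) (u s))"
      by (rule backward_integrable(4)[OF \<xi> u t])
    note c = curve[unfolded integral_curve_iff, rule_format, OF subsetD[OF seg]]
    have "fst (u t) = matrix_exp (t *\<^sub>R (\<epsilon> *\<^sub>R S)) *v fst z
       + (LBINT s. orient t s *\<^sub>R (matrix_exp ((t - s) *\<^sub>R (\<epsilon> *\<^sub>R S)) *v (\<epsilon> *\<^sub>R nl1 (\<xi> s) (u s))))"
      using c by (intro integrated_imp_mild[OF m(1) i1]) (simp only: scaleR_matrix_vector_assoc[symmetric] simp_thms)
    then have 1: "fst (u t) = fst (?L t)"
      unfolding slow_mild[symmetric] using t by (simp add: lp_def)
    have "snd (u t) = EF t *v snd z
       + (LBINT s. orient t s *\<^sub>R (EF (t - s) *v nl2 (\<xi> s) (u s)))"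
      using c by (intro integrated_imp_mild[OF m(2) i2]) (simp only: simp_thms)
    then show ?thesis
      using 1 fast_split[OF \<xi> u t, of "fst z"] by (simp add: matrix_vector_mult_diff_distrib)
  qed
  text \<open>The homogeneous part of the fast component would grow faster than the weight allows.\<close>
  have "snd z - snd (?L 0) = 0"
  proof -
    obtain Bu BL where B: "\<And>t. norm1 (u t) \<le> Bu * wt t" "\<And>t. norm1 (?L t) \<le> BL * wt t"
      using wspace_bound[OF u] wspace_bound[OF lp_backward[OF \<xi> u]] by metis
    have le: "norm (snd z - snd (?L 0)) \<le> (Bu + BL) * exp (- (\<gamma> + \<gamma>f) * t)" if t: "t \<le> 0" for t
    proof -
      \<comment> \<open>Running the difference forwards from \<open>t\<close> to \<open>0\<close>
        contracts it at rate \<open>\<gamma>f\<close>. The weight at \<open>t\<close> is beaten by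
        this contraction, and letting \<open>t\<close> tend to minus infinity leaves zero.\<close>
      have "snd z - snd (?L 0) = EF (- t) *v (EF t *v (snd z - snd (?L 0)))"
        using matrix_exp_add_vec[of "- t" t F] by (simp add: matrix_exp_0)
      also have "\<dots> = EF (- t) *v (snd (u t) - snd (?L t))" using main[OF t] by simp
      also have "norm \<dots> \<le> exp (\<gamma>f * (- t)) * norm (snd (u t) - snd (?L t))"
        using t by (intro exp_F) simp
      also have "\<dots> \<le> exp (\<gamma>f * (- t)) * ((Bu + BL) * wt t)"
      proof (intro mult_left_mono)
        have "norm (snd (u t)) \<le> norm1 (u t)" "norm (snd (?L t)) \<le> norm1 (?L t)" by (simp_all add: norm1_def)
        then show "norm (snd (u t) - snd (?L t)) \<le> (Bu + BL) * wt t"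
          using B(1)[of t] B(2)[of t] norm_triangle_ineq4[of "snd (u t)" "snd (?L t)"]
          unfolding distrib_right by linarith
      qed simp
      also have "\<dots> = (Bu + BL) * exp (- (\<gamma> + \<gamma>f) * t)" by (simp add: algebra_simps flip: exp_add)
      finally show ?thesis .
    qed
    have "((\<lambda>t. (Bu + BL) * exp (- (\<gamma> + \<gamma>f) * t)) \<longlongrightarrow> 0) at_bot"
      using rate_pos(2)
      by (intro tendsto_mult_right_zero exp_at_bot[THEN filterlim_compose]
          filterlim_tendsto_pos_mult_at_bot[OF tendsto_const] filterlim_ident)
    then have "norm (snd z - snd (?L 0)) \<le> 0"
      by (rule tendsto_lowerbound) (use le in \<open>auto simp: eventually_at_bot_linorder\<close>)
    then show ?thesis by simp
  qed
  then have "?L t = u t" if "t \<le> 0" for t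
    using main[OF that] by (simp add: prod_eq_iff)
  moreover have "?L t = u t" if "0 < t" for t
    using wspace_outside[OF u, of t] that by (simp add: lp_def)
  ultimately show ?thesis by (intro ext) (metis not_le)
qed

section \<open>Characterization of the graph by growth in the past, and its invariance\<close>

lemma cut_backward:
  assumes "continuous_on {..0} u" and B: "\<And>t. t \<le> 0 \<Longrightarrow> norm1 (u t) \<le> B * wt t"
  shows "(\<lambda>t. if t \<le> 0 then u t else 0) \<in> backward"
proof -
  have eq: "(\<lambda>t. if t \<le> 0 then u t else 0) = (\<lambda>t. indicator {..0} t *\<^sub>R u t)"
    by (auto simp: fun_eq_iff)
  have "(\<lambda>t. indicator {..0} t *\<^sub>R u t) \<in> borel_measurable borel"
    by (rule borel_measurable_continuous_on_indicator[OF _ assms(1)]) simp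
  then have "(\<lambda>t. if t \<le> 0 then u t else 0) \<in> borel_measurable borel" by (simp only: eq)
  moreover have "0 \<le> B" using order_trans[OF norm1_nonneg B[of 0]] by simp
  ultimately show ?thesis using B by (intro wspaceI[where B = B]) auto
qed

text \<open>The right side speaks of the flow alone, not of the fixed point; this is what lets the
  cocycle property yield invariance, and it is also the description of
  \<open>slow_set\<close>.\<close>

lemma graph_iff:
  assumes \<rho>: "cs + cf < 1" and \<xi>: "tame \<xi>"
  shows "snd z = graph \<xi> (fst z) \<longleftrightarrow> (\<exists>B. \<forall>t\<le>0. norm1 (flow \<xi> t z) \<le> B * wt t)"
proof
  assume "snd z = graph \<xi> (fst z)"
  then have z: "lpsol \<xi> (fst z) 0 = z" using lpsol_0[OF \<rho> \<xi>, of "fst z"] by (simp add: prod_eq_iff)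
  note l = lpsol[OF \<rho> \<xi>, of "fst z"]
  obtain B where "\<And>t. norm1 (lpsol \<xi> (fst z) t) \<le> B * wt t"
    using wspace_bound[OF l(1)] by blast
  moreover have "flow \<xi> t z = lpsol \<xi> (fst z) t" if "t \<le> 0" for t
  proof (rule flow_eq_on[OF \<xi>])
    show "integral_curve {..0} \<xi> z (lpsol \<xi> (fst z))"
      using lp_integral_curve[OF \<xi> l(1,2)] by (simp only: z)
    show "closed_segment 0 t \<subseteq> {..0}"
      using that by (auto simp: closed_segment_eq_real_ivl split: if_splits)
  qed
  ultimately show "\<exists>B. \<forall>t\<le>0. norm1 (flow \<xi> t z) \<le> B * wt t" by metis
next
  assume "\<exists>B. \<forall>t\<le>0. norm1 (flow \<xi> t z) \<le> B * wt t"
  then obtain B where B: "\<And>t. t \<le> 0 \<Longrightarrow> norm1 (flow \<xi> t z) \<le> B * wt t" by blast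
  let ?u = "\<lambda>t. if t \<le> 0 then flow \<xi> t z else 0"
  have "continuous_on {..0} (\<lambda>t. flow \<xi> t z)"
    by (rule continuous_on_subset[OF integral_curve_continuous[OF integral_curve_flow[OF \<xi>]]]) simp
  from cut_backward[OF this B] have u: "?u \<in> backward" .
  \<comment> \<open>For nonpositive \<open>t\<close> the density vanishes at positive times, so
    cutting the orbit off there does not change the integrals.\<close>
  have eq: "orient t s *\<^sub>R field (\<xi> s) (?u s) = orient t s *\<^sub>R field (\<xi> s) (flow \<xi> s z)" if "t \<le> 0" for t s
    using that orient_nonzero[of t s] by (cases "orient t s = 0") auto
  have "integral_curve {..0} \<xi> z ?u"
    unfolding integral_curve_def
  proof (rule ballI)
    fix t :: real assume "t \<in> {..0}"
    then have t: "t \<le> 0" by simp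
    have "integrable lborel (\<lambda>s. orient t s *\<^sub>R field (\<xi> s) (flow \<xi> s z)) \<and>
        flow \<xi> t z = z + (LBINT s. orient t s *\<^sub>R field (\<xi> s) (flow \<xi> s z))"
      using integral_curve_flow[OF \<xi>, of z] unfolding integral_curve_def by blast
    then show "integrable lborel (\<lambda>s. orient t s *\<^sub>R field (\<xi> s) (?u s)) \<and>
        ?u t = z + (LBINT s. orient t s *\<^sub>R field (\<xi> s) (?u s))"
      unfolding eq[OF t] if_P[OF t] .
  qed
  from integral_curve_lp[OF \<xi> u this] have "lpsol \<xi> (fst z) = ?u"
    by (rule lpsol_eq[OF \<rho> \<xi> u])
  then show "snd z = graph \<xi> (fst z)" by (simp add: graph_def flow_0[OF \<xi>])
qed

text \<open>The past of the point at time \<open>t\<close> is the shifted orbit. Where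
  \<open>s + t\<close> is nonpositive the old bound applies with the constant
  \<open>B * wt t\<close>; the remaining times lie in the compact interval from \<open>0\<close> to
  \<open>\<bar>t\<bar>\<close>, where continuity bounds the orbit.\<close>

lemma graph_invariant:
  assumes \<rho>: "cs + cf < 1" and \<xi>: "tame \<xi>" and z: "snd z = graph \<xi> (fst z)"
  shows "snd (flow \<xi> t z) = graph (\<lambda>r. \<xi> (r + t)) (fst (flow \<xi> t z))"
proof -
  obtain B where B: "\<And>t. t \<le> 0 \<Longrightarrow> norm1 (flow \<xi> t z) \<le> B * wt t"
    using z graph_iff[OF \<rho> \<xi>] by blast
  have "0 \<le> B" using order_trans[OF norm1_nonneg B[of 0]] by simp
  have "continuous_on {0..\<bar>t\<bar>} (\<lambda>s. norm1 (flow \<xi> s z))"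
    by (intro continuous_intros continuous_on_subset[OF integral_curve_continuous[OF integral_curve_flow[OF \<xi>]]]) simp
  then have "bounded ((\<lambda>s. norm1 (flow \<xi> s z)) ` {0..\<bar>t\<bar>})"
    by (intro compact_imp_bounded compact_continuous_image compact_Icc)
  then obtain C where C: "\<And>s. 0 \<le> s \<Longrightarrow> s \<le> \<bar>t\<bar> \<Longrightarrow> norm1 (flow \<xi> s z) \<le> C"
    unfolding bounded_iff by (metis abs_of_nonneg atLeastAtMost_iff imageI norm1_nonneg real_norm_def)
  have "norm1 (flow (\<lambda>r. \<xi> (r + t)) s (flow \<xi> t z)) \<le> (B * wt t + \<bar>C\<bar>) * wt s"
    if s: "s \<le> 0" for s
  proof -
    have eq: "flow (\<lambda>r. \<xi> (r + t)) s (flow \<xi> t z) = flow \<xi> (s + t) z"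
      by (rule flow_cocycle[OF \<xi>, symmetric])
    have "norm1 (flow \<xi> (s + t) z) \<le> B * wt (s + t) + \<bar>C\<bar> * wt s"
    proof (cases "s + t \<le> 0")
      case True
      have "0 \<le> \<bar>C\<bar> * wt s" by simp
      then show ?thesis using B[OF True] by linarith
    next
      case False
      have "\<bar>C\<bar> * 1 \<le> \<bar>C\<bar> * wt s"
        using s \<gamma>_pos by (intro mult_left_mono) (auto simp: mult_le_0_iff)
      moreover have "norm1 (flow \<xi> (s + t) z) \<le> C" using False s by (intro C) auto
      moreover have "0 \<le> B * wt (s + t)" using \<open>0 \<le> B\<close> by simp
      ultimately show ?thesis by linarith
    qed
    then show ?thesis unfolding eq by (simp add: algebra_simps exp_add exp_diff exp_minus divide_inverse)
  qed
  then show ?thesis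
    unfolding graph_iff[OF \<rho> tame_shift[OF \<xi>]] by blast
qed

end


section \<open>Exponential tracking\<close>

context slow_fast
begin

abbreviation forward :: "(real \<Rightarrow> (real ^ 'n) \<times> (real ^ 'm)) set" where
  "forward \<equiv> wspace {0..} (\<lambda>t. wt t)"

abbreviation incr1 where "incr1 \<xi> w u s \<equiv> nl1 (\<xi> s) (w s + u s) - nl1 (\<xi> s) (w s)"
abbreviation incr2 where "incr2 \<xi> w u s \<equiv> nl2 (\<xi> s) (w s + u s) - nl2 (\<xi> s) (w s)"

text \<open>The difference of two solutions, of which the reference one is \<open>w\<close>, is determined by its
  behaviour at infinity in the slow component and by its initial value in the fast one; the latter
  is chosen so as to land on the graph.\<close>

definition tslow ::
    "(real \<Rightarrow> real ^ 'm) \<Rightarrow> (real \<Rightarrow> (real ^ 'n) \<times> (real ^ 'm)) \<Rightarrow>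
     (real \<Rightarrow> (real ^ 'n) \<times> (real ^ 'm)) \<Rightarrow> real \<Rightarrow> real ^ 'n" where
  "tslow \<xi> w u t = - \<epsilon> *\<^sub>R (LBINT s. indicator {t<..} s *\<^sub>R (ES (t - s) *v incr1 \<xi> w u s))"

definition tfast ::
    "(real \<Rightarrow> real ^ 'm) \<Rightarrow> (real \<Rightarrow> (real ^ 'n) \<times> (real ^ 'm)) \<Rightarrow>
     (real \<Rightarrow> (real ^ 'n) \<times> (real ^ 'm)) \<Rightarrow> real \<Rightarrow> real ^ 'm" where
  "tfast \<xi> w u t = (LBINT s. orient t s *\<^sub>R (EF (t - s) *v incr2 \<xi> w u s))"

definition track where
  "track \<xi> w u t = (if 0 \<le> t then
     (tslow \<xi> w u t,
      EF t *v (graph \<xi> (fst (w 0) + tslow \<xi> w u 0) - snd (w 0)) + tfast \<xi> w u t) else 0)"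

context
  fixes \<xi> :: "real \<Rightarrow> real ^ 'm" and w :: "real \<Rightarrow> (real ^ 'n) \<times> (real ^ 'm)"
  assumes \<xi>: "tame \<xi>" and w: "w \<in> borel_measurable borel"
begin

lemma increment_measurable:
  assumes "u \<in> forward"
  shows "(\<lambda>s. incr1 \<xi> w u s) \<in> borel_measurable borel"
    "(\<lambda>s. incr2 \<xi> w u s) \<in> borel_measurable borel"
proof -
  note [measurable] = tame_measurable[OF \<xi>] w wspace_measurable[OF assms]
  show "(\<lambda>s. incr1 \<xi> w u s) \<in> borel_measurable borel"
    "(\<lambda>s. incr2 \<xi> w u s) \<in> borel_measurable borel"
    by measurable
qed

lemma increment_bound:
  assumes "\<And>s. norm1 (u s) \<le> B * wt s"
  shows "norm (incr1 \<xi> w u s) \<le> K * B * wt s"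
    "norm (incr2 \<xi> w u s) \<le> K * B * wt s"
proof -
  have "K * norm1 (w s + u s - w s) \<le> K * B * wt s"
    using mult_left_mono[OF assms[of s], of K] K_pos by simp
  note nl_lipschitz[THEN order_trans, OF this]
  then show "norm (incr1 \<xi> w u s) \<le> K * B * wt s"
    "norm (incr2 \<xi> w u s) \<le> K * B * wt s" by blast+
qed

lemma forward_integrable:
  assumes u: "u \<in> forward"
  shows "integrable lborel (\<lambda>s. indicator {t<..} s *\<^sub>R (ES (t - s) *v incr1 \<xi> w u s))"
    and "0 \<le> t \<Longrightarrow> integrable lborel (\<lambda>s. orient t s *\<^sub>R (EF (t - s) *v incr2 \<xi> w u s))"
    and "0 \<le> t \<Longrightarrow> integrable lborel (\<lambda>s. orient t s *\<^sub>R (incr1 \<xi> w u s))"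
    and "0 \<le> t \<Longrightarrow> integrable lborel (\<lambda>s. orient t s *\<^sub>R (incr2 \<xi> w u s))"
proof -
  obtain B where B: "0 \<le> B" "\<And>s. norm1 (u s) \<le> B * wt s" using wspace_bound[OF u] by blast
  have KB: "0 \<le> K * B" using K_pos B by simp
  note le = increment_bound[OF B(2)] and m = increment_measurable[OF u]
  show "integrable lborel (\<lambda>s. indicator {t<..} s *\<^sub>R (ES (t - s) *v incr1 \<xi> w u s))"
    by (rule slow_convolution(1)[OF m(1) _ _ KB le(1)]) auto
  assume t: "0 \<le> t"
  show "integrable lborel (\<lambda>s. orient t s *\<^sub>R (EF (t - s) *v incr2 \<xi> w u s))"
    unfolding orient_pos[OF t] by (rule fast_convolution(1)[OF m(2) _ _ KB le(2)]) auto
  have exp_le: "K * B * wt s \<le> K * B" if "orient t s \<noteq> 0" for s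
  proof -
    have "0 \<le> s" using orient_nonzero[OF that] t by auto
    then have "- \<gamma> * s \<le> 0" using \<gamma>_pos by simp
    then have "wt s \<le> 1" by simp
    from mult_left_mono[OF this KB] show ?thesis by simp
  qed
  show "integrable lborel (\<lambda>s. orient t s *\<^sub>R (incr1 \<xi> w u s))"
    by (rule integrable_orient_bounded[OF m(1) order_trans[OF le(1) exp_le]])
  show "integrable lborel (\<lambda>s. orient t s *\<^sub>R (incr2 \<xi> w u s))"
    by (rule integrable_orient_bounded[OF m(2) order_trans[OF le(2) exp_le]])
qed

lemma tslow_diff:
  assumes u: "u \<in> forward" and v: "v \<in> forward"
    and B: "0 \<le> B" "\<And>s. norm1 (u s - v s) \<le> B * wt s"
  shows "norm (tslow \<xi> w u t - tslow \<xi> w v t) \<le> cs * B * wt t"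
    and "0 \<le> t \<Longrightarrow> norm (tfast \<xi> w u t - tfast \<xi> w v t) \<le> cf * B * wt t"
proof -
  note [measurable] = tame_measurable[OF \<xi>] w wspace_measurable[OF u] wspace_measurable[OF v]
  have KB: "0 \<le> K * B" using K_pos B by simp
  have "K * norm1 ((w s + u s) - (w s + v s)) \<le> K * B * wt s" for s
    using mult_left_mono[OF B(2)[of s], of K] K_pos by simp
  note le = nl_lipschitz[THEN order_trans, OF this]
  have m: "(\<lambda>s. nl1 (\<xi> s) (w s + u s) - nl1 (\<xi> s) (w s + v s)) \<in> borel_measurable borel"
    "(\<lambda>s. nl2 (\<xi> s) (w s + u s) - nl2 (\<xi> s) (w s + v s)) \<in> borel_measurable borel" by measurable
    let ?I = "LBINT s. indicator {t<..} s *\<^sub>R (ES (t - s) *v (nl1 (\<xi> s) (w s + u s) - nl1 (\<xi> s) (w s + v s)))"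
  have "indicator {t<..} s *\<^sub>R (ES (t - s) *v (nl1 (\<xi> s) (w s + u s) - nl1 (\<xi> s) (w s + v s)))
      = indicator {t<..} s *\<^sub>R (ES (t - s) *v (incr1 \<xi> w u s))
        - indicator {t<..} s *\<^sub>R (ES (t - s) *v (incr1 \<xi> w v s))" for s
    by (simp add: matrix_vector_mult_diff_distrib algebra_simps)
  then have "tslow \<xi> w u t - tslow \<xi> w v t = - \<epsilon> *\<^sub>R ?I"
    using Bochner_Integration.integral_diff[OF forward_integrable(1)[OF u] forward_integrable(1)[OF v], of t t]
    unfolding tslow_def by (simp only: scaleR_diff_right)
  moreover have "norm ?I \<le> K * B / (\<gamma> + \<epsilon> * \<gamma>s) * wt t"
    by (rule slow_convolution(2)[OF m(1) _ _ KB le(1)]) auto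
  then have "\<epsilon> * norm ?I \<le> \<epsilon> * (K * B / (\<gamma> + \<epsilon> * \<gamma>s) * wt t)"
    using \<epsilon>_pos by (intro mult_left_mono) auto
  ultimately show "norm (tslow \<xi> w u t - tslow \<xi> w v t) \<le> cs * B * wt t"
    using \<epsilon>_pos by (simp add: cs_def mult_ac)
  assume t: "0 \<le> t"
  let ?J = "LBINT s. indicator {0<..<t} s *\<^sub>R (EF (t - s) *v (nl2 (\<xi> s) (w s + u s) - nl2 (\<xi> s) (w s + v s)))"
  have "indicator {0<..<t} s *\<^sub>R (EF (t - s) *v (nl2 (\<xi> s) (w s + u s) - nl2 (\<xi> s) (w s + v s)))
      = orient t s *\<^sub>R (EF (t - s) *v (incr2 \<xi> w u s))
        - orient t s *\<^sub>R (EF (t - s) *v (incr2 \<xi> w v s))" for s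
    by (simp add: orient_pos[OF t] matrix_vector_mult_diff_distrib algebra_simps)
  then have "tfast \<xi> w u t - tfast \<xi> w v t = ?J"
    using Bochner_Integration.integral_diff[OF forward_integrable(2)[OF u t] forward_integrable(2)[OF v t]]
    unfolding tfast_def by (simp only:)
  moreover have "norm ?J \<le> K * B / - (\<gamma> + \<gamma>f) * wt t"
    by (rule fast_convolution(2)[OF m(2) _ _ KB le(2)]) auto
  moreover have "K * B / - (\<gamma> + \<gamma>f) = cf * B"
    unfolding cf_eq[symmetric] by simp
  ultimately show "norm (tfast \<xi> w u t - tfast \<xi> w v t) \<le> cf * B * wt t"
    by (simp only:)
qed

lemma tslow_zero: "tslow \<xi> w (\<lambda>_. 0) t = 0" "tfast \<xi> w (\<lambda>_. 0) t = 0"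
  by (simp_all add: tslow_def tfast_def)

lemma track_0: "track \<xi> w u 0 = (tslow \<xi> w u 0, graph \<xi> (fst (w 0) + tslow \<xi> w u 0) - snd (w 0))"
  by (simp add: track_def tfast_def orient_def matrix_exp_0)

lemma exp_F_weight:
  assumes "0 \<le> t"
  shows "norm (EF t *v y) \<le> norm y * wt t"
proof -
  have "norm (EF t *v y) \<le> exp (\<gamma>f * t) * norm y" by (rule exp_F[OF assms])
  also have "\<gamma>f * t \<le> - \<gamma> * t" using rate_pos(2) assms by (intro mult_right_mono) auto
  then have "exp (\<gamma>f * t) * norm y \<le> wt t * norm y" by (intro mult_right_mono) auto
  finally show ?thesis by (simp add: mult.commute)
qed

text \<open>Besides \<open>cs + cf\<close> there is a third term: the initial fast value depends on
  \<open>u\<close> through the graph, whose Lipschitz constant \<open>cf / (1 - (cs + cf))\<close>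
  multiplies the bound \<open>cs\<close> for the slow component at \<open>0\<close>. The free fast
  motion then carries it along within the weight.\<close>

lemma track_diff:
  assumes \<rho>: "cs + cf < 1" and u: "u \<in> forward" and v: "v \<in> forward"
    and B: "0 \<le> B" "\<And>s. norm1 (u s - v s) \<le> B * wt s"
  shows "norm1 (track \<xi> w u t - track \<xi> w v t)
    \<le> (cs + cf + cf / (1 - (cs + cf)) * cs) * B * wt t"
proof (cases "0 \<le> t")
  case True
  let ?d = "graph \<xi> (fst (w 0) + tslow \<xi> w u 0) - graph \<xi> (fst (w 0) + tslow \<xi> w v 0)"
  have "norm ?d \<le> cf / (1 - (cs + cf)) * norm (tslow \<xi> w u 0 - tslow \<xi> w v 0)"
    using graph_lipschitz[OF \<rho> \<xi>, of "fst (w 0) + tslow \<xi> w u 0" "fst (w 0) + tslow \<xi> w v 0"] by simp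
  also have "\<dots> \<le> cf / (1 - (cs + cf)) * (cs * B * wt 0)"
    using \<rho> cf_pos by (intro mult_left_mono tslow_diff u v B) auto
  finally have d: "norm ?d \<le> cf / (1 - (cs + cf)) * cs * B" by simp
  have "norm (snd (track \<xi> w u t - track \<xi> w v t))
      = norm (EF t *v ?d + (tfast \<xi> w u t - tfast \<xi> w v t))"
    using True by (simp add: track_def matrix_vector_mult_diff_distrib algebra_simps)
  also have "\<dots> \<le> cf / (1 - (cs + cf)) * cs * B * wt t + cf * B * wt t"
    using order_trans[OF exp_F_weight[OF True] mult_right_mono[OF d]]
    by (intro norm_triangle_mono tslow_diff u v B True) auto
  finally have "norm (snd (track \<xi> w u t - track \<xi> w v t))
      \<le> cf / (1 - (cs + cf)) * cs * B * wt t + cf * B * wt t" .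
  moreover have "norm (fst (track \<xi> w u t - track \<xi> w v t)) \<le> cs * B * wt t"
    using tslow_diff(1)[OF u v B, of t] True by (simp add: track_def)
  ultimately show ?thesis unfolding norm1_def distrib_right by linarith
next
  case False
  have "norm1 (track \<xi> w u t - track \<xi> w v t) = 0" using False by (simp add: track_def)
  also have "0 \<le> (cs + cf + cf / (1 - (cs + cf)) * cs) * B * wt t"
    using \<rho> B(1) cs_pos cf_pos
    by (intro mult_nonneg_nonneg add_nonneg_nonneg divide_nonneg_nonneg) auto
  finally show ?thesis .
qed

lemma track_forward:
  assumes \<rho>: "cs + cf < 1" and u: "u \<in> forward"
  shows "track \<xi> w u \<in> forward"
proof -
  note [measurable] = tame_measurable[OF \<xi>] w wspace_measurable[OF u]
  have ind: "indicator {t<..} s = (if t < s then 1 else 0 :: real)" for s t :: real by simp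
  have [measurable]: "tslow \<xi> w u \<in> borel_measurable borel" "tfast \<xi> w u \<in> borel_measurable borel"
    unfolding tslow_def tfast_def ind by measurable
  have m: "track \<xi> w u \<in> borel_measurable borel"
    unfolding track_def by (intro measurable_If borel_measurable_Pair) measurable
  obtain B where B: "0 \<le> B" "\<And>s. norm1 (u s) \<le> B * wt s" using wspace_bound[OF u] by blast
  define c where "c = norm (graph \<xi> (fst (w 0)) - snd (w 0))"
  define l where "l = cs + cf + cf / (1 - (cs + cf)) * cs"
  have "norm1 (track \<xi> w u t) \<le> (l * B + c) * wt t" for t
  proof -
    have "norm1 (track \<xi> w u t) \<le> norm1 (track \<xi> w u t - track \<xi> w (\<lambda>_. 0) t) + norm1 (track \<xi> w (\<lambda>_. 0) t)"
      using norm1_triangle[of "track \<xi> w u t - track \<xi> w (\<lambda>_. 0) t" "track \<xi> w (\<lambda>_. 0) t"] by simp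
    moreover have "norm1 (track \<xi> w u t - track \<xi> w (\<lambda>_. 0) t) \<le> l * B * wt t"
      unfolding l_def using B by (intro track_diff \<rho> u zero_wspace) auto
    moreover have "norm1 (track \<xi> w (\<lambda>_. 0) t) \<le> c * wt t"
      using exp_F_weight[of t "graph \<xi> (fst (w 0)) - snd (w 0)"]
      by (auto simp: track_def tslow_zero norm1_def c_def)
    ultimately show ?thesis unfolding distrib_right by linarith
  qed
  moreover have "0 \<le> l * B + c"
    unfolding l_def c_def using \<rho> cs_pos cf_pos B
    by (intro add_nonneg_nonneg mult_nonneg_nonneg divide_nonneg_nonneg) auto
  moreover have "track \<xi> w u t = 0" if "t \<notin> {0..}" for t using that by (simp add: track_def)
  ultimately show ?thesis using m by (intro wspaceI[where B = "l * B + c"])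
qed

lemma track_fixpoint:
  assumes \<rho>: "cs + cf + cf / (1 - (cs + cf)) * cs < 1" "cs + cf < 1"
  obtains u where "u \<in> forward" "track \<xi> w u = u"
proof -
  obtain B0 where B0: "0 \<le> B0" "\<And>t. norm1 (track \<xi> w (\<lambda>_. 0) t) \<le> B0 * wt t"
    using wspace_bound[OF track_forward[OF \<rho>(2) zero_wspace]] by blast
  have "\<exists>u\<in>forward. track \<xi> w u = u \<and> (\<forall>t. (\<lambda>n. (track \<xi> w ^^ n) (\<lambda>_. 0) t) \<longlonglongrightarrow> u t)"
  proof (rule weighted_fixpoint[where W = "\<lambda>t. wt t"
        and \<rho> = "cs + cf + cf / (1 - (cs + cf)) * cs" and ?B0.0 = B0])
    show "u \<in> forward" if "\<And>n. v n \<in> forward" "\<And>t. (\<lambda>n. v n t) \<longlonglongrightarrow> u t"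
      "\<And>n t. norm1 (v n t - u t) \<le> C * wt t" for v u C
      by (rule wspace_closed[OF _ that]) simp
  next
    show "norm1 (track \<xi> w (\<lambda>_. 0) t - 0) \<le> B0 * wt t" for t
      using B0(2) by simp
    show "0 \<le> cs + cf + cf / (1 - (cs + cf)) * cs"
      using \<rho> cs_pos cf_pos by (intro add_nonneg_nonneg mult_nonneg_nonneg divide_nonneg_nonneg) auto
  qed (use \<rho> B0 zero_wspace track_forward track_diff in auto)
  then show ?thesis using that by blast
qed

text \<open>Once the fixed point is known, its initial fast value is treated as a datum and the
  graph is no longer involved, so the constant is \<open>1 / (1 - (cs + cf))\<close>. A bound
  proportional to \<open>norm1 (u 0)\<close> is what produces the factor
  \<open>norm (z - z')\<close> in the tracking property.\<close>

lemma track_bound: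
  assumes \<rho>: "cs + cf < 1" and u: "u \<in> forward" "track \<xi> w u = u" and t: "0 \<le> t"
  shows "norm1 (u t) \<le> norm1 (u 0) / (1 - (cs + cf)) * wt t"
proof -
  obtain B0 where B0: "\<And>s. norm1 (u s) \<le> B0 * wt s" using wspace_bound[OF u(1)] by blast
  show ?thesis
  proof (rule weighted_bound[where I = "{0..}" and W = "\<lambda>t. wt t" and d = "\<lambda>t. norm1 (u t)"
        and ?B0.0 = B0])
    fix B t assume B: "0 \<le> B" "\<And>s. s \<in> {0..} \<Longrightarrow> norm1 (u s) \<le> B * wt s" and "t \<in> {0 :: real..}"
    then have t: "0 \<le> t" by simp
    have B': "norm1 (u s - 0) \<le> B * wt s" for s
      using B wspace_outside[OF u(1), of s] by (cases "0 \<le> s") auto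
    note d = tslow_diff[OF u(1) zero_wspace B(1) B', unfolded tslow_zero diff_zero]
    have ut: "u t = (tslow \<xi> w u t, EF t *v snd (u 0) + tfast \<xi> w u t)"
      using fun_cong[OF u(2), of t] fun_cong[OF u(2), of 0] t unfolding track_0
      by (metis snd_conv track_def)
    have "norm1 (u t) \<le> cs * B * wt t + (norm (snd (u 0)) * wt t + cf * B * wt t)"
      unfolding ut norm1_def fst_conv snd_conv
      by (intro add_mono norm_triangle_mono d exp_F_weight t)
    moreover have "norm (snd (u 0)) * wt t \<le> norm1 (u 0) * wt t"
      by (intro mult_right_mono) (auto simp: norm1_def)
    ultimately show "norm1 (u t) \<le> (norm1 (u 0) + (cs + cf) * B) * wt t"
      unfolding distrib_right by linarith
  qed (use \<rho> cs_pos cf_pos t B0 in auto)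
qed

text \<open>Counterpart of \<open>fast_split\<close> in the other direction: the integral from
  \<open>t\<close> to infinity is the one from \<open>0\<close> less the part between, which trades
  the condition at infinity for an initial value.\<close>

lemma tslow_split:
  assumes u: "u \<in> forward" and t: "0 \<le> t"
  shows "tslow \<xi> w u t = ES t *v tslow \<xi> w u 0
    + \<epsilon> *\<^sub>R (LBINT s. orient t s *\<^sub>R (ES (t - s) *v incr1 \<xi> w u s))"
proof -
  let ?f = "\<lambda>s. incr1 \<xi> w u s"
  note [measurable] = increment_measurable(1)[OF u]
  let ?q = "\<lambda>s. ES (t - s) *v ?f s"
  let ?g = "\<lambda>s. indicator {0<..} s *\<^sub>R (ES (0 - s) *v ?f s)"
  have g: "integrable lborel ?g" by (rule forward_integrable(1)[OF u])
  have shift: "ES t *v (ES (0 - s) *v y)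
      = ES (t - s) *v y" for s y
    using matrix_exp_add_vec[of "\<epsilon> * t" "\<epsilon> * (0 - s)" S y] by (simp add: right_diff_distrib)
  have Eg: "integrable lborel (\<lambda>s. indicator {0<..} s *\<^sub>R ?q s)"
    "ES t *v (LBINT s. ?g s) = (LBINT s. indicator {0<..} s *\<^sub>R ?q s)"
    using integrable_bounded_linear[OF matrix_vector_mul_bounded_linear[of "ES t"] g]
      integral_bounded_linear[OF matrix_vector_mul_bounded_linear[of "ES t"] g]
    by (simp_all only: matrix_vector_mult_scaleR shift)
  have i: "integrable lborel (\<lambda>s. indicator {t<..} s *\<^sub>R ?q s)" by (rule forward_integrable(1)[OF u])
  have AE: "AE s in lborel. orient t s *\<^sub>R ?q s = indicator {0<..} s *\<^sub>R ?q s - indicator {t<..} s *\<^sub>R ?q s"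
  proof (rule AE_mp[OF AE_lborel_singleton[of t]], intro AE_I2 impI)
    fix s assume "s \<noteq> t"
    then have "orient t s = indicator {0<..} s - indicator {t<..} s"
      using t by (auto simp: orient_def split: split_indicator)
    then show "orient t s *\<^sub>R ?q s = indicator {0<..} s *\<^sub>R ?q s - indicator {t<..} s *\<^sub>R ?q s"
      by (simp only: scaleR_left_diff_distrib)
  qed
  have "(LBINT s. orient t s *\<^sub>R ?q s)
      = (LBINT s. indicator {0<..} s *\<^sub>R ?q s - indicator {t<..} s *\<^sub>R ?q s)"
    by (rule integral_cong_AE[OF _ _ AE]) measurable
  also have "\<dots> = (LBINT s. indicator {0<..} s *\<^sub>R ?q s) - (LBINT s. indicator {t<..} s *\<^sub>R ?q s)"
    by (rule Bochner_Integration.integral_diff[OF Eg(1) i])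
  finally show ?thesis
    unfolding tslow_def matrix_vector_mult_scaleR Eg(2) by (simp add: scaleR_diff_right)
qed

text \<open>By variation of constants \<open>u\<close> solves the linear system forced by the
  increments of the nonlinearities along \<open>w\<close>. Adding the equation of \<open>w\<close>
  makes the increments telescope to the nonlinearities at \<open>w + u\<close>.\<close>

lemma track_integral_curve:
  assumes u: "u \<in> forward" "track \<xi> w u = u" and curve: "integral_curve {0..} \<xi> (w 0) w"
  shows "integral_curve {0..} \<xi> (w 0 + u 0) (\<lambda>t. w t + u t)"
  unfolding integral_curve_iff
proof (rule ballI)
  fix t :: real assume "t \<in> {0..}"
  then have t: "0 \<le> t" by simp
  have seg: "0 \<le> r" if "r \<in> closed_segment 0 t" for r
    using that t by (auto simp: closed_segment_eq_real_ivl split: if_splits)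
  let ?f = "\<lambda>s. incr1 \<xi> w u s"
  let ?g = "\<lambda>s. incr2 \<xi> w u s"
  note m = increment_measurable[OF u(1)]
  note [measurable] = m
  have m1: "(\<lambda>s. \<epsilon> *\<^sub>R ?f s) \<in> borel_measurable borel" by measurable
  have i1: "integrable lborel (\<lambda>s. orient t s *\<^sub>R \<epsilon> *\<^sub>R ?f s)"
    using integrable_scaleR_right[OF forward_integrable(3)[OF u(1) t], of \<epsilon>] by (simp add: mult.commute)
  have i2: "integrable lborel (\<lambda>s. orient t s *\<^sub>R ?g s)" by (rule forward_integrable(4)[OF u(1) t])
  have ur: "u r = (tslow \<xi> w u r, EF r *v snd (u 0) + tfast \<xi> w u r)" if "0 \<le> r" for r
    using fun_cong[OF u(2), of r] fun_cong[OF u(2), of 0] that unfolding track_0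
    by (metis snd_conv track_def)
  have "fst (u r) = matrix_exp (r *\<^sub>R (\<epsilon> *\<^sub>R S)) *v fst (u 0)
     + (LBINT s. orient r s *\<^sub>R (matrix_exp ((r - s) *\<^sub>R (\<epsilon> *\<^sub>R S)) *v (\<epsilon> *\<^sub>R ?f s)))"
    if "r \<in> closed_segment 0 t" for r
  proof -
    have "fst (u 0) = tslow \<xi> w u 0" using arg_cong[OF ur[of 0], of fst] by simp
    moreover have "fst (u r) = tslow \<xi> w u r" using arg_cong[OF ur[OF seg[OF that]], of fst] by simp
    ultimately show ?thesis
      unfolding slow_mild[symmetric] using tslow_split[OF u(1) seg[OF that]] by simp
  qed
  note 1 = mild_imp_integrated[OF m1 i1 this]
  have "snd (u r) = EF r *v snd (u 0)
     + (LBINT s. orient r s *\<^sub>R (EF (r - s) *v ?g s))"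
    if "r \<in> closed_segment 0 t" for r
    using arg_cong[OF ur[OF seg[OF that]], of snd] unfolding tfast_def snd_conv .
  note 2 = mild_imp_integrated[OF m(2) i2 this]
  let ?a = "\<lambda>s. orient t s *\<^sub>R (\<epsilon> *\<^sub>R (S *v fst (w s)) + \<epsilon> *\<^sub>R nl1 (\<xi> s) (w s))"
  let ?b = "\<lambda>s. orient t s *\<^sub>R (F *v snd (w s) + nl2 (\<xi> s) (w s))"
  let ?c = "\<lambda>s. orient t s *\<^sub>R (\<epsilon> *\<^sub>R S *v fst (u s) + \<epsilon> *\<^sub>R ?f s)"
  let ?d = "\<lambda>s. orient t s *\<^sub>R (F *v snd (u s) + ?g s)"
  have 3: "integrable lborel ?a \<and> integrable lborel ?b \<and>
      fst (w t) = fst (w 0) + (LBINT s. ?a s) \<and> snd (w t) = snd (w 0) + (LBINT s. ?b s)"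
    using curve[unfolded integral_curve_iff] \<open>t \<in> {0..}\<close> by blast
  have eq: "orient t s *\<^sub>R (\<epsilon> *\<^sub>R (S *v fst (w s + u s)) + \<epsilon> *\<^sub>R nl1 (\<xi> s) (w s + u s)) = ?a s + ?c s"
    "orient t s *\<^sub>R (F *v snd (w s + u s) + nl2 (\<xi> s) (w s + u s)) = ?b s + ?d s" for s
    by (simp_all add: matrix_vector_right_distrib scaleR_matrix_vector_assoc[symmetric] algebra_simps)
  show "integrable lborel (\<lambda>s. orient t s *\<^sub>R (\<epsilon> *\<^sub>R (S *v fst (w s + u s)) + \<epsilon> *\<^sub>R nl1 (\<xi> s) (w s + u s))) \<and>
     integrable lborel (\<lambda>s. orient t s *\<^sub>R (F *v snd (w s + u s) + nl2 (\<xi> s) (w s + u s))) \<and>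
     fst (w t + u t) = fst (w 0 + u 0)
       + (LBINT s. orient t s *\<^sub>R (\<epsilon> *\<^sub>R (S *v fst (w s + u s)) + \<epsilon> *\<^sub>R nl1 (\<xi> s) (w s + u s))) \<and>
     snd (w t + u t) = snd (w 0 + u 0)
       + (LBINT s. orient t s *\<^sub>R (F *v snd (w s + u s) + nl2 (\<xi> s) (w s + u s)))"
    unfolding eq
  proof (intro conjI)
    show "integrable lborel (\<lambda>s. ?a s + ?c s)" "integrable lborel (\<lambda>s. ?b s + ?d s)"
      using 1(1) 2(1) 3 by (intro Bochner_Integration.integrable_add; blast)+
    show "fst (w t + u t) = fst (w 0 + u 0) + (LBINT s. ?a s + ?c s)"
      using 1 3 Bochner_Integration.integral_add[of lborel ?a ?c] by simp
    show "snd (w t + u t) = snd (w 0 + u 0) + (LBINT s. ?b s + ?d s)"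
      using 2 3 Bochner_Integration.integral_add[of lborel ?b ?d] by simp
  qed
qed

end

text \<open>The tracking point is \<open>z + u 0\<close> for the fixed point \<open>u\<close> of
  \<open>track\<close> along the orbit of \<open>z\<close>; it lies on the graph by the choice of
  the initial value of \<open>u\<close>, and the distance of the two orbits is \<open>u\<close>
  itself.\<close>

lemma graph_tracking:
  assumes \<rho>: "cs + cf + cf / (1 - (cs + cf)) * cs < 1" "cs + cf < 1" and \<xi>: "tame \<xi>"
  shows "\<exists>z'. snd z' = graph \<xi> (fst z') \<and> (\<forall>t\<ge>0. norm1 (flow \<xi> t z - flow \<xi> t z')
    \<le> norm1 (z - z') / (1 - (cs + cf)) * wt t)"
proof -
  let ?w = "\<lambda>t. flow \<xi> t z"
  have w: "?w \<in> borel_measurable borel"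
    using integral_curve_continuous[OF integral_curve_flow[OF \<xi>]]
    by (rule borel_measurable_continuous_onI)
  have w0: "?w 0 = z" by (rule flow_0[OF \<xi>])
  have curve: "integral_curve {0..} \<xi> (?w 0) ?w"
    using integral_curve_flow[OF \<xi>, of z] unfolding w0 integral_curve_def by blast
  obtain u where u: "u \<in> forward" "track \<xi> ?w u = u" using track_fixpoint[OF \<xi> w \<rho>] by blast
  define z' where "z' = z + u 0"
  have curve': "integral_curve {0..} \<xi> z' (\<lambda>t. flow \<xi> t z + u t)"
    using track_integral_curve[OF \<xi> w u curve] unfolding w0 z'_def .
  have "u 0 = (tslow \<xi> ?w u 0, graph \<xi> (fst z + tslow \<xi> ?w u 0) - snd z)"
    using track_0[OF \<xi> w, of u] unfolding u(2) w0 .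
  then have "snd z' = graph \<xi> (fst z')" by (simp add: z'_def)
  moreover have "norm1 (flow \<xi> t z - flow \<xi> t z') \<le> norm1 (z - z') / (1 - (cs + cf)) * wt t"
    if "t \<ge> 0" for t
  proof -
    have "flow \<xi> t z' = flow \<xi> t z + u t"
      by (rule flow_eq_on[OF \<xi> curve']) (use that in \<open>auto simp: closed_segment_eq_real_ivl\<close>)
    then have "norm1 (flow \<xi> t z - flow \<xi> t z') = norm1 (u t)" by (simp add: norm1_def)
    moreover have "norm1 (z - z') = norm1 (u 0)" by (simp add: z'_def norm1_def)
    ultimately show ?thesis using track_bound[OF \<xi> w \<rho>(2) u that] by simp
  qed
  ultimately show ?thesis by blast
qed

end


section \<open>Measurability of the stationary process\<close>

text \<open>Left-tagged sums on the equidistant partition of the interval from \<open>T\<close> to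
  \<open>0\<close> into \<open>Suc n\<close> pieces; \<open>T\<close> is negative, so the nodes
  increase. Each sum involves finitely many values of \<open>w\<close> and is therefore measurable
  in \<open>w\<close>.\<close>

definition riemann_stieltjes where
  "riemann_stieltjes G w T n = (\<Sum>i<Suc n. G (T - real i * T / real (Suc n)) *v
     (w (T - real (Suc i) * T / real (Suc n)) - w (T - real i * T / real (Suc n))))"

lemma stieltjes_integral_tendsto:
  assumes I: "has_stieltjes_integral G w T 0 I" and T: "T < 0"
  shows "(\<lambda>n. riemann_stieltjes G w T n) \<longlonglongrightarrow> I"
proof (rule metric_LIMSEQ_I)
  fix e :: real assume "e > 0"
  from I[unfolded has_stieltjes_integral_def, rule_format, OF this]
  obtain d where d: "d > 0 \<and> (\<forall>n (t :: nat \<Rightarrow> real) (\<tau> :: nat \<Rightarrow> real). t 0 = T \<and> t n = 0 \<and>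
      (\<forall>i<n. t i < t (Suc i) \<and> t (Suc i) - t i < d \<and> t i \<le> \<tau> i \<and> \<tau> i \<le> t (Suc i)) \<longrightarrow>
      norm ((\<Sum>i<n. G (\<tau> i) *v (w (t (Suc i)) - w (t i))) - I) < e)"
    by (rule exE)
  obtain N :: nat where N: "- T / d < real N" using reals_Archimedean2 by blast
  have "dist (riemann_stieltjes G w T n) I < e" if "n \<ge> N" for n
  proof -
    let ?t = "\<lambda>i. T - real i * T / real (Suc n)"
    have "- T / d < real (Suc n)" using N that by linarith
    then have mesh: "- T / real (Suc n) < d" using d by (simp add: field_simps)
    have step: "?t (Suc i) - ?t i = - T / real (Suc n)" for i
    proof -
      have "real (Suc i) * T / real (Suc n) = real i * T / real (Suc n) + T / real (Suc n)"
        by (simp add: add_divide_distrib distrib_right)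
      then show ?thesis by simp
    qed
    have pos: "0 < - T / real (Suc n)" using T by (intro divide_pos_pos) auto
    have "norm ((\<Sum>i<Suc n. G (?t i) *v (w (?t (Suc i)) - w (?t i))) - I) < e"
    proof (rule conjunct2[OF d, rule_format], intro conjI allI impI)
      show "?t i < ?t (Suc i)" "?t (Suc i) - ?t i < d" "?t i \<le> ?t i" "?t i \<le> ?t (Suc i)" for i
        using step[of i] mesh pos by linarith+
    qed simp_all
    then show ?thesis unfolding riemann_stieltjes_def dist_norm .
  qed
  then show "\<exists>N. \<forall>n\<ge>N. dist (riemann_stieltjes G w T n) I < e" by blast
qed

text \<open>An explicit iterated limit in place of the definite description: it shows that the
  integral is unique, and it is measurable in the path. The truncation points are
  \<open>- real (Suc k)\<close> because the proper integrals are only provided for strictly negative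
  \<open>T\<close>.\<close>

lemma ou_eq_lim:
  assumes "\<exists>I. has_ou_integral F w I"
  shows "ou F w = lim (\<lambda>k. lim (\<lambda>n. riemann_stieltjes (\<lambda>s. matrix_exp ((- s) *\<^sub>R F)) w (- real (Suc k)) n))"
proof -
  have eq: "lim (\<lambda>k. lim (\<lambda>n. riemann_stieltjes (\<lambda>s. matrix_exp ((- s) *\<^sub>R F)) w (- real (Suc k)) n)) = I"
    if I: "has_ou_integral F w I" for I
  proof -
    obtain J where J: "\<And>T. T < 0 \<Longrightarrow> has_stieltjes_integral (\<lambda>s. matrix_exp ((- s) *\<^sub>R F)) w T 0 (J T)"
      "(J \<longlongrightarrow> I) at_bot"
      using I unfolding has_ou_integral_def by blast
    have "lim (\<lambda>n. riemann_stieltjes (\<lambda>s. matrix_exp ((- s) *\<^sub>R F)) w (- real (Suc k)) n) = J (- real (Suc k))" for k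
      by (rule limI, rule stieltjes_integral_tendsto[OF J(1)]) simp_all
    moreover have "(\<lambda>k. J (- real (Suc k))) \<longlonglongrightarrow> I"
      by (rule filterlim_compose[OF J(2)], rule filterlim_compose[OF filterlim_uminus_at_bot_at_top],
          rule filterlim_compose[OF filterlim_real_sequentially filterlim_Suc])
    ultimately show ?thesis by (simp only: limI)
  qed
  obtain I where I: "has_ou_integral F w I" using assms by blast
  have "ou F w = I"
    unfolding ou_def
  proof (rule the_equality, rule I)
    fix I' assume "has_ou_integral F w I'"
    from eq[OF this] eq[OF I] show "I' = I" by (rule trans[OF sym])
  qed
  then show ?thesis using eq[OF I] by (simp only:)
qed

lemma wshift_wshift: "wshift t (wshift s w) = wshift (t + s) w"
  by (rule ext) (simp add: wshift_def add_ac)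

lemma borel_measurable_ou:
  assumes P: "\<And>t. (\<lambda>w. w t) \<in> borel_measurable P"
    and \<Omega>: "\<And>w. w \<in> space P \<Longrightarrow> w \<in> \<Omega> \<Longrightarrow> \<exists>I. has_ou_integral F w I"
  shows "(\<lambda>w. ou F w) \<in> borel_measurable (restrict_space P \<Omega>)"
proof -
  have [measurable]: "(\<lambda>w. w t) \<in> borel_measurable (restrict_space P \<Omega>)" for t
    by (rule measurable_restrict_space1[OF P])
  have "(\<lambda>w. riemann_stieltjes (\<lambda>s. matrix_exp ((- s) *\<^sub>R F)) w T n) \<in> borel_measurable (restrict_space P \<Omega>)" for T n
    unfolding riemann_stieltjes_def by measurable
  then have "(\<lambda>w. lim (\<lambda>k. lim (\<lambda>n. riemann_stieltjes (\<lambda>s. matrix_exp ((- s) *\<^sub>R F)) w (- real (Suc k)) n)))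
      \<in> borel_measurable (restrict_space P \<Omega>)"
    by (intro borel_measurable_lim_metric)
  then show ?thesis
    by (rule measurable_cong[THEN iffD1, rotated]) (auto simp: ou_eq_lim[OF \<Omega>] space_restrict_space)
qed

text \<open>Time is approximated from the right by grid points. For each grid the time takes
  countably many values, so joint measurability reduces to measurability at fixed times; right
  continuity gives the limit.\<close>

lemma jointly_measurable_right_continuous:
  fixes X :: "real \<Rightarrow> 'w \<Rightarrow> 'a::metric_space"
  assumes X [measurable]: "\<And>s. X s \<in> borel_measurable W"
    and right: "\<And>w s. w \<in> space W \<Longrightarrow> ((\<lambda>s. X s w) \<longlongrightarrow> X s w) (at_right s)"
  shows "(\<lambda>(s, w). X s w) \<in> borel_measurable (borel \<Otimes>\<^sub>M W)"
proof -
  \<comment> \<open>The summand \<open>1\<close> after the floor makes \<open>q n s\<close> strictly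
    larger than \<open>s\<close>, as the filter \<open>at_right s\<close> demands, also when
    \<open>s\<close> itself is a grid point.\<close>
  define q where "q n s = (real_of_int \<lfloor>s * real (Suc n)\<rfloor> + 1) / real (Suc n)" for n :: nat and s :: real
  have q: "s < q n s" "q n s \<le> s + 1 / real (Suc n)" for n s
  proof -
    have N: "0 < real (Suc n)" by simp
    have f: "s * real (Suc n) < real_of_int \<lfloor>s * real (Suc n)\<rfloor> + 1"
      "real_of_int \<lfloor>s * real (Suc n)\<rfloor> \<le> s * real (Suc n)" by linarith+
    show "s < q n s" unfolding q_def pos_less_divide_eq[OF N] by (rule f)
    have "q n s \<le> (s * real (Suc n) + 1) / real (Suc n)"
      unfolding q_def using f(2) by (intro divide_right_mono) auto
    also have "\<dots> = s + 1 / real (Suc n)" using N by (simp add: add_divide_distrib del: of_nat_Suc)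
    finally show "q n s \<le> s + 1 / real (Suc n)" .
  qed
  have q_lim: "filterlim (\<lambda>n. q n s) (at_right s) sequentially" for s
    unfolding filterlim_at
  proof (intro conjI)
    have "(\<lambda>n. s + 1 / real (Suc n)) \<longlonglongrightarrow> s + 0"
      by (intro tendsto_intros LIMSEQ_Suc[OF lim_1_over_n])
    then have lim: "(\<lambda>n. s + 1 / real (Suc n)) \<longlonglongrightarrow> s" by simp
    show "(\<lambda>n. q n s) \<longlonglongrightarrow> s"
    proof (rule tendsto_sandwich[OF _ _ tendsto_const lim])
      show "\<forall>\<^sub>F n in sequentially. s \<le> q n s"
        by (intro always_eventually allI less_imp_le q)
      show "\<forall>\<^sub>F n in sequentially. q n s \<le> s + 1 / real (Suc n)"
        by (intro always_eventually allI q)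
    qed
    have "q n s \<in> {s<..} \<and> q n s \<noteq> s" for n using q(1)[of s n] by simp
    then show "\<forall>\<^sub>F n in sequentially. q n s \<in> {s<..} \<and> q n s \<noteq> s"
      by (intro always_eventually allI)
  qed
  have m: "(\<lambda>p. X (q n (fst p)) (snd p)) \<in> borel_measurable (borel \<Otimes>\<^sub>M W)" for n
    unfolding q_def
  proof (rule measurable_compose_countable[where g = "\<lambda>p. \<lfloor>fst p * real (Suc n)\<rfloor>"
        and f = "\<lambda>k p. X ((real_of_int k + 1) / real (Suc n)) (snd p)"])
    show "(\<lambda>p. X ((real_of_int k + 1) / real (Suc n)) (snd p)) \<in> borel_measurable (borel \<Otimes>\<^sub>M W)" for k
      by measurable
    show "(\<lambda>p. \<lfloor>fst p * real (Suc n)\<rfloor>) \<in> measurable (borel \<Otimes>\<^sub>M W) (count_space UNIV)"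
      by measurable
  qed
  have "(\<lambda>p. X (fst p) (snd p)) \<in> borel_measurable (borel \<Otimes>\<^sub>M W)"
  proof (rule borel_measurable_LIMSEQ_metric[OF m])
    fix p :: "real \<times> 'w" assume "p \<in> space (borel \<Otimes>\<^sub>M W)"
    then have "snd p \<in> space W" by (auto simp: space_pair_measure)
    from filterlim_compose[OF right[OF this] q_lim]
    show "(\<lambda>n. X (q n (fst p)) (snd p)) \<longlonglongrightarrow> X (fst p) (snd p)" .
  qed
  then show ?thesis by (simp add: case_prod_beta')
qed

text \<open>One-sided limits give a bound near each point, and bounds on adjacent intervals combine;
  bisection in the form of \<open>Bolzano\<close> passes to the compact interval.\<close>

lemma cadlag_bounded:
  fixes f :: "real \<Rightarrow> 'a::real_normed_vector"
  assumes f: "cadlag f" and "a \<le> b"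
  shows "\<exists>B. \<forall>t\<in>{a..b}. norm (f t) \<le> B"
proof (rule Bolzano[where P = "\<lambda>a b. \<exists>B. \<forall>t\<in>{a..b}. norm (f t) \<le> B", OF \<open>a \<le> b\<close>])
  fix a b c :: real
  assume "\<exists>B. \<forall>t\<in>{a..b}. norm (f t) \<le> B" "\<exists>B. \<forall>t\<in>{b..c}. norm (f t) \<le> B"
  then obtain B C where B: "\<And>t. a \<le> t \<Longrightarrow> t \<le> b \<Longrightarrow> norm (f t) \<le> B" and C: "\<And>t. b \<le> t \<Longrightarrow> t \<le> c \<Longrightarrow> norm (f t) \<le> C"
    by (meson atLeastAtMost_iff)
  have "norm (f t) \<le> max B C" if "a \<le> t" "t \<le> c" for t
    using B[of t] C[of t] that by (cases "t \<le> b") auto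
  then show "\<exists>B. \<forall>t\<in>{a..c}. norm (f t) \<le> B" by (meson atLeastAtMost_iff)
next
  fix x :: real
  obtain l where r: "(f \<longlongrightarrow> f x) (at_right x)" and l: "(f \<longlongrightarrow> l) (at_left x)"
    using f unfolding cadlag_def by blast
  have "\<forall>\<^sub>F t in at_right x. norm (f t) < norm (f x) + 1"
    by (rule order_tendstoD(2)[OF tendsto_norm[OF r]]) simp
  moreover have "\<forall>\<^sub>F t in at_left x. norm (f t) < norm l + 1"
    by (rule order_tendstoD(2)[OF tendsto_norm[OF l]]) simp
  ultimately have "\<forall>\<^sub>F t in at x. norm (f t) < norm (f x) + norm l + 1"
    unfolding eventually_at_split using norm_ge_zero[of l] norm_ge_zero[of "f x"]
    by (auto elim!: eventually_mono intro: less_le_trans)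
  then obtain d where d: "d > 0" "\<And>t. t \<noteq> x \<Longrightarrow> dist t x < d \<Longrightarrow> norm (f t) < norm (f x) + norm l + 1"
    unfolding eventually_at by auto
  have "norm (f t) \<le> norm (f x) + norm l + 1" if "dist t x < d" for t
    using d(2)[OF _ that] norm_ge_zero[of l] by (cases "t = x") auto
  then show "\<exists>d>0. \<forall>a b. a \<le> x \<and> x \<le> b \<and> b - a < d \<longrightarrow> (\<exists>B. \<forall>t\<in>{a..b}. norm (f t) \<le> B)"
    using d(1) by (intro exI[of _ d]) (auto simp: dist_real_def intro!: exI[of _ "norm (f x) + norm l + 1"])
qed

lemma cadlag_sublinear_tame:
  fixes f :: "real \<Rightarrow> 'a::euclidean_space"
  assumes f: "cadlag f" and lim: "((\<lambda>t. (1 / t) *\<^sub>R f t) \<longlongrightarrow> 0) at_infinity"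
  shows "tame f"
  unfolding tame_def
proof (intro conjI allI impI)
  \<comment> \<open>Borel measurability of a single path is joint measurability over a one-point
    sample space.\<close>
  have "(\<lambda>(s, w :: unit). f s) \<in> borel_measurable (borel \<Otimes>\<^sub>M count_space UNIV)"
    using f by (intro jointly_measurable_right_continuous) (auto simp: cadlag_def)
  from measurable_Pair1[OF this, of "()"] show "f \<in> borel_measurable borel" by simp
  fix c :: real assume "c > 0"
  have "\<forall>\<^sub>F t in at_infinity. norm ((1 / t) *\<^sub>R f t) < 1"
    using order_tendstoD(2)[OF tendsto_norm[OF lim], of 1] by simp
  then obtain b where b: "\<And>t. b \<le> \<bar>t\<bar> \<Longrightarrow> norm ((1 / t) *\<^sub>R f t) < 1"
    unfolding eventually_at_infinity by auto
  obtain B where B: "\<And>t. - \<bar>b\<bar> \<le> t \<Longrightarrow> t \<le> \<bar>b\<bar> \<Longrightarrow> norm (f t) \<le> B"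
    using cadlag_bounded[OF f, of "- \<bar>b\<bar>" "\<bar>b\<bar>"] by (force simp only: atLeastAtMost_iff)
  have "0 \<le> B" using order_trans[OF norm_ge_zero B[of 0]] by simp
  have "norm (f t) \<le> ((B + 1) * (1 + 1 / c)) * exp (c * \<bar>t\<bar>)" for t
  proof -
    have "norm (f t) \<le> B + \<bar>t\<bar>"
    proof (cases "\<bar>t\<bar> \<le> \<bar>b\<bar>")
      case True
      then have "norm (f t) \<le> B" by (intro B) (auto simp: abs_le_iff)
      then show ?thesis by linarith
    next
      case False
      then have "norm (f t) / \<bar>t\<bar> < 1" "0 < \<bar>t\<bar>" using b[of t] by auto
      then show ?thesis using \<open>0 \<le> B\<close> by (simp add: field_simps)
    qed
    also have "\<dots> \<le> (B + 1) * (1 + \<bar>t\<bar>)" using \<open>0 \<le> B\<close> by (simp add: algebra_simps)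
    also have "\<dots> \<le> (B + 1) * ((1 + 1 / c) * exp (c * \<bar>t\<bar>))"
      using \<open>0 \<le> B\<close> exp_linear_bound[OF \<open>c > 0\<close>] by (intro mult_left_mono) auto
    finally show ?thesis by (simp only: mult.assoc)
  qed
  then show "\<exists>C. \<forall>t. norm (f t) \<le> C * exp (c * \<bar>t\<bar>)" by blast
qed

text \<open>The distance to the graph is an infimum over \<open>x\<close> of functions measurable in
  \<open>w\<close>. Continuity of \<open>h w\<close> allows \<open>x\<close> to be restricted to a
  countable dense set without changing the infimum.\<close>

lemma borel_measurable_infdist_graph:
  fixes h :: "'w \<Rightarrow> 'a::euclidean_space \<Rightarrow> 'b::euclidean_space"
  assumes h: "\<And>x. (\<lambda>w. h w x) \<in> borel_measurable W"
    and cont: "\<And>w. w \<in> space W \<Longrightarrow> continuous_on UNIV (h w)"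
  shows "(\<lambda>w. infdist z {(x, h w x) | x. True}) \<in> borel_measurable W"
proof -
  obtain D :: "'a set" where D: "countable D" "\<And>X. open X \<Longrightarrow> X \<noteq> {} \<Longrightarrow> \<exists>d\<in>D. d \<in> X"
    using countable_dense_setE by blast
  have "D \<noteq> {}" using D(2)[of UNIV] by auto
  have "(\<lambda>w. INF x\<in>D. dist z (x, h w x)) \<in> borel_measurable W"
  proof (rule borel_measurable_cINF[OF D(1)])
    fix x
    have "(\<lambda>w. (x, h w x)) \<in> borel_measurable W" using h by (intro borel_measurable_Pair) auto
    then show "(\<lambda>w. dist z (x, h w x)) \<in> borel_measurable W" by (intro borel_measurable_dist) auto
  qed (auto intro!: bdd_belowI2[of _ 0])
  moreover have "infdist z {(x, h w x) | x. True} = (INF x\<in>D. dist z (x, h w x))" if w: "w \<in> space W" for w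
  proof -
    let ?f = "\<lambda>x. dist z (x, h w x)"
    have bdd: "bdd_below (?f ` A)" for A by (intro bdd_belowI2[of _ 0]) auto
    have f: "continuous_on UNIV ?f" by (intro continuous_intros cont[OF w])
    have "infdist z {(x, h w x) | x. True} = (INF x. ?f x)"
      unfolding infdist_def by (auto simp: image_def intro!: arg_cong[where f = Inf])
    also have "\<dots> = (INF x\<in>D. ?f x)"
    proof (rule antisym)
      show "(INF x. ?f x) \<le> (INF x\<in>D. ?f x)"
        using \<open>D \<noteq> {}\<close> by (intro cINF_superset_mono bdd) auto
      show "(INF x\<in>D. ?f x) \<le> (INF x. ?f x)"
      proof (rule cINF_greatest)
        fix x
        show "(INF x\<in>D. ?f x) \<le> ?f x"
        proof (rule ccontr)
          assume "\<not> (INF x\<in>D. ?f x) \<le> ?f x"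
          then have "?f x < (INF x\<in>D. ?f x)" by (simp only: not_le)
          then have "open {y. ?f y < (INF x\<in>D. ?f x)}" "{y. ?f y < (INF x\<in>D. ?f x)} \<noteq> {}"
            by (auto intro!: open_Collect_less f continuous_on_const)
          from D(2)[OF this] obtain y where "y \<in> D" "?f y < (INF x\<in>D. ?f x)" by auto
          moreover have "(INF x\<in>D. ?f x) \<le> ?f y" by (rule cINF_lower[OF bdd \<open>y \<in> D\<close>])
          ultimately show False by linarith
        qed
      qed simp
    qed
    finally show ?thesis .
  qed
  ultimately show ?thesis by (simp cong: measurable_cong)
qed


section \<open>Slow manifold of the random system\<close>

lemma interval_integrable_lessThan:
  "interval_lebesgue_integrable lborel (- \<infinity>) (ereal t) f
    \<longleftrightarrow> integrable lborel (\<lambda>s. indicator {..<t} s *\<^sub>R f s)"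
  by (simp add: interval_lebesgue_integrable_def set_integrable_def)

lemma interval_integral_lessThan:
  "(LBINT s=-\<infinity>..ereal t. f s) = (LBINT s. indicator {..<t} s *\<^sub>R f s)"
  by (simp add: interval_lebesgue_integral_def set_lebesgue_integral_def)

lemma restrict_C_minus:
  fixes u :: "real \<Rightarrow> 'a::euclidean_space \<times> 'b::euclidean_space"
  assumes "continuous_on {..0} u"
  shows "restrict u {..0} \<in> C_minus \<gamma> \<longleftrightarrow> (\<exists>B. \<forall>t\<le>0. norm1 (u t) \<le> B * exp (- \<gamma> * t))"
proof
  assume "restrict u {..0} \<in> C_minus \<gamma>"
  then obtain B C where B: "\<And>t. t \<le> 0 \<Longrightarrow> norm (exp (\<gamma> * t) *\<^sub>R fst (u t)) \<le> B"
      and C: "\<And>t. t \<le> 0 \<Longrightarrow> norm (exp (\<gamma> * t) *\<^sub>R snd (u t)) \<le> C"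
    unfolding C_minus_def bdd_above_def by fastforce
  have "norm1 (u t) \<le> (B + C) * exp (- \<gamma> * t)" if "t \<le> 0" for t
  proof -
    have "exp (\<gamma> * t) * norm1 (u t) \<le> B + C"
      using B[OF that] C[OF that] by (simp add: norm1_def distrib_left)
    then have "exp (\<gamma> * t) * norm1 (u t) * exp (- \<gamma> * t) \<le> (B + C) * exp (- \<gamma> * t)"
      by (intro mult_right_mono) auto
    also have "exp (\<gamma> * t) * norm1 (u t) * exp (- \<gamma> * t) = norm1 (u t)" by (simp add: exp_minus)
    finally show ?thesis .
  qed
  then show "\<exists>B. \<forall>t\<le>0. norm1 (u t) \<le> B * exp (- \<gamma> * t)" by blast
next
  assume "\<exists>B. \<forall>t\<le>0. norm1 (u t) \<le> B * exp (- \<gamma> * t)"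
  then obtain B where B: "\<And>t. t \<le> 0 \<Longrightarrow> norm1 (u t) \<le> B * exp (- \<gamma> * t)" by blast
  have le: "exp (\<gamma> * t) * norm1 (u t) \<le> B" if "t \<le> 0" for t
  proof -
    have "exp (\<gamma> * t) * norm1 (u t) \<le> exp (\<gamma> * t) * (B * exp (- \<gamma> * t))"
      by (intro mult_left_mono B that) simp
    also have "\<dots> = B" by (simp add: exp_minus)
    finally show ?thesis .
  qed
  have "exp (\<gamma> * t) * norm (fst (u t)) \<le> B" "exp (\<gamma> * t) * norm (snd (u t)) \<le> B" if "t \<le> 0" for t
  proof -
    have "exp (\<gamma> * t) * norm (fst (u t)) \<le> exp (\<gamma> * t) * norm1 (u t)"
      "exp (\<gamma> * t) * norm (snd (u t)) \<le> exp (\<gamma> * t) * norm1 (u t)"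
      by (intro mult_left_mono; simp add: norm1_def)+
    then show "exp (\<gamma> * t) * norm (fst (u t)) \<le> B" "exp (\<gamma> * t) * norm (snd (u t)) \<le> B"
      using le[OF that] by linarith+
  qed
  then show "restrict u {..0} \<in> C_minus \<gamma>"
    unfolding C_minus_def using continuous_on_eq[OF assms, of "restrict u {..0}"]
    by (auto intro!: bdd_aboveI2[of _ _ B])
qed

context slow_fast
begin

text \<open>The continuity clause is automatic, since oriented integrals depend continuously on
  their upper limit.\<close>

lemma random_ode_solution_iff:
  "random_ode_solution S F g1 g2 \<sigma> \<epsilon> w z u
    \<longleftrightarrow> integral_curve UNIV (ou_path F w) z u"
proof -
  have "random_ode_solution S F g1 g2 \<sigma> \<epsilon> w z u
    \<longleftrightarrow> continuous_on UNIV u \<and> integral_curve UNIV (ou_path F w) z u"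
    unfolding random_ode_solution_def Let_def interval_integral_orient interval_integrable_orient
      integral_curve_iff nl1_def nl2_def by simp
  then show ?thesis using integral_curve_continuous by blast
qed

lemma random_ode_flow_eq:
  "random_ode_flow S F g1 g2 \<sigma> \<epsilon> t w z = flow (ou_path F w) t z"
  unfolding random_ode_flow_def flow_def random_ode_solution_iff ..

text \<open>Members of \<open>C_minus\<close> are \<open>undefined\<close> at positive times and
  members of \<open>backward\<close> are zero there. The densities see negative times only, so
  exchanging one for the other leaves all integrals unchanged; the integrability clauses hold
  throughout \<open>backward\<close>.\<close>

lemma integral_system_solution_iff:
  assumes "(\<lambda>t. if t \<le> 0 then u t else 0) \<in> backward" (is "?u \<in> _") and \<xi>: "tame (ou_path F w)"
  shows "integral_system_solution S F g1 g2 \<sigma> \<epsilon> w x0 u \<longleftrightarrow> lp (ou_path F w) x0 ?u = ?u"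
proof -
  let ?\<xi> = "ou_path F w"
  have 1: "orient t s *\<^sub>R (ES (t - s) *v nl1 (?\<xi> s) (?u s))
      = orient t s *\<^sub>R (ES (t - s) *v nl1 (?\<xi> s) (u s))" if "t \<le> 0" for t s
    using that orient_nonzero[of t s] by (cases "orient t s = 0") auto
  have 2: "indicator {..<t} s *\<^sub>R (EF (t - s) *v nl2 (?\<xi> s) (?u s))
      = indicator {..<t} s *\<^sub>R (EF (t - s) *v nl2 (?\<xi> s) (u s))" if "t \<le> 0" for t s
    using that by (cases "s < t") auto
  have "integral_system_solution S F g1 g2 \<sigma> \<epsilon> w x0 u \<longleftrightarrow> (\<forall>t\<le>0. lp ?\<xi> x0 ?u t = u t)"
    (is "_ \<longleftrightarrow> (\<forall>t\<le>0. ?Q t)")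
  proof -
    have "interval_lebesgue_integrable lborel 0 (ereal t)
        (\<lambda>s. ES (t - s) *v g1 (fst (u s)) (snd (u s) + \<sigma> *\<^sub>R ?\<xi> s)) \<and>
      interval_lebesgue_integrable lborel (-\<infinity>) (ereal t)
        (\<lambda>s. EF (t - s) *v g2 (fst (u s)) (snd (u s) + \<sigma> *\<^sub>R ?\<xi> s)) \<and>
      fst (u t) = ES t *v x0 + \<epsilon> *\<^sub>R (LBINT s=0..ereal t.
        ES (t - s) *v g1 (fst (u s)) (snd (u s) + \<sigma> *\<^sub>R ?\<xi> s)) \<and>
      snd (u t) = (LBINT s=-\<infinity>..ereal t.
        EF (t - s) *v g2 (fst (u s)) (snd (u s) + \<sigma> *\<^sub>R ?\<xi> s)) \<longleftrightarrow> ?Q t" if t: "t \<le> 0" for t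
    proof -
      have "integrable lborel (\<lambda>s. orient t s *\<^sub>R (ES (t - s) *v nl1 (?\<xi> s) (u s)))"
        "integrable lborel (\<lambda>s. indicator {..<t} s *\<^sub>R (EF (t - s) *v nl2 (?\<xi> s) (u s)))"
        using backward_integrable(1,2)[OF \<xi> assms(1) t] unfolding 1[OF t] 2[OF t] .
      moreover have "?Q t \<longleftrightarrow> fst (u t) = ES t *v x0 + \<epsilon> *\<^sub>R (\<integral>s.
          orient t s *\<^sub>R (ES (t - s) *v nl1 (?\<xi> s) (u s)) \<partial>lborel) \<and>
        snd (u t) = (LBINT s. indicator {..<t} s *\<^sub>R (EF (t - s) *v nl2 (?\<xi> s) (u s)))"
        unfolding lp_def if_P[OF t] 1[OF t] 2[OF t] prod_eq_iff fst_conv snd_conv by (simp only: eq_commute)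
      ultimately show ?thesis
        unfolding interval_integral_orient interval_integrable_orient interval_integrable_lessThan
          interval_integral_lessThan nl1_def nl2_def
        by blast
    qed
    then show ?thesis unfolding integral_system_solution_def Let_def by blast
  qed
  also have "\<dots> \<longleftrightarrow> lp ?\<xi> x0 ?u = ?u"
  proof
    assume Q: "\<forall>t\<le>0. ?Q t"
    show "lp ?\<xi> x0 ?u = ?u"
    proof
      fix t show "lp ?\<xi> x0 ?u t = ?u t"
      proof (cases "t \<le> 0")
        case True
        then show ?thesis using Q by (simp only: if_True)
      qed (simp add: lp_def)
    qed
  next
    assume "lp ?\<xi> x0 ?u = ?u"
    then show "\<forall>t\<le>0. ?Q t" by (metis (mono_tags, lifting))
  qed
  finally show ?thesis .
qed

lemma C_minus_cut:
  assumes "u \<in> C_minus \<gamma>"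
  shows "(\<lambda>t. if t \<le> 0 then u t else 0) \<in> backward" "restrict u {..0} = u"
proof -
  have u: "continuous_on {..0} u" "u \<in> extensional {..0}" using assms by (simp_all add: C_minus_def)
  show *: "restrict u {..0} = u" using u(2) by (rule extensional_restrict)
  then obtain B where "\<And>t. t \<le> 0 \<Longrightarrow> norm1 (u t) \<le> B * exp (- \<gamma> * t)"
    using assms restrict_C_minus[OF u(1), of \<gamma>] by auto
  then show "(\<lambda>t. if t \<le> 0 then u t else 0) \<in> backward" by (rule cut_backward[OF u(1)])
qed

text \<open>In this form existence, uniqueness and the value of the definite description in
  \<open>integral_system_path\<close> all follow by rewriting.\<close>

lemma integral_system_unique:
  assumes \<rho>: "cs + cf < 1" and \<xi>: "tame (ou_path F w)"
  shows "u \<in> C_minus \<gamma> \<and> integral_system_solution S F g1 g2 \<sigma> \<epsilon> w x0 u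
    \<longleftrightarrow> u = restrict (lpsol (ou_path F w) x0) {..0}"
proof -
  let ?\<xi> = "ou_path F w"
  let ?l = "lpsol ?\<xi> x0"
  note l = lpsol[OF \<rho> \<xi>, of x0]
  have cut: "(\<lambda>t. if t \<le> 0 then restrict ?l {..0} t else 0) = ?l"
    using wspace_outside[OF l(1)] by (auto simp: fun_eq_iff)
  have cont: "continuous_on {..0} ?l"
    by (rule integral_curve_continuous[OF lp_integral_curve[OF \<xi> l(1,2)]])
  obtain B where "\<And>t. norm1 (?l t) \<le> B * exp (- \<gamma> * t)" using wspace_bound[OF l(1)] by blast
  then have "restrict ?l {..0} \<in> C_minus \<gamma>" using restrict_C_minus[OF cont] by blast
  moreover have "integral_system_solution S F g1 g2 \<sigma> \<epsilon> w x0 (restrict ?l {..0})"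
    using integral_system_solution_iff[of "restrict ?l {..0}" w x0] l(1,2) \<xi> unfolding cut by blast
  moreover have "u = restrict ?l {..0}"
    if u: "u \<in> C_minus \<gamma>" "integral_system_solution S F g1 g2 \<sigma> \<epsilon> w x0 u"
  proof -
    have "?l = (\<lambda>t. if t \<le> 0 then u t else 0)"
      using integral_system_solution_iff[OF C_minus_cut(1)[OF u(1)] \<xi>] u(2)
      by (intro lpsol_eq[OF \<rho> \<xi> C_minus_cut(1)[OF u(1)]]) blast
    then have "restrict ?l {..0} = restrict u {..0}" by (simp add: restrict_def fun_eq_iff)
    then show ?thesis using C_minus_cut(2)[OF u(1)] by simp
  qed
  ultimately show ?thesis by blast
qed

lemma slow_graph_eq:
  assumes \<rho>: "cs + cf < 1" and \<xi>: "tame (ou_path F w)"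
  shows "slow_graph S F g1 g2 \<gamma> \<sigma> \<epsilon> w x0 = graph (ou_path F w) x0"
proof -
  let ?\<xi> = "ou_path F w"
  let ?l = "lpsol ?\<xi> x0"
  have path: "integral_system_path S F g1 g2 \<gamma> \<sigma> \<epsilon> w x0 = restrict ?l {..0}"
    unfolding integral_system_path_def integral_system_unique[OF \<rho> \<xi>] by simp
  have "graph ?\<xi> x0 = snd (lp ?\<xi> x0 ?l 0)"
    using lpsol(2)[OF \<rho> \<xi>, of x0] by (simp add: graph_def)
  also have "\<dots> = (LBINT s. indicator {..<0} s *\<^sub>R (EF (- s) *v nl2 (?\<xi> s) (?l s)))"
    by (simp add: lp_def)
  also have "\<dots> = (LBINT s. indicator {..<0} s *\<^sub>R (EF (- s) *v nl2 (?\<xi> s) (restrict ?l {..0} s)))"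
    by (intro Bochner_Integration.integral_cong) (auto simp: indicator_def)
  also have "\<dots> = slow_graph S F g1 g2 \<gamma> \<sigma> \<epsilon> w x0"
    unfolding slow_graph_def path Let_def nl2_def
    by (simp add: interval_lebesgue_integral_def set_lebesgue_integral_def zero_ereal_def)
  finally show ?thesis by (rule sym)
qed

lemma slow_set_eq:
  assumes \<rho>: "cs + cf < 1" and \<xi>: "tame (ou_path F w)"
  shows "slow_set S F g1 g2 \<gamma> \<sigma> \<epsilon> w = {z. snd z = graph (ou_path F w) (fst z)}"
proof -
  let ?\<xi> = "ou_path F w"
  have "continuous_on {..0} (\<lambda>t. flow ?\<xi> t z)" for z
    by (rule continuous_on_subset[OF integral_curve_continuous[OF integral_curve_flow[OF \<xi>]]]) simp
  note c = restrict_C_minus[OF this, where \<gamma> = \<gamma>]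
  show ?thesis
    unfolding slow_set_def random_ode_flow_eq c graph_iff[OF \<rho> \<xi>] ..
qed

section \<open>Joint measurability of the flow and of the graph map\<close>

context
  fixes W :: "'w measure" and \<Xi> :: "'w \<Rightarrow> real \<Rightarrow> real ^ 'm"
  assumes \<Xi>: "(\<lambda>(s, w). \<Xi> w s) \<in> borel_measurable (borel \<Otimes>\<^sub>M W)"
    and \<Xi>_tame: "\<And>w. w \<in> space W \<Longrightarrow> tame (\<Xi> w)"
begin

lemma path_measurable:
  assumes [measurable]: "f \<in> borel_measurable N" "g \<in> measurable N W"
  shows "(\<lambda>x. \<Xi> (g x) (f x)) \<in> borel_measurable N"
  using measurable_compose[OF measurable_Pair[OF assms] \<Xi>] by simp

text \<open>Induction on the Picard iterates, each an integral with measurable parameters of the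
  previous one. The induction must be joint in time, path and initial value, since the integration
  variable takes the place of time.\<close>

lemma flow_measurable:
  "(\<lambda>(t, w, z). flow (\<Xi> w) t z) \<in> borel_measurable (borel \<Otimes>\<^sub>M W \<Otimes>\<^sub>M borel)"
proof -
  let ?N = "borel \<Otimes>\<^sub>M W \<Otimes>\<^sub>M borel :: (real \<times> 'w \<times> (real ^ 'n) \<times> (real ^ 'm)) measure"
  define U where "U n p = (picard (\<Xi> (fst (snd p))) (snd (snd p)) ^^ n) (\<lambda>_. 0) (fst p)"
    for n and p :: "real \<times> 'w \<times> (real ^ 'n) \<times> (real ^ 'm)"
  have U_Suc: "U (Suc n) p = snd (snd p)
      + (LBINT s. orient (fst p) s *\<^sub>R field (\<Xi> (fst (snd p)) s) (U n (s, snd p)))" for n p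
    by (simp add: U_def picard_def)
  have "U n \<in> borel_measurable ?N" for n
  proof (induction n)
    case 0
    then show ?case by (simp add: U_def)
  next
    case (Suc n)
    \<comment> \<open>Substitutes the integration variable for the time slot while path and initial
      value are kept.\<close>
    have 1: "(\<lambda>q. (snd q, snd (fst q))) \<in> measurable (?N \<Otimes>\<^sub>M lborel) ?N" by measurable
    have [measurable]: "(\<lambda>q. U n (snd q, snd (fst q))) \<in> borel_measurable (?N \<Otimes>\<^sub>M lborel)"
      by (rule measurable_compose[OF 1 Suc])
    have [measurable]: "(\<lambda>q. \<Xi> (fst (snd (fst q))) (snd q)) \<in> borel_measurable (?N \<Otimes>\<^sub>M lborel)"
      by (rule path_measurable) measurable
    have "(\<lambda>p. LBINT s. orient (fst p) s *\<^sub>R field (\<Xi> (fst (snd p)) s) (U n (s, snd p))) \<in> borel_measurable ?N"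
      by (rule lborel.borel_measurable_lebesgue_integral) (simp add: case_prod_beta')
    then show ?case unfolding U_Suc[abs_def] by (intro borel_measurable_add) measurable
  qed
  then have "(\<lambda>p. flow (\<Xi> (fst (snd p))) (fst p) (snd (snd p))) \<in> borel_measurable ?N"
  proof (rule borel_measurable_LIMSEQ_metric)
    fix p assume "p \<in> space ?N"
    then have "fst (snd p) \<in> space W" by (auto simp: space_pair_measure)
    from picard_tendsto_flow[OF \<Xi>_tame[OF this]]
    show "(\<lambda>n. U n p) \<longlonglongrightarrow> flow (\<Xi> (fst (snd p))) (fst p) (snd (snd p))" by (simp add: U_def)
  qed
  then show ?thesis by (simp add: case_prod_beta')
qed

text \<open>The same induction for the iterates of \<open>lp\<close> with \<open>x0\<close> fixed;
  time must still be carried along and is set to \<open>0\<close> only in the limit.\<close>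

lemma graph_measurable:
  assumes \<rho>: "cs + cf < 1"
  shows "(\<lambda>w. graph (\<Xi> w) x0) \<in> borel_measurable W"
proof -
  define U where "U n p = (lp (\<Xi> (snd p)) x0 ^^ n) (\<lambda>_. 0) (fst p)" for n and p :: "real \<times> 'w"
  have ind: "indicator {..<t} s = (if s < t then 1 else 0 :: real)" for s t :: real by simp
  have U_Suc: "U (Suc n) p = (if fst p \<le> 0 then
     (ES (fst p) *v x0
        + \<epsilon> *\<^sub>R (LBINT s. orient (fst p) s *\<^sub>R (ES (fst p - s) *v nl1 (\<Xi> (snd p) s) (U n (s, snd p)))),
      LBINT s. (if s < fst p then 1 else 0) *\<^sub>R (EF (fst p - s) *v nl2 (\<Xi> (snd p) s) (U n (s, snd p)))) else 0)" for n p
    by (simp add: U_def lp_def ind del: indicator_simps)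
  have m: "U n \<in> borel_measurable (borel \<Otimes>\<^sub>M W)" for n
  proof (induction n)
    case 0
    then show ?case by (simp add: U_def)
  next
    case (Suc n)
    let ?N = "borel \<Otimes>\<^sub>M W :: (real \<times> 'w) measure"
    have 1: "(\<lambda>q. (snd q, snd (fst q))) \<in> measurable (?N \<Otimes>\<^sub>M lborel) ?N" by measurable
    have [measurable]: "(\<lambda>q. U n (snd q, snd (fst q))) \<in> borel_measurable (?N \<Otimes>\<^sub>M lborel)"
      by (rule measurable_compose[OF 1 Suc])
    have [measurable]: "(\<lambda>q. \<Xi> (snd (fst q)) (snd q)) \<in> borel_measurable (?N \<Otimes>\<^sub>M lborel)"
      by (rule path_measurable) measurable
    have [measurable]: "(\<lambda>p. LBINT s. orient (fst p) s *\<^sub>R (ES (fst p - s) *v nl1 (\<Xi> (snd p) s) (U n (s, snd p)))) \<in> borel_measurable ?N"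
      by (rule lborel.borel_measurable_lebesgue_integral) (simp add: case_prod_beta')
    have [measurable]: "(\<lambda>p. LBINT s. (if s < fst p then 1 else 0) *\<^sub>R (EF (fst p - s) *v nl2 (\<Xi> (snd p) s) (U n (s, snd p)))) \<in> borel_measurable ?N"
      by (rule lborel.borel_measurable_lebesgue_integral) (simp add: case_prod_beta')
    show ?case unfolding U_Suc[abs_def] by (intro measurable_If borel_measurable_Pair) measurable
  qed
  have "(\<lambda>w. lpsol (\<Xi> w) x0 0) \<in> borel_measurable W"
  proof (rule borel_measurable_LIMSEQ_metric)
    show "(\<lambda>w. U n (0, w)) \<in> borel_measurable W" for n
      by (rule measurable_compose[OF _ m]) measurable
    fix w assume "w \<in> space W"
    from lpsol(3)[OF \<rho> \<Xi>_tame[OF this]] show "(\<lambda>n. U n (0, w)) \<longlonglongrightarrow> lpsol (\<Xi> w) x0 0"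
      by (simp add: U_def)
  qed
  then show ?thesis unfolding graph_def by (rule borel_measurable_snd_pair)
qed

end

section \<open>Assembly of the slow manifold from the pathwise results\<close>

lemma ex1_random_ode_solution:
  assumes "tame (ou_path F w)"
  shows "\<exists>!u. random_ode_solution S F g1 g2 \<sigma> \<epsilon> w z u"
  unfolding random_ode_solution_iff
proof (rule ex_ex1I)
  show "\<exists>u. integral_curve UNIV (ou_path F w) z u"
    using integral_curve_flow[OF assms] by blast
  show "u = v" if "integral_curve UNIV (ou_path F w) z u"
    "integral_curve UNIV (ou_path F w) z v" for u v
    by (rule ext, rule integral_curve_unique[OF that]) simp
qed

lemma integral_system_flow:
  assumes \<rho>: "cs + cf < 1" and \<xi>: "tame (ou_path F w)"
    and u: "u \<in> C_minus \<gamma>" "integral_system_solution S F g1 g2 \<sigma> \<epsilon> w x0 u"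
  shows "\<exists>y0. u 0 = (x0, y0) \<and> (\<forall>t\<le>0. u t = random_ode_flow S F g1 g2 \<sigma> \<epsilon> t w (x0, y0))"
proof -
  let ?\<xi> = "ou_path F w"
  have u_eq: "u = restrict (lpsol ?\<xi> x0) {..0}"
    using u integral_system_unique[OF \<rho> \<xi>] by blast
  have 0: "lpsol ?\<xi> x0 0 = (x0, graph ?\<xi> x0)" by (rule lpsol_0[OF \<rho> \<xi>])
  have curve: "integral_curve {..0} ?\<xi> (x0, graph ?\<xi> x0) (lpsol ?\<xi> x0)"
    using lp_integral_curve[OF \<xi> lpsol(1,2)[OF \<rho> \<xi>, of x0]] unfolding 0 .
  have "u t = random_ode_flow S F g1 g2 \<sigma> \<epsilon> t w (x0, graph ?\<xi> x0)" if "t \<le> 0" for t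
  proof -
    have "flow ?\<xi> t (x0, graph ?\<xi> x0) = lpsol ?\<xi> x0 t"
      by (rule flow_eq_on[OF \<xi> curve])
         (use that in \<open>auto simp: closed_segment_eq_real_ivl split: if_splits\<close>)
    then show ?thesis unfolding u_eq random_ode_flow_eq using that by simp
  qed
  moreover have "u 0 = (x0, graph ?\<xi> x0)" unfolding u_eq using 0 by simp
  ultimately show ?thesis by blast
qed

lemma slow_graph_lipschitz:
  assumes \<rho>: "cs + cf < 1" and \<xi>: "tame (ou_path F w)"
  shows "(- K / ((\<gamma> + \<gamma>f) * (1 - slow_rho K \<gamma> \<gamma>s \<gamma>f \<epsilon>)))-lipschitz_on UNIV
    (slow_graph S F g1 g2 \<gamma> \<sigma> \<epsilon> w)"
proof -
  have "- K / ((\<gamma> + \<gamma>f) * (1 - slow_rho K \<gamma> \<gamma>s \<gamma>f \<epsilon>)) = cf / (1 - (cs + cf))"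
    unfolding slow_rho_eq cf_def by (rule divide_divide_eq_left[symmetric])
  moreover have "(cf / (1 - (cs + cf)))-lipschitz_on UNIV (slow_graph S F g1 g2 \<gamma> \<sigma> \<epsilon> w)"
    by (rule lipschitz_onI) (use graph_lipschitz[OF \<rho> \<xi>] \<rho> cf_pos in
        \<open>simp_all add: slow_graph_eq[OF \<rho> \<xi>] dist_norm\<close>)
  ultimately show ?thesis by simp
qed

lemma slow_set_graph:
  assumes \<rho>: "cs + cf < 1" and \<xi>: "tame (ou_path F w)"
  shows "slow_set S F g1 g2 \<gamma> \<sigma> \<epsilon> w = {(x0, slow_graph S F g1 g2 \<gamma> \<sigma> \<epsilon> w x0) | x0. True}"
  unfolding slow_set_eq[OF \<rho> \<xi>] slow_graph_eq[OF \<rho> \<xi>] by force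

lemma ou_shift_path: "(\<lambda>r. ou F (wshift r (wshift t w))) = (\<lambda>r. ou F (wshift (r + t) w))"
  by (simp add: wshift_wshift)

lemma slow_manifold_system:
  assumes \<rho>: "cs + cf + cf / (1 - (cs + cf)) * cs < 1" "cs + cf < 1"
    and meas: "(\<lambda>(s, w). ou F (wshift s w)) \<in> borel_measurable (borel \<Otimes>\<^sub>M W)"
    and \<xi>: "\<And>w. w \<in> space W \<Longrightarrow> tame (ou_path F w)"
    and inv: "\<And>t w. w \<in> space W \<Longrightarrow> wshift t w \<in> space W"
  shows "random_dynamical_system W wshift (random_ode_flow S F g1 g2 \<sigma> \<epsilon>)"
    and "slow_manifold W wshift (random_ode_flow S F g1 g2 \<sigma> \<epsilon>) (slow_set S F g1 g2 \<gamma> \<sigma> \<epsilon>)"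
proof -
  let ?\<phi> = "random_ode_flow S F g1 g2 \<sigma> \<epsilon>" and ?M = "slow_set S F g1 g2 \<gamma> \<sigma> \<epsilon>"
  let ?h = "\<lambda>w. graph (ou_path F w)"
  show "random_dynamical_system W wshift ?\<phi>"
    unfolding random_dynamical_system_def random_ode_flow_eq
  proof (intro conjI ballI allI)
    show "(\<lambda>(t, w, z). flow (ou_path F w) t z) \<in> borel_measurable (borel \<Otimes>\<^sub>M W \<Otimes>\<^sub>M borel)"
      by (rule flow_measurable[OF meas \<xi>])
    fix w assume w: "w \<in> space W"
    show "flow (ou_path F w) 0 z = z" for z by (rule flow_0[OF \<xi>[OF w]])
    show "flow (ou_path F w) (t + s) z
        = flow (\<lambda>r. ou F (wshift r (wshift s w))) t (flow (ou_path F w) s z)" for t s z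
      unfolding ou_shift_path by (rule flow_cocycle[OF \<xi>[OF w]])
  qed
  have h_lip: "(cf / (1 - (cs + cf)))-lipschitz_on UNIV (?h w)" if "w \<in> space W" for w
    by (rule lipschitz_onI)
       (use graph_lipschitz[OF \<rho>(2) \<xi>[OF that]] \<rho> cf_pos in \<open>simp_all add: dist_norm\<close>)
  then have h_cont: "continuous_on UNIV (?h w)" if "w \<in> space W" for w
    using that by (blast intro: lipschitz_on_continuous_on)
  have h_meas: "(\<lambda>w. ?h w x) \<in> borel_measurable W" for x
    by (rule graph_measurable[OF meas \<xi> \<rho>(2)])
  have M: "?M w = {(x, ?h w x) | x. True}" if "w \<in> space W" for w
    unfolding slow_set_eq[OF \<rho>(2) \<xi>[OF that]] by force
  have rset: "random_set W ?M"
    unfolding random_set_def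
  proof (intro conjI ballI allI)
    fix w assume w: "w \<in> space W"
    show "?M w \<noteq> {}" unfolding M[OF w] by blast
    show "closed (?M w)"
      unfolding slow_set_eq[OF \<rho>(2) \<xi>[OF w]]
      by (intro closed_Collect_eq continuous_intros continuous_on_compose2[OF h_cont[OF w]]) auto
  next
    fix z
    have "(\<lambda>w. infdist z {(x, ?h w x) | x. True}) \<in> borel_measurable W"
      by (rule borel_measurable_infdist_graph[OF h_meas h_cont])
    then show "(\<lambda>w. infdist z (?M w)) \<in> borel_measurable W"
      by (rule measurable_cong[THEN iffD1, rotated]) (simp only: M)
  qed
  have invariant: "?\<phi> t w ` ?M w \<subseteq> ?M (wshift t w)" if w: "w \<in> space W" for t w
    unfolding slow_set_eq[OF \<rho>(2) \<xi>[OF w]] slow_set_eq[OF \<rho>(2) \<xi>[OF inv[OF w]]] random_ode_flow_eq ou_shift_path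
    using graph_invariant[OF \<rho>(2) \<xi>[OF w]] by blast
  have manifold: "lipschitz_invariant_manifold W wshift ?\<phi> ?M"
    unfolding lipschitz_invariant_manifold_def
    using rset invariant M h_lip h_meas by (intro conjI exI[of _ ?h]) blast+
  have tracking: "exponential_tracking W ?\<phi> ?M"
    unfolding exponential_tracking_def
  proof (intro exI conjI allI ballI)
    \<comment> \<open>The tracking rate is the exponent of the weight. The random constant can be
      taken deterministic: \<open>1 / (1 - \<rho>)\<close> from \<open>track_bound\<close>, times 2
      for the passage from \<open>norm1\<close> to the Euclidean norm.\<close>
    show "0 < \<gamma>" by (rule \<gamma>_pos)
    show "(\<lambda>_. 2 / (1 - (cs + cf))) \<in> borel_measurable W" by simp
    show "0 < 2 / (1 - (cs + cf))" using \<rho>(2) by simp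
    fix w z assume w: "w \<in> space W"
    obtain z' where z': "snd z' = ?h w (fst z')"
      "\<And>t. t \<ge> 0 \<Longrightarrow> norm1 (flow (ou_path F w) t z - flow (ou_path F w) t z')
        \<le> norm1 (z - z') / (1 - (cs + cf)) * exp (- \<gamma> * t)"
      using graph_tracking[OF \<rho> \<xi>[OF w], of z] by blast
    have "norm (?\<phi> t w z - ?\<phi> t w z') \<le> 2 / (1 - (cs + cf)) * exp (- \<gamma> * t) * norm (z - z')"
      if t: "t \<ge> 0" for t
    proof -
      have "norm (?\<phi> t w z - ?\<phi> t w z') \<le> norm1 (z - z') / (1 - (cs + cf)) * exp (- \<gamma> * t)"
        unfolding random_ode_flow_eq by (rule order_trans[OF norm_le_norm1 z'(2)[OF t]])
      also have "\<dots> \<le> 2 * norm (z - z') / (1 - (cs + cf)) * exp (- \<gamma> * t)"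
        using \<rho>(2) by (intro mult_right_mono divide_right_mono norm1_le_norm) auto
      finally show ?thesis by (simp add: mult_ac)
    qed
    moreover have "z' \<in> ?M w" unfolding slow_set_eq[OF \<rho>(2) \<xi>[OF w]] using z'(1) by blast
    ultimately show "\<exists>z'\<in>?M w. \<forall>t\<ge>0. norm (?\<phi> t w z - ?\<phi> t w z')
        \<le> 2 / (1 - (cs + cf)) * exp (- \<gamma> * t) * norm (z - z')" by blast
  qed
  show "slow_manifold W wshift ?\<phi> ?M"
    unfolding slow_manifold_def using manifold tracking by blast
qed

end

text \<open>With \<eta> = 1 - k the hypothesis gives c < \<eta> / 2, so the denominator exceeds
  \<eta> / 2. The two terms containing c then add up to at most c (2 - \<eta>) / \<eta>, which is
  below \<eta> because 2 c < \<eta> \<eta>. This is the origin of the square and of the factor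
  1/2.\<close>

lemma small_parameter:
  fixes c k :: real
  assumes "0 < k" "k < 1" "0 < c" "c < (1 - k)\<^sup>2 / 2"
  shows "c + k < 1" "c + k + k / (1 - (c + k)) * c < 1"
proof -
  define \<eta> where "\<eta> = 1 - k"
  have \<eta>: "0 < \<eta>" "\<eta> < 1" "k = 1 - \<eta>" using assms by (auto simp: \<eta>_def)
  have c: "c < \<eta> * \<eta> / 2" using assms by (simp add: \<eta>_def power2_eq_square)
  have "\<eta> * \<eta> \<le> \<eta> * 1" using \<eta> by (intro mult_left_mono) auto
  then have c2: "c < \<eta> / 2" using c by linarith
  then show "c + k < 1" using \<eta> by linarith
  have den: "\<eta> / 2 < 1 - (c + k)" using c2 \<eta> by linarith
  then have "k / (1 - (c + k)) \<le> k / (\<eta> / 2)"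
    using \<eta> assms by (intro divide_left_mono mult_pos_pos) auto
  then have "k / (1 - (c + k)) * c \<le> k / (\<eta> / 2) * c"
    using assms by (intro mult_right_mono) auto
  moreover have "c + k / (\<eta> / 2) * c = c * ((2 - \<eta>) / \<eta>)"
    using \<eta>(1) unfolding \<eta>(3) by (simp add: field_simps)
  moreover have "c * ((2 - \<eta>) / \<eta>) < \<eta>"
  proof -
    have "c * (2 - \<eta>) \<le> c * 2" using \<eta> assms by (intro mult_left_mono) auto
    also have "\<dots> < \<eta> * \<eta>" using c by linarith
    finally show ?thesis using \<eta> by (simp add: divide_less_eq)
  qed
  ultimately show "c + k + k / (1 - (c + k)) * c < 1" using \<eta> by linarith
qed

theorem theorem4:
  fixes S :: "real ^ 'n ^ 'n" and F :: "real ^ 'm ^ 'm"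
    and g1 :: "real ^ 'n \<Rightarrow> real ^ 'm \<Rightarrow> real ^ 'n"
    and g2 :: "real ^ 'n \<Rightarrow> real ^ 'm \<Rightarrow> real ^ 'm"
    and \<sigma> \<alpha> \<gamma>s \<gamma>f K \<gamma> :: real
    and P :: "(real \<Rightarrow> real ^ 'm) measure" and \<Omega> :: "(real \<Rightarrow> real ^ 'm) set"
  assumes \<sigma>: "\<sigma> > 0" and \<alpha>: "1 < \<alpha>" "\<alpha> < 2"
    and S_spec: "\<And>l. complex_eigenvalue S l \<Longrightarrow> Re l \<ge> 0"
    and F_spec: "\<And>l. complex_eigenvalue F l \<Longrightarrow> Re l < 0"
    and g_zero: "g1 0 0 = 0" "g2 0 0 = 0"
    and A1_signs: "\<gamma>s > 0" "\<gamma>f < 0"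
    and A1_S: "\<And>t x. t \<le> 0 \<Longrightarrow> norm (matrix_exp (t *\<^sub>R S) *v x) \<le> exp (\<gamma>s * t) * norm x"
    and A1_F: "\<And>t y. t \<ge> 0 \<Longrightarrow> norm (matrix_exp (t *\<^sub>R F) *v y) \<le> exp (\<gamma>f * t) * norm y"
    and A2_pos: "K > 0"
    and A2_1: "\<And>x1 y1 x2 y2. norm (g1 x1 y1 - g1 x2 y2) \<le> K * (norm (x1 - x2) + norm (y1 - y2))"
    and A2_2: "\<And>x1 y1 x2 y2. norm (g2 x1 y1 - g2 x2 y2) \<le> K * (norm (x1 - x2) + norm (y1 - y2))"
    and A3: "K < - \<gamma>f"
    and \<gamma>: "\<gamma> > 0" "K < - (\<gamma> + \<gamma>f)"
    and P_sets: "sets P = sets skorokhod_borel"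
    and P_levy: "two_sided_stable_levy \<alpha> P (\<lambda>t w. w t)"
    and P_shift: "\<And>t. wshift t \<in> measurable P P" "\<And>t. distr P P (wshift t) = P"
    and \<Omega>_full: "\<Omega> \<in> sets P" "measure P \<Omega> = 1"
    and \<Omega>_inv: "\<And>t w. w \<in> \<Omega> \<Longrightarrow> wshift t w \<in> \<Omega>"
    and \<Omega>_xi: "\<And>w. w \<in> \<Omega> \<Longrightarrow> \<exists>I. has_ou_integral F w I"
    and \<Omega>_cadlag: "\<And>w. w \<in> \<Omega> \<Longrightarrow> cadlag (\<lambda>t. ou F (wshift t w))"
    and \<Omega>_sde: "\<And>w s t. w \<in> \<Omega> \<Longrightarrow> s \<le> t \<Longrightarrow>
        ou F (wshift t w) = ou F (wshift s w)
          + (LBINT r=ereal s..ereal t. F *v ou F (wshift r w)) + (w t - w s)"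
    and \<Omega>_sublin: "\<And>w. w \<in> \<Omega> \<Longrightarrow>
        ((\<lambda>t. (1 / t) *\<^sub>R ou F (wshift t w)) \<longlongrightarrow> 0) at_infinity"
  shows "\<exists>\<delta>>0. \<forall>\<epsilon>. 0 < \<epsilon> \<and> \<epsilon> < \<delta> \<longrightarrow>
     (\<forall>w\<in>\<Omega>. \<forall>x0. \<exists>!u. u \<in> C_minus \<gamma> \<and> integral_system_solution S F g1 g2 \<sigma> \<epsilon> w x0 u) \<and>
     (\<forall>w\<in>\<Omega>. \<forall>z. \<exists>!u. random_ode_solution S F g1 g2 \<sigma> \<epsilon> w z u) \<and>
     (\<forall>w\<in>\<Omega>. \<forall>x0 u. u \<in> C_minus \<gamma> \<and> integral_system_solution S F g1 g2 \<sigma> \<epsilon> w x0 u \<longrightarrow>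
        (\<exists>y0. u 0 = (x0, y0) \<and> (\<forall>t\<le>0. u t = random_ode_flow S F g1 g2 \<sigma> \<epsilon> t w (x0, y0)))) \<and>
     random_dynamical_system (restrict_space P \<Omega>) wshift (random_ode_flow S F g1 g2 \<sigma> \<epsilon>) \<and>
     slow_manifold (restrict_space P \<Omega>) wshift (random_ode_flow S F g1 g2 \<sigma> \<epsilon>)
       (slow_set S F g1 g2 \<gamma> \<sigma> \<epsilon>) \<and>
     (\<forall>w\<in>\<Omega>. slow_set S F g1 g2 \<gamma> \<sigma> \<epsilon> w = {(x0, slow_graph S F g1 g2 \<gamma> \<sigma> \<epsilon> w x0) | x0. True}) \<and>
     (\<forall>w\<in>\<Omega>. (- K / ((\<gamma> + \<gamma>f) * (1 - slow_rho K \<gamma> \<gamma>s \<gamma>f \<epsilon>)))-lipschitz_on UNIV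
               (slow_graph S F g1 g2 \<gamma> \<sigma> \<epsilon> w))"
proof -
  let ?W = "restrict_space P \<Omega>"
  have space_W: "space ?W = \<Omega>"
    using sets.sets_into_space[OF \<Omega>_full(1)] by (auto simp: space_restrict_space)
  have tame: "tame (\<lambda>s. ou F (wshift s w))" if "w \<in> \<Omega>" for w
    by (rule cadlag_sublinear_tame[OF \<Omega>_cadlag[OF that] \<Omega>_sublin[OF that]])
  \<comment> \<open>Measurability of the coordinates is part of the Levy property, so the Skorokhod
    sigma-algebra need not be analysed.\<close>
  have eval: "(\<lambda>w. w t) \<in> borel_measurable P" for t
    using P_levy unfolding two_sided_stable_levy_def two_sided_levy_def by blast
  have ou_meas: "ou F \<in> borel_measurable ?W"
    by (rule borel_measurable_ou[OF eval \<Omega>_xi])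
  have shift_meas: "wshift t \<in> measurable ?W ?W" for t
  proof (rule measurable_restrict_space2)
    show "wshift t \<in> space ?W \<rightarrow> \<Omega>" unfolding space_W using \<Omega>_inv by blast
    show "wshift t \<in> measurable ?W P" by (rule measurable_restrict_space1[OF P_shift(1)])
  qed
  have meas: "(\<lambda>(s, w). ou F (wshift s w)) \<in> borel_measurable (borel \<Otimes>\<^sub>M ?W)"
  proof (rule jointly_measurable_right_continuous)
    show "(\<lambda>w. ou F (wshift s w)) \<in> borel_measurable ?W" for s
      by (rule measurable_compose[OF shift_meas ou_meas])
    fix w s assume "w \<in> space ?W"
    then show "((\<lambda>s. ou F (wshift s w)) \<longlongrightarrow> ou F (wshift s w)) (at_right s)"
      using \<Omega>_cadlag unfolding space_W cadlag_def by blast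
  qed
  \<comment> \<open>The fast constant \<open>cf\<close>, named outside the locale because it is
    needed before \<epsilon> is chosen.\<close>
  define k where "k = - K / (\<gamma> + \<gamma>f)"
  have neg: "\<gamma> + \<gamma>f < 0" using \<gamma> A2_pos by linarith
  have k: "0 < k" "k < 1"
    using neg \<gamma>(2) A2_pos by (simp_all add: k_def field_simps)
  \<comment> \<open>Solves \<open>\<delta> * K / \<gamma> = (1 - k)\<^sup>2 / 2\<close>; since
    \<open>cs\<close> is at most \<open>\<epsilon> * K / \<gamma>\<close>, every smaller \<epsilon>
    meets the hypothesis of \<open>small_parameter\<close>. The choice involves neither the path nor
    the initial value.\<close>
  define \<delta> where "\<delta> = \<gamma> * ((1 - k)\<^sup>2 / 2) / K"
  have "\<delta> > 0" using k \<gamma>(1) A2_pos by (simp add: \<delta>_def)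
  show ?thesis
  proof (rule exI[of _ \<delta>], rule conjI[OF \<open>\<delta> > 0\<close>], rule allI, rule impI, elim conjE)
    fix \<epsilon> :: real
    assume \<epsilon>: "0 < \<epsilon>" "\<epsilon> < \<delta>"
    interpret slow_fast S F g1 g2 \<sigma> \<gamma>s \<gamma>f K \<gamma> \<epsilon>
      by unfold_locales (fact \<sigma> \<epsilon>(1) A1_signs(1) A2_pos \<gamma> g_zero A1_S A1_F A2_1 A2_2)+
    have cf_k: "cf = k" by (simp add: cf_def k_def)
    have "cs \<le> \<epsilon> * K / \<gamma>"
      unfolding cs_def using \<epsilon> A2_pos \<gamma>(1) A1_signs(1)
      by (intro divide_left_mono mult_pos_pos add_pos_pos) auto
    also have "\<dots> < \<delta> * K / \<gamma>"
      using \<epsilon> A2_pos \<gamma>(1) by (intro divide_strict_right_mono mult_strict_right_mono) auto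
    also have "\<dots> = (1 - k)\<^sup>2 / 2" using A2_pos \<gamma>(1) by (simp add: \<delta>_def)
    finally have \<rho>: "cs + cf < 1" "cs + cf + cf / (1 - (cs + cf)) * cs < 1"
      unfolding cf_k by (intro small_parameter k cs_pos; assumption)+
    show "(\<forall>w\<in>\<Omega>. \<forall>x0. \<exists>!u. u \<in> C_minus \<gamma> \<and> integral_system_solution S F g1 g2 \<sigma> \<epsilon> w x0 u) \<and>
     (\<forall>w\<in>\<Omega>. \<forall>z. \<exists>!u. random_ode_solution S F g1 g2 \<sigma> \<epsilon> w z u) \<and>
     (\<forall>w\<in>\<Omega>. \<forall>x0 u. u \<in> C_minus \<gamma> \<and> integral_system_solution S F g1 g2 \<sigma> \<epsilon> w x0 u \<longrightarrow>
        (\<exists>y0. u 0 = (x0, y0) \<and> (\<forall>t\<le>0. u t = random_ode_flow S F g1 g2 \<sigma> \<epsilon> t w (x0, y0)))) \<and>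
     random_dynamical_system ?W wshift (random_ode_flow S F g1 g2 \<sigma> \<epsilon>) \<and>
     slow_manifold ?W wshift (random_ode_flow S F g1 g2 \<sigma> \<epsilon>) (slow_set S F g1 g2 \<gamma> \<sigma> \<epsilon>) \<and>
     (\<forall>w\<in>\<Omega>. slow_set S F g1 g2 \<gamma> \<sigma> \<epsilon> w = {(x0, slow_graph S F g1 g2 \<gamma> \<sigma> \<epsilon> w x0) | x0. True}) \<and>
     (\<forall>w\<in>\<Omega>. (- K / ((\<gamma> + \<gamma>f) * (1 - slow_rho K \<gamma> \<gamma>s \<gamma>f \<epsilon>)))-lipschitz_on UNIV
               (slow_graph S F g1 g2 \<gamma> \<sigma> \<epsilon> w))"
    proof (intro conjI ballI)
      fix w assume w: "w \<in> \<Omega>"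
      show "\<forall>x0. \<exists>!u. u \<in> C_minus \<gamma> \<and> integral_system_solution S F g1 g2 \<sigma> \<epsilon> w x0 u"
        unfolding integral_system_unique[OF \<rho>(1) tame[OF w]] by simp
      show "\<forall>z. \<exists>!u. random_ode_solution S F g1 g2 \<sigma> \<epsilon> w z u"
        using ex1_random_ode_solution[OF tame[OF w]] by blast
      show "\<forall>x0 u. u \<in> C_minus \<gamma> \<and> integral_system_solution S F g1 g2 \<sigma> \<epsilon> w x0 u \<longrightarrow>
          (\<exists>y0. u 0 = (x0, y0) \<and> (\<forall>t\<le>0. u t = random_ode_flow S F g1 g2 \<sigma> \<epsilon> t w (x0, y0)))"
        using integral_system_flow[OF \<rho>(1) tame[OF w]] by blast
      show "slow_set S F g1 g2 \<gamma> \<sigma> \<epsilon> w = {(x0, slow_graph S F g1 g2 \<gamma> \<sigma> \<epsilon> w x0) | x0. True}"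
        by (rule slow_set_graph[OF \<rho>(1) tame[OF w]])
      show "(- K / ((\<gamma> + \<gamma>f) * (1 - slow_rho K \<gamma> \<gamma>s \<gamma>f \<epsilon>)))-lipschitz_on UNIV
          (slow_graph S F g1 g2 \<gamma> \<sigma> \<epsilon> w)"
        by (rule slow_graph_lipschitz[OF \<rho>(1) tame[OF w]])
    next
      note facts = slow_manifold_system[of ?W, OF \<rho>(2,1) meas, unfolded space_W, OF tame \<Omega>_inv]
      show "random_dynamical_system ?W wshift (random_ode_flow S F g1 g2 \<sigma> \<epsilon>)"
        by (rule facts(1))
      show "slow_manifold ?W wshift (random_ode_flow S F g1 g2 \<sigma> \<epsilon>) (slow_set S F g1 g2 \<gamma> \<sigma> \<epsilon>)"
        by (rule facts(2))
    qed
  qed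
qed

end
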